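(* Let $T>0$. For each $\varepsilon>0$ let $\mathbf{BL}_\varepsilon$ satisfy $(\mathbf{H}_{\mathbf{BL}})$, let $\mathbb{M}_\varepsilon=(\mathbf{M}^k_\varepsilon)_{k=0..N}$ be a regular stratification of $\mathbb{R}^N$ adapted to $\mathbf{BL}_\varepsilon$, and let $H_\varepsilon$, $(H^k_\varepsilon)_{k=0..N}$ be the associated Hamiltonians and (HJB-SD)$_\varepsilon$ the associated problem. Assume that $\mathbb{M}_\varepsilon$ converges, in the sense of regular stratifications, to a regular stratification $\mathbb{M}=(\mathbf{M}^k)_{k=0..N}$ of $\mathbb{R}^N$. Then: (i) if, for all $\varepsilon>0$, $v_\varepsilon$ is a lower semicontinuous supersolution of (HJB-SD)$_\varepsilon$, then $\underline v=\liminf_* v_\varepsilon$ is a lower semicontinuous supersolution of the problem associated with $H=\limsup^*H_\varepsilon$, i.e. a viscosity supersolution of $\underline v_t+H(x,t,D\underline v)=0$ in $\mathbb{R}^N\times(0,T]$; (ii) if, for all $\varepsilon>0$, $u_\varepsilon$ is an upper semicontinuous subsolution of (HJB-SD)$_\varepsilon$ and if the Hamiltonians $(H^k_\varepsilon)_{k=0..N}$ satisfy (NC) and (TC) with constants uniform in $\varepsilon$, then $\bar u=\limsup^*u_\varepsilon$ is a subsolution of (HJB-SD) on $\mathbb{M}$ with $H^k=\liminf_*H^k_\varepsilon$ for every $k=0,\dots,N$, i.e. for each $k$ it is a viscosity subsolution of $\bar u_t+H^k(x,t,D\bar u)=0$ on $\mathbf{M}^k\times(0,T]$.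
   Context: **Assumption $(\mathbf{H}_{\mathbf{BL}})$.** A set-valued map $\mathbf{BL}:\mathbb{R}^N\times[0,T]\to\mathcal{P}(\mathbb{R}^{N+1})$ satisfies it if it has compact convex images, is upper semicontinuous, and there is $M>0$ with $\mathbf{BL}(x,t)\subset\{(b,l)\in\mathbb{R}^N\times\mathbb{R}:|b|\le M,\ |l|\le M\}$ for all $(x,t)$. **Admissible Flat Stratification (AFS).** Let $O\subset\mathbb{R}^N$ be open and $O=\mathbf{M}^0\cup\dots\cup\mathbf{M}^N$ with the $\mathbf{M}^k$ pairwise disjoint submanifolds (closures relative to $O$). This is an AFS of $O$ if: (i) for any $x\in\mathbf{M}^k$ there are $r>0$ and a $k$-dimensional linear subspace $V_k$ with $B(x,r)\cap\mathbf{M}^k=B(x,r)\cap(x+V_k)$, and $B(x,r)\cap\mathbf{M}^l=\emptyset$ if $l<k$; (ii) if $\mathbf{M}^k\cap\overline{\mathbf{M}^l}\ne\emptyset$ for some $l>k$ then $\mathbf{M}^k\subset\overline{\mathbf{M}^l}$; (iii) $\overline{\mathbf{M}^k}\subset\mathbf{M}^0\cup\dots\cup\mathbf{M}^k$. **Regular stratification.** $\mathbb{M}$ is a regular stratification of $\mathbb{R}^N$ if $\mathbb{R}^N=\mathbf{M}^0\cup\dots\cup\mathbf{M}^N$ (disjoint union) and for any $x$ there are $r=r(x)>0$ and a $C^{1,1}$ change of coordinates $\Psi^x:B(x,r)\to\mathbb{R}^N$ such that the sets $\Psi^x(\mathbf{M}^k\cap B(x,r))$ form an AFS of $\Psi^x(B(x,r))$.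 $T_x\mathbf{M}^k$ is the linear tangent space to $\mathbf{M}^k$ at $x$. $\mathbb{M}$ is adapted to $\mathbf{BL}$ if for every $k$ the map $(x,t)\mapsto\mathbf{BL}(x,t)\cap(T_x\mathbf{M}^k\times\mathbb{R})$ is continuous on $\mathbf{M}^k\times[0,T]$ for the Hausdorff distance. **Convergence of regular stratifications.** $\mathbb{M}_\varepsilon$ converges to $\mathbb{M}$ if for each $x\in\mathbb{R}^N$ there are $r>0$, an AFS $\mathbb{M}^\star=(\mathbf{M}^{\star,k})_k$ of $\mathbb{R}^N$ and, for any $\varepsilon>0$, changes of coordinates $\Psi^x_\varepsilon,\Psi^x$ on $B(x,r)$ as in the definition of regular stratification, with $\Psi^x_\varepsilon(x)=\Psi^x(x)$, such that for every $k$: $\Psi^x_\varepsilon(\mathbf{M}^k_\varepsilon\cap B(x,r))=\mathbf{M}^{\star,k}\cap\Psi^x_\varepsilon(B(x,r))$ and $\Psi^x(\mathbf{M}^k\cap B(x,r))=\mathbf{M}^{\star,k}\cap\Psi^x(B(x,r))$; and $\Psi^x_\varepsilon\to\Psi^x$ in $C^1(B(x,r))$ and the inverses, defined on $\Psi^x(B(x,r))$, converge in $C^1$ to $(\Psi^x)^{-1}$. **Hamiltonians.** $H_\varepsilon(x,t,p)=\sup_{(b,l)\in\mathbf{BL}_\varepsilon(x,t)}\{-b\cdot p-l\}$; for $x\in\mathbf{M}^k_\varepsilon$, $H^k_\varepsilon(x,t,p)=\sup\{-b\cdot p-l:(b,l)\in\mathbf{BL}_\varepsilon(x,t),\ b\in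 T_x\mathbf{M}^k_\varepsilon\}$. Rectified Hamiltonians near $x$: with $\chi_\varepsilon=(\Psi^x_\varepsilon)^{-1}$, for $y\in\mathbf{M}^{\star,k}$, $\tilde H^k_\varepsilon(y,t,q)=H^k_\varepsilon(\chi_\varepsilon(y),t,D\Psi^x_\varepsilon(\chi_\varepsilon(y))^{T}q)$; similarly $\tilde H^k$ from $H^k$ with $\Psi^x$. **Half-relaxed limits.** $\limsup^*f_\varepsilon(z)=\limsup_{z'\to z,\ \varepsilon\to0}f_\varepsilon(z')$ and $\liminf_*f_\varepsilon(z)=\liminf_{z'\to z,\ \varepsilon\to0}f_\varepsilon(z')$, with respect to all variables ($z=(x,t)$ for functions, $z=(x,t,p)$ for Hamiltonians). $H^k=\liminf_*H^k_\varepsilon$ means that the rectified Hamiltonians satisfy $\tilde H^k=\liminf_*\tilde H^k_\varepsilon$ (points taken in $\mathbf{M}^{\star,k}$). The half-relaxed limits $\underline v$, $\bar u$ are understood to be bounded functions, as required for being a super/subsolution. **(NC), (TC) with uniform constants.** For the rectified Hamiltonians $\tilde H^j_\varepsilon$ and the AFS $\mathbb{M}^\star$: for every point $z$, with $z\in\mathbf{M}^{\star,k}$ and $r,V_k$ as in (i) of AFS, $p=p_\top+p_\perp$ ($p_\top\in V_k$, $p_\perp\in V_k^\perp$), there are $C_1,C_2,\delta>0$ and a modulus $m$ with $m(0+)=0$, all independent of $\varepsilon$, such that (TC) for $k\le j\le N$, $t,t'\in[0,T]$, $y_1,y_2\in\mathbf{M}^{\star,j}\cap B(z,r)$ with $y_1-y_2\in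 V_k$: $|\tilde H^j_\varepsilon(y_1,t,p)-\tilde H^j_\varepsilon(y_2,t',p)|\le C_1\{|y_1-y_2|+m(|t-t'|)\}|p|+m(|y_1-y_2|+|t-t'|)$; (NC) for $k<j\le N$, $t\in[0,T]$, $y\in\mathbf{M}^{\star,j}\cap B(z,r)$, $p\in T_y\mathbf{M}^{\star,j}$: $\tilde H^j_\varepsilon(y,t,p)\ge\delta|p_\perp|-C_2(1+|p_\top|)$. **Sub/supersolutions of (HJB-SD).** Given Hamiltonians $H^k$ on strata $\mathbf{M}^k$, a bounded usc $u:\mathbb{R}^N\times[0,T]\to\mathbb{R}$ is a subsolution if for every $k=0,\dots,N$, every $C^1$ function $\phi$ and every local maximum point $(x,t)\in\mathbf{M}^k\times(0,T]$ of $u-\phi$ on $\mathbf{M}^k\times(0,T]$: $\phi_t(x,t)+H^k(x,t,D\phi(x,t))\le0$. A bounded lsc $v$ is a supersolution if for every $C^1$ function $\phi$ and every local minimum point $(x,t)$ of $v-\phi$ on $\mathbb{R}^N\times(0,T]$: $\phi_t(x,t)+H(x,t,D\phi(x,t))\ge0$. (HJB-SD)$_\varepsilon$ is the same with $\mathbb{M}_\varepsilon$, $H_\varepsilon$, $H^k_\varepsilon$.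
   Formalization: In (NC) the components p_⊤ and p_⊥ of p are also required to lie in T_yM^{*,j} (automatic if V_k ⊂ T_yM^{*,j}); without this, part (ii) fails for AFS in which a piece of a stratum approaches M^{*,k} obliquely. *)

theory Defs
  imports "HOL-Analysis.Analysis"
begin

(* R^N is a Euclidean space 'a with N = DIM('a).  A stratification is a family M :: nat => 'a set of
   which only the members M k with k <= DIM('a) matter.  Families indexed by the parameter
   epsilon > 0 are functions of a real argument e, used only for e > 0. *)

section \<open>Semicontinuity, half-relaxed limits, Hausdorff distance\<close>

definition usc_on :: "'z::metric_space set \<Rightarrow> ('z \<Rightarrow> real) \<Rightarrow> bool" where
  "usc_on S u \<longleftrightarrow> (\<forall>z\<in>S. \<forall>a>u z. \<forall>\<^sub>F z' in at z within S. u z' < a)"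

definition lsc_on :: "'z::metric_space set \<Rightarrow> ('z \<Rightarrow> real) \<Rightarrow> bool" where
  "lsc_on S v \<longleftrightarrow> (\<forall>z\<in>S. \<forall>a<v z. \<forall>\<^sub>F z' in at z within S. a < v z')"

(* Here f e is a function on the set S e.  The limit is taken over (z', e) -> (z, 0) with e > 0
   and z' in S e; the value z' = z is allowed, since only the pair (z, 0) itself is excluded. *)
definition relaxed_limsup ::
  "(real \<Rightarrow> 'z::metric_space set) \<Rightarrow> (real \<Rightarrow> 'z \<Rightarrow> ereal) \<Rightarrow> 'z \<Rightarrow> ereal" where
  "relaxed_limsup S f z = Limsup (at (z, 0) within {(z', e). 0 < e \<and> z' \<in> S e}) (\<lambda>(z', e). f e z')"

definition relaxed_liminf ::
  "(real \<Rightarrow> 'z::metric_space set) \<Rightarrow> (real \<Rightarrow> 'z \<Rightarrow> ereal) \<Rightarrow> 'z \<Rightarrow> ereal" where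
  "relaxed_liminf S f z = Liminf (at (z, 0) within {(z', e). 0 < e \<and> z' \<in> S e}) (\<lambda>(z', e). f e z')"

(* Valued in ennreal so that the empty set is at distance 0 from itself and at infinite distance
   from every nonempty set. *)
definition hausdorff_edist :: "'z::metric_space set \<Rightarrow> 'z set \<Rightarrow> ennreal" where
  "hausdorff_edist A B =
     max (SUP a\<in>A. INF b\<in>B. ennreal (dist a b)) (SUP b\<in>B. INF a\<in>A. ennreal (dist a b))"

definition hausdorff_continuous_on ::
  "'y::metric_space set \<Rightarrow> ('y \<Rightarrow> 'z::metric_space set) \<Rightarrow> bool" where
  "hausdorff_continuous_on S F \<longleftrightarrow>
     (\<forall>z\<in>S. ((\<lambda>z'. hausdorff_edist (F z') (F z)) \<longlongrightarrow> 0) (at z within S))"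


section \<open>Stratifications\<close>

definition flat_at ::
  "(nat \<Rightarrow> 'a::euclidean_space set) \<Rightarrow> nat \<Rightarrow> 'a \<Rightarrow> real \<Rightarrow> 'a set \<Rightarrow> bool" where
  "flat_at M k x r V \<longleftrightarrow>
     0 < r \<and> subspace V \<and> dim V = k \<and>
     ball x r \<inter> M k = ball x r \<inter> (\<lambda>v. x + v) ` V \<and>
     (\<forall>l<k. ball x r \<inter> M l = {})"

(* flat_at already makes each M k a k-dimensional submanifold. *)
definition flat_stratification ::
  "'a::euclidean_space set \<Rightarrow> (nat \<Rightarrow> 'a set) \<Rightarrow> bool" where
  "flat_stratification W M \<longleftrightarrow>
     open W \<and> W = (\<Union>k\<le>DIM('a). M k) \<and> disjoint_family_on M {..DIM('a)} \<and>
     (\<forall>k\<le>DIM('a). \<forall>x\<in>M k. \<exists>r V. flat_at M k x r V) \<and>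
     (\<forall>k\<le>DIM('a). \<forall>l\<le>DIM('a). k < l \<and> M k \<inter> closure (M l) \<noteq> {} \<longrightarrow> M k \<subseteq> closure (M l)) \<and>
     (\<forall>k\<le>DIM('a). W \<inter> closure (M k) \<subseteq> (\<Union>j\<le>k. M j))"

(* C^{1,1} diffeomorphism of a ball onto its image: by the inverse function theorem the image is
   open and the inverse is again (locally) C^{1,1}. *)
definition C11_coordinates ::
  "'a::euclidean_space \<Rightarrow> real \<Rightarrow> ('a \<Rightarrow> 'a) \<Rightarrow> bool" where
  "C11_coordinates x r \<Psi> \<longleftrightarrow>
     inj_on \<Psi> (ball x r) \<and>
     (\<forall>y\<in>ball x r. \<Psi> differentiable (at y) \<and> bij (frechet_derivative \<Psi> (at y))) \<and>
     (\<exists>L. \<forall>y\<in>ball x r. \<forall>z\<in>ball x r.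
        onorm (\<lambda>h. frechet_derivative \<Psi> (at y) h - frechet_derivative \<Psi> (at z) h) \<le> L * dist y z)"

definition flattening ::
  "(nat \<Rightarrow> 'a::euclidean_space set) \<Rightarrow> 'a \<Rightarrow> real \<Rightarrow> ('a \<Rightarrow> 'a) \<Rightarrow> bool" where
  "flattening M x r \<Psi> \<longleftrightarrow>
     0 < r \<and> C11_coordinates x r \<Psi> \<and>
     flat_stratification (\<Psi> ` ball x r) (\<lambda>k. \<Psi> ` (M k \<inter> ball x r))"

definition regular_stratification :: "(nat \<Rightarrow> 'a::euclidean_space set) \<Rightarrow> bool" where
  "regular_stratification M \<longleftrightarrow>
     (\<Union>k\<le>DIM('a). M k) = UNIV \<and> disjoint_family_on M {..DIM('a)} \<and>
     (\<forall>x. \<exists>r \<Psi>. flattening M x r \<Psi>)"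

(* Velocities at x of the C^1 curves that stay in M; for a submanifold, its linear tangent space. *)
definition tangent_space :: "'a::euclidean_space set \<Rightarrow> 'a \<Rightarrow> 'a set" where
  "tangent_space M x =
     {v. \<exists>\<gamma> d. 0 < d \<and> \<gamma> C1_differentiable_on {-d<..<d} \<and> \<gamma> ` {-d<..<d} \<subseteq> M \<and>
          \<gamma> 0 = x \<and> (\<gamma> has_vector_derivative v) (at 0)}"

(* Convergence f e -> g in C^1 as e -> 0+, uniformly on D e. *)
definition C1_converges ::
  "(real \<Rightarrow> 'a::euclidean_space set) \<Rightarrow> (real \<Rightarrow> 'a \<Rightarrow> 'a) \<Rightarrow> ('a \<Rightarrow> 'a) \<Rightarrow> bool" where
  "C1_converges D f g \<longleftrightarrow>
     (\<forall>\<eta>>0. \<forall>\<^sub>F e in at_right 0. \<forall>y\<in>D e.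
        dist (f e y) (g y) < \<eta> \<and>
        onorm (\<lambda>h. frechet_derivative (f e) (at y) h - frechet_derivative g (at y) h) < \<eta>)"

(* The chart data at x witnessing the convergence of the stratifications Me e to M.  The inverse of
   \<Psi>e e lives on \<Psi>e e ` ball x r and that of \<Psi> on \<Psi> ` ball x r; they are compared where both
   are defined. *)
definition convergence_chart ::
  "(real \<Rightarrow> nat \<Rightarrow> 'a::euclidean_space set) \<Rightarrow> (nat \<Rightarrow> 'a set) \<Rightarrow>
   'a \<Rightarrow> real \<Rightarrow> (nat \<Rightarrow> 'a set) \<Rightarrow> (real \<Rightarrow> 'a \<Rightarrow> 'a) \<Rightarrow> ('a \<Rightarrow> 'a) \<Rightarrow> bool" where
  "convergence_chart Me M x r Ms \<Psi>e \<Psi> \<longleftrightarrow>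
     0 < r \<and> flat_stratification UNIV Ms \<and> flattening M x r \<Psi> \<and>
     (\<forall>k\<le>DIM('a). \<Psi> ` (M k \<inter> ball x r) = Ms k \<inter> \<Psi> ` ball x r) \<and>
     (\<forall>e>0. flattening (Me e) x r (\<Psi>e e) \<and> \<Psi>e e x = \<Psi> x \<and>
        (\<forall>k\<le>DIM('a). \<Psi>e e ` (Me e k \<inter> ball x r) = Ms k \<inter> \<Psi>e e ` ball x r)) \<and>
     C1_converges (\<lambda>e. ball x r) \<Psi>e \<Psi> \<and>
     C1_converges (\<lambda>e. \<Psi> ` ball x r \<inter> \<Psi>e e ` ball x r)
       (\<lambda>e. inv_into (ball x r) (\<Psi>e e)) (inv_into (ball x r) \<Psi>)"

definition stratifications_converge ::
  "(real \<Rightarrow> nat \<Rightarrow> 'a::euclidean_space set) \<Rightarrow> (nat \<Rightarrow> 'a set) \<Rightarrow> bool" where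
  "stratifications_converge Me M \<longleftrightarrow> (\<forall>x. \<exists>r Ms \<Psi>e \<Psi>. convergence_chart Me M x r Ms \<Psi>e \<Psi>)"


section \<open>Control data and Hamiltonians\<close>

definition H_BL ::
  "real \<Rightarrow> ('a::euclidean_space \<times> real \<Rightarrow> ('a \<times> real) set) \<Rightarrow> bool" where
  "H_BL T BL \<longleftrightarrow>
     (\<forall>z\<in>UNIV \<times> {0..T}. compact (BL z) \<and> convex (BL z)) \<and>
     (\<forall>z\<in>UNIV \<times> {0..T}. \<forall>U. open U \<and> BL z \<subseteq> U \<longrightarrow>
        (\<forall>\<^sub>F z' in at z within UNIV \<times> {0..T}. BL z' \<subseteq> U)) \<and>
     (\<exists>K>0. \<forall>z\<in>UNIV \<times> {0..T}. BL z \<subseteq> {(b, l). norm b \<le> K \<and> \<bar>l\<bar> \<le> K})"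

definition adapted ::
  "real \<Rightarrow> ('a::euclidean_space \<times> real \<Rightarrow> ('a \<times> real) set) \<Rightarrow> (nat \<Rightarrow> 'a set) \<Rightarrow> bool" where
  "adapted T BL M \<longleftrightarrow>
     (\<forall>k\<le>DIM('a). hausdorff_continuous_on (M k \<times> {0..T})
        (\<lambda>(x, t). BL (x, t) \<inter> (tangent_space (M k) x \<times> UNIV)))"

(* Suprema are taken in ereal: an empty set of admissible (b, l) gives the value -\<infinity>. *)
definition hamiltonian ::
  "('a::euclidean_space \<times> real \<Rightarrow> ('a \<times> real) set) \<Rightarrow> 'a \<Rightarrow> real \<Rightarrow> 'a \<Rightarrow> ereal" where
  "hamiltonian BL x t p = (SUP (b, l)\<in>BL (x, t). ereal (- (b \<bullet> p) - l))"

definition stratum_hamiltonian ::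
  "('a::euclidean_space \<times> real \<Rightarrow> ('a \<times> real) set) \<Rightarrow> (nat \<Rightarrow> 'a set) \<Rightarrow>
   nat \<Rightarrow> 'a \<Rightarrow> real \<Rightarrow> 'a \<Rightarrow> ereal" where
  "stratum_hamiltonian BL M k x t p =
     (SUP (b, l)\<in>{(b, l) \<in> BL (x, t). b \<in> tangent_space (M k) x}. ereal (- (b \<bullet> p) - l))"

(* Meaningful for y in \<Psi> ` B. *)
definition rectified ::
  "'a::euclidean_space set \<Rightarrow> ('a \<Rightarrow> 'a) \<Rightarrow> ('a \<Rightarrow> real \<Rightarrow> 'a \<Rightarrow> ereal) \<Rightarrow> 'a \<Rightarrow> real \<Rightarrow> 'a \<Rightarrow> ereal" where
  "rectified B \<Psi> H y t q =
     (let x = inv_into B \<Psi> y in H x t (adjoint (frechet_derivative \<Psi> (at x)) q))"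

(* H k = liminf_* (He e k) on the k-th stratum, read in the chart (r, Ms, \<Psi>e, \<Psi>) at x: the
   rectification of H k is the lower half-relaxed limit of the rectifications of He e k, with
   the points taken in Ms k (and in the image of the chart \<Psi>e e). *)
definition rectified_liminf ::
  "real \<Rightarrow> (real \<Rightarrow> nat \<Rightarrow> 'a::euclidean_space \<Rightarrow> real \<Rightarrow> 'a \<Rightarrow> ereal) \<Rightarrow>
   (nat \<Rightarrow> 'a \<Rightarrow> real \<Rightarrow> 'a \<Rightarrow> ereal) \<Rightarrow>
   'a \<Rightarrow> real \<Rightarrow> (nat \<Rightarrow> 'a set) \<Rightarrow> (real \<Rightarrow> 'a \<Rightarrow> 'a) \<Rightarrow> ('a \<Rightarrow> 'a) \<Rightarrow> bool" where
  "rectified_liminf T He H x r Ms \<Psi>e \<Psi> \<longleftrightarrow>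
     (\<forall>k\<le>DIM('a). \<forall>y\<in>Ms k \<inter> \<Psi> ` ball x r. \<forall>t\<in>{0..T}. \<forall>q.
        rectified (ball x r) \<Psi> (H k) y t q =
        relaxed_liminf (\<lambda>e. (Ms k \<inter> \<Psi>e e ` ball x r) \<times> {0..T} \<times> UNIV)
          (\<lambda>e (y, t, q). rectified (ball x r) (\<Psi>e e) (He e k) y t q) (y, t, q))"


section \<open>Tangential continuity and normal controllability\<close>

definition modulus :: "(real \<Rightarrow> real) \<Rightarrow> bool" where
  "modulus m \<longleftrightarrow> (\<forall>s\<ge>0. 0 \<le> m s) \<and> mono_on {0..} m \<and> (m \<longlongrightarrow> 0) (at_right 0)"

(* In the next three definitions G e j is the rectified Hamiltonian of index j, D e the set on which
   the chart makes it meaningful, and V = V_k the flat direction of the stratum through z. *)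

(* In ereal, |(-\<infinity>) - (-\<infinity>)| = \<infinity>, so this includes finiteness of the Hamiltonians. *)
definition TC ::
  "real \<Rightarrow> (nat \<Rightarrow> 'a::euclidean_space set) \<Rightarrow> (real \<Rightarrow> 'a set) \<Rightarrow>
   (real \<Rightarrow> nat \<Rightarrow> 'a \<Rightarrow> real \<Rightarrow> 'a \<Rightarrow> ereal) \<Rightarrow>
   nat \<Rightarrow> 'a \<Rightarrow> real \<Rightarrow> 'a set \<Rightarrow> real \<Rightarrow> (real \<Rightarrow> real) \<Rightarrow> bool" where
  "TC T Ms D G k z r V C1 m \<longleftrightarrow>
     (\<forall>e>0. \<forall>j. k \<le> j \<and> j \<le> DIM('a) \<longrightarrow>
        (\<forall>t\<in>{0..T}. \<forall>t'\<in>{0..T}.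
           \<forall>y1\<in>Ms j \<inter> ball z r \<inter> D e. \<forall>y2\<in>Ms j \<inter> ball z r \<inter> D e. y1 - y2 \<in> V \<longrightarrow>
             (\<forall>p. \<bar>G e j y1 t p - G e j y2 t' p\<bar>
                  \<le> ereal (C1 * (norm (y1 - y2) + m \<bar>t - t'\<bar>) * norm p
                            + m (norm (y1 - y2) + \<bar>t - t'\<bar>)))))"

(* A covector p in the tangent space of Ms j at y is split as pt + pn along V and its orthogonal
   complement.  The splitting takes place inside that tangent space, which is a condition on Ms
   around z: it holds whenever V is contained in the tangent space (the intended picture, strata
   near z being unions of translates of V), but it excludes a piece of Ms j approaching z
   obliquely to V, along which the inequality alone gives no control in the directions normal
   to V. *)
definition NC ::
  "real \<Rightarrow> (nat \<Rightarrow> 'a::euclidean_space set) \<Rightarrow> (real \<Rightarrow> 'a set) \<Rightarrow>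
   (real \<Rightarrow> nat \<Rightarrow> 'a \<Rightarrow> real \<Rightarrow> 'a \<Rightarrow> ereal) \<Rightarrow>
   nat \<Rightarrow> 'a \<Rightarrow> real \<Rightarrow> 'a set \<Rightarrow> real \<Rightarrow> real \<Rightarrow> bool" where
  "NC T Ms D G k z r V C2 \<delta> \<longleftrightarrow>
     (\<forall>e>0. \<forall>j. k < j \<and> j \<le> DIM('a) \<longrightarrow>
        (\<forall>t\<in>{0..T}. \<forall>y\<in>Ms j \<inter> ball z r \<inter> D e. \<forall>p\<in>tangent_space (Ms j) y.
           \<exists>pt\<in>V \<inter> tangent_space (Ms j) y. \<exists>pn\<in>orthogonal_comp V \<inter> tangent_space (Ms j) y.
             p = pt + pn \<and> G e j y t p \<ge> ereal (\<delta> * norm pn - C2 * (1 + norm pt))))"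

definition uniform_NC_TC ::
  "real \<Rightarrow> (real \<Rightarrow> nat \<Rightarrow> 'a::euclidean_space \<Rightarrow> real \<Rightarrow> 'a \<Rightarrow> ereal) \<Rightarrow>
   'a \<Rightarrow> real \<Rightarrow> (nat \<Rightarrow> 'a set) \<Rightarrow> (real \<Rightarrow> 'a \<Rightarrow> 'a) \<Rightarrow> ('a \<Rightarrow> 'a) \<Rightarrow> bool" where
  "uniform_NC_TC T He x r Ms \<Psi>e \<Psi> \<longleftrightarrow>
     (let D = (\<lambda>e. \<Psi>e e ` ball x r);
          G = (\<lambda>e j. rectified (ball x r) (\<Psi>e e) (He e j))
      in \<forall>k\<le>DIM('a). \<forall>z\<in>Ms k \<inter> \<Psi> ` ball x r. \<exists>\<rho> V. flat_at Ms k z \<rho> V \<and>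
           (\<exists>C1>0. \<exists>C2>0. \<exists>\<delta>>0. \<exists>m. modulus m \<and>
              TC T Ms D G k z \<rho> V C1 m \<and> NC T Ms D G k z \<rho> V C2 \<delta>))"


section \<open>Viscosity sub- and supersolutions\<close>

definition local_max_on :: "'z::metric_space set \<Rightarrow> ('z \<Rightarrow> real) \<Rightarrow> 'z \<Rightarrow> bool" where
  "local_max_on S f z \<longleftrightarrow> z \<in> S \<and> (\<forall>\<^sub>F z' in at z within S. f z' \<le> f z)"

definition local_min_on :: "'z::metric_space set \<Rightarrow> ('z \<Rightarrow> real) \<Rightarrow> 'z \<Rightarrow> bool" where
  "local_min_on S f z \<longleftrightarrow> z \<in> S \<and> (\<forall>\<^sub>F z' in at z within S. f z \<le> f z')"

(* \<phi> is C^1 on space-time with spatial gradient D\<phi> and time derivative \<phi>t. *)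
definition C1_test ::
  "('a::euclidean_space \<times> real \<Rightarrow> real) \<Rightarrow> ('a \<times> real \<Rightarrow> 'a) \<Rightarrow> ('a \<times> real \<Rightarrow> real) \<Rightarrow> bool" where
  "C1_test \<phi> D\<phi> \<phi>t \<longleftrightarrow>
     (\<forall>z. (\<phi> has_derivative (\<lambda>(h, s). D\<phi> z \<bullet> h + \<phi>t z * s)) (at z)) \<and>
     continuous_on UNIV D\<phi> \<and> continuous_on UNIV \<phi>t"

definition supersolution ::
  "real \<Rightarrow> ('a::euclidean_space \<Rightarrow> real \<Rightarrow> 'a \<Rightarrow> ereal) \<Rightarrow> ('a \<times> real \<Rightarrow> real) \<Rightarrow> bool" where
  "supersolution T H v \<longleftrightarrow>
     bounded (v ` (UNIV \<times> {0..T})) \<and> lsc_on (UNIV \<times> {0..T}) v \<and>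
     (\<forall>\<phi> D\<phi> \<phi>t. C1_test \<phi> D\<phi> \<phi>t \<longrightarrow>
        (\<forall>x t. local_min_on (UNIV \<times> {0<..T}) (\<lambda>z. v z - \<phi> z) (x, t) \<longrightarrow>
           ereal (\<phi>t (x, t)) + H x t (D\<phi> (x, t)) \<ge> 0))"

definition subsolution ::
  "real \<Rightarrow> (nat \<Rightarrow> 'a::euclidean_space set) \<Rightarrow> (nat \<Rightarrow> 'a \<Rightarrow> real \<Rightarrow> 'a \<Rightarrow> ereal) \<Rightarrow>
   ('a \<times> real \<Rightarrow> real) \<Rightarrow> bool" where
  "subsolution T M H u \<longleftrightarrow>
     bounded (u ` (UNIV \<times> {0..T})) \<and> usc_on (UNIV \<times> {0..T}) u \<and>
     (\<forall>k\<le>DIM('a). \<forall>\<phi> D\<phi> \<phi>t. C1_test \<phi> D\<phi> \<phi>t \<longrightarrow>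
        (\<forall>x t. local_max_on (M k \<times> {0<..T}) (\<lambda>z. u z - \<phi> z) (x, t) \<longrightarrow>
           ereal (\<phi>t (x, t)) + H k x t (D\<phi> (x, t)) \<le> 0))"

end

theory Submission
  imports Defs
begin

text \<open>
  Both parts rest on the stability of maxima: if \<open>ubar\<close> is the upper half-relaxed limit of \<open>u e\<close>
  and \<open>g e\<close> tends to \<open>g0\<close> uniformly on a compact set \<open>K\<close>, then along a sequence the maximizers of
  \<open>u e - g e\<close> over \<open>K\<close> converge to a point where \<open>ubar - g0\<close> is at least as large as at any
  prescribed point of the relative interior of \<open>K\<close> (\<open>maximizers_converge\<close>).

  For supersolutions this is applied to \<open>- v e\<close>. Subtracting the squared distance to a minimum point
  of \<open>vlow - \<phi>\<close> makes that minimum strict, so the limit point is the given one, and the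
  inequalities at the approximating points pass to the upper half-relaxed limit of the Hamiltonians.

  For subsolutions the inequality on the stratum \<open>M k\<close> only concerns the restriction of \<open>ubar\<close> to
  \<open>M k\<close>, whereas \<open>ubar\<close> is a limit of values of \<open>u e\<close> on all strata. Let \<open>z\<close> be the image of
  the point \<open>x\<close> in the chart at \<open>x\<close>, \<open>V\<close> the flat direction of \<open>Ms k\<close> at \<open>z\<close> and \<open>P\<close> the
  projection onto the orthogonal complement of \<open>V\<close>. One maximizes
  \<open>u e - \<phi> - dist\<^sup>2 - C |P (\<Psi>e e y - z)|\<close> over a small neighbourhood; the last term vanishes
  exactly on the \<open>k\<close>-th stratum, and for large \<open>C\<close> it keeps the maximizers away from the boundary
  of the neighbourhood (\<open>penalization_strict\<close>). If a maximizer lay on a stratum of dimension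
  \<open>j > k\<close>, the test function would have there a gradient with normal part of size \<open>C\<close>, and normal
  controllability would make the Hamiltonian of that stratum larger than a multiple of \<open>C\<close>,
  contradicting the subsolution property (\<open>normal_penalty_inactive\<close>). So the maximizers lie on
  the \<open>k\<close>-th strata, where the penalty vanishes, and one passes to the limit in the rectified
  Hamiltonians.

  The Hamiltonian of a stratum only sees the component of the gradient tangent to the stratum, so the
  argument requires that the normal direction \<open>P (y - z)\<close> of the penalty at a point \<open>y\<close> of \<open>Ms j\<close>
  be tangent to \<open>Ms j\<close>. This comes from the geometry: a flat stratification is conical near each
  of its points, that is, \<open>y - z\<close> is tangent to the stratum of \<open>y\<close> once \<open>y\<close> is close to \<open>z\<close>
  (\<open>flat_stratification_conical\<close>), and the splitting in the normal controllability condition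
  then puts \<open>P (y - z)\<close> in the tangent space as well.
\<close>

section \<open>Half-relaxed limits and convergence of maximizers\<close>

lemma usc_on_sequentially:
  assumes "usc_on S u" "z \<in> S" "\<And>n. X n \<in> S" "X \<longlonglongrightarrow> z" "u z < a"
  shows "\<forall>\<^sub>F n in sequentially. u (X n) < a"
proof -
  have "\<forall>\<^sub>F z' in at z within S. u z' < a"
    using assms unfolding usc_on_def by blast
  then obtain d where d: "d > 0" "\<And>y. y \<in> S \<Longrightarrow> y \<noteq> z \<Longrightarrow> dist y z < d \<Longrightarrow> u y < a"
    unfolding eventually_at by blast
  have "\<forall>\<^sub>F n in sequentially. dist (X n) z < d"
    using assms(4) d(1) tendstoD by blast
  then show ?thesis
    by (rule eventually_mono) (metis assms(3,5) d(2))
qed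

text \<open>
  A maximizing sequence has a cluster point, where semicontinuity bounds the supremum by the
  value. The supremum is taken in the extended reals, so its finiteness is part of the
  conclusion.
\<close>
lemma usc_attains_max:
  fixes u :: "'z::metric_space \<Rightarrow> real"
  assumes "usc_on S u" "K \<subseteq> S" "compact K" "K \<noteq> {}" "continuous_on K g"
  obtains w where "w \<in> K" "\<And>y. y \<in> K \<Longrightarrow> u y - g y \<le> u w - g w"
proof -
  define s where "s = (SUP y\<in>K. ereal (u y - g y))"
  have ne: "(\<lambda>y. ereal (u y - g y)) ` K \<noteq> {}" using assms(4) by simp
  obtain Y :: "nat \<Rightarrow> ereal" where "incseq Y"
      "range Y \<subseteq> (\<lambda>y. ereal (u y - g y)) ` K" "s = (SUP n. Y n)"
    using Sup_countable_SUP[OF ne] unfolding s_def by auto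
  then have Y: "\<And>n. Y n \<in> (\<lambda>y. ereal (u y - g y)) ` K" "Y \<longlonglongrightarrow> s"
    using LIMSEQ_SUP[of Y] by auto
  then obtain X where X: "\<And>n. X n \<in> K" "\<And>n. Y n = ereal (u (X n) - g (X n))"
    unfolding image_iff by metis
  obtain w r where w: "w \<in> K" "strict_mono r" "(X \<circ> r) \<longlonglongrightarrow> w"
    using assms(3) X(1) unfolding compact_eq_seq_compact_metric seq_compact_def by blast
  have "(\<lambda>n. g ((X \<circ> r) n)) \<longlonglongrightarrow> g w"
    using assms(5) X(1) w unfolding continuous_on_sequentially comp_def by auto
  then have g: "\<forall>\<^sub>F n in sequentially. g w - \<eta> < g (X (r n))" if "\<eta> > 0" for \<eta>
    using that by (auto dest!: order_tendstoD(1)[where a = "g w - \<eta>"])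
  have sle: "s \<le> ereal (u w - g w + 2 * \<eta>)" if "\<eta> > 0" for \<eta>
  proof -
    have "\<forall>\<^sub>F n in sequentially. u ((X \<circ> r) n) < u w + \<eta>"
      by (rule usc_on_sequentially[OF assms(1) _ _ w(3)]) (use w X assms(2) that in auto)
    with g[OF that] have "\<forall>\<^sub>F n in sequentially. (Y \<circ> r) n \<le> ereal (u w - g w + 2 * \<eta>)"
      by eventually_elim (auto simp: X(2))
    moreover have "(Y \<circ> r) \<longlonglongrightarrow> s"
      using Y(2) w(2) by (rule LIMSEQ_subseq_LIMSEQ)
    ultimately show ?thesis
      unfolding comp_def by (intro tendsto_upperbound) auto
  qed
  have "u y - g y \<le> u w - g w" if "y \<in> K" for y
  proof (rule field_le_epsilon)
    fix e :: real assume "e > 0"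
    have "ereal (u y - g y) \<le> s" unfolding s_def using that by (rule SUP_upper)
    also have "s \<le> ereal (u w - g w + 2 * (e/2))" using sle[of "e/2"] \<open>e > 0\<close> by simp
    finally show "u y - g y \<le> u w - g w + e" by simp
  qed
  with w(1) show ?thesis by (rule that)
qed

lemma filterlim_relaxed:
  fixes E :: "nat \<Rightarrow> real"
  assumes "X \<longlonglongrightarrow> z" "E \<longlonglongrightarrow> 0" "\<And>n. 0 < E n" "\<And>n. X n \<in> S (E n)"
  shows "filterlim (\<lambda>n. (X n, E n)) (at (z, 0) within {(z', e). 0 < e \<and> z' \<in> S e}) sequentially"
proof -
  have "E n \<noteq> 0" for n using assms(3)[of n] by simp
  then show ?thesis
    unfolding filterlim_at using assms by (auto intro!: tendsto_Pair)
qed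

text \<open>
  The half-relaxed limit dominates the limit along every admissible sequence. Together with
  its lower analogue, this is how limits of viscosity inequalities are recovered.
\<close>
lemma limsup_le_relaxed_limsup:
  assumes "X \<longlonglongrightarrow> z" "E \<longlonglongrightarrow> 0" "\<And>n. 0 < E n" "\<And>n. X n \<in> S (E n)"
  shows "limsup (\<lambda>n. f (E n) (X n)) \<le> relaxed_limsup S f z"
  unfolding Limsup_le_iff
proof safe
  fix y assume "relaxed_limsup S f z < y"
  then have "\<forall>\<^sub>F p in at (z, 0) within {(z', e). 0 < e \<and> z' \<in> S e}. (case p of (z', e) \<Rightarrow> f e z') < y"
    unfolding relaxed_limsup_def by (rule Limsup_lessD)
  from eventually_compose_filterlim[OF this filterlim_relaxed[OF assms]]
  show "\<forall>\<^sub>F n in sequentially. f (E n) (X n) < y" by simp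
qed

lemma relaxed_liminf_uminus: "relaxed_liminf S f z = - relaxed_limsup S (\<lambda>e z. - f e z) z"
  unfolding relaxed_liminf_def relaxed_limsup_def
  by (simp add: ereal_Limsup_uminus case_prod_unfold)

lemma relaxed_liminf_le_liminf:
  assumes "X \<longlonglongrightarrow> z" "E \<longlonglongrightarrow> 0" "\<And>n. 0 < E n" "\<And>n. X n \<in> S (E n)"
  shows "relaxed_liminf S f z \<le> liminf (\<lambda>n. f (E n) (X n))"
  using limsup_le_relaxed_limsup[OF assms, of "\<lambda>e z. - f e z"]
  by (simp add: relaxed_liminf_uminus ereal_Limsup_uminus ereal_uminus_le_reorder)

lemma relaxed_limsup_lessD:
  assumes "relaxed_limsup S f z < a"
  obtains d where "0 < d" "\<And>z' e. 0 < e \<Longrightarrow> e < d \<Longrightarrow> z' \<in> S e \<Longrightarrow> dist z' z < d \<Longrightarrow> f e z' < a"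
proof -
  have "\<forall>\<^sub>F p in at (z, 0) within {(z', e). 0 < e \<and> z' \<in> S e}. (case p of (z', e) \<Rightarrow> f e z') < a"
    using assms unfolding relaxed_limsup_def by (rule Limsup_lessD)
  then obtain d where d: "d > 0"
    "\<And>z' e. 0 < e \<Longrightarrow> z' \<in> S e \<Longrightarrow> dist (z', e) (z, 0) < d \<Longrightarrow> f e z' < a"
    unfolding eventually_at by fastforce
  show ?thesis
  proof (rule that[of "d/2"])
    fix z' and e :: real assume e: "0 < e" "e < d/2" "z' \<in> S e" "dist z' z < d/2"
    have "dist (z', e) (z, 0) \<le> dist z' z + \<bar>e\<bar>"
      using sqrt_sum_squares_le_sum_abs[of "dist z' z" e] by (simp add: dist_Pair_Pair)
    with e show "f e z' < a" by (intro d(2)) auto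
  qed (use d in auto)
qed

lemma usc_on_relaxed_limsup:
  fixes f :: "real \<Rightarrow> 'z::metric_space \<Rightarrow> ereal"
  assumes "\<And>z. z \<in> S \<Longrightarrow> ereal (ubar z) = relaxed_limsup (\<lambda>e. S) f z"
  shows "usc_on S ubar"
  unfolding usc_on_def
proof (intro ballI allI impI)
  fix z a assume z: "z \<in> S" and a: "ubar z < a"
  define b where "b = (ubar z + a) / 2"
  have b: "ubar z < b" "b < a" using a by (auto simp: b_def)
  have "relaxed_limsup (\<lambda>e. S) f z < ereal b" using b(1) assms[OF z, symmetric] by simp
  then obtain d where d: "0 < d"
    "\<And>z' e. 0 < e \<Longrightarrow> e < d \<Longrightarrow> z' \<in> S \<Longrightarrow> dist z' z < d \<Longrightarrow> f e z' < ereal b"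
    by (rule relaxed_limsup_lessD) blast
  have "ubar y < a" if y: "y \<in> S" "dist y z < d/2" for y
  proof -
    have "relaxed_limsup (\<lambda>e. S) f y \<le> ereal b"
      unfolding relaxed_limsup_def
    proof (rule Limsup_bounded)
      show "\<forall>\<^sub>F p in at (y, 0) within {(z', e). 0 < e \<and> z' \<in> S}. (case p of (z', e) \<Rightarrow> f e z') \<le> ereal b"
        unfolding eventually_at
      proof (intro exI[of _ "d/2"] conjI ballI impI)
        fix p :: "'z \<times> real" assume p: "p \<in> {(z', e). 0 < e \<and> z' \<in> S}" "p \<noteq> (y, 0) \<and> dist p (y, 0) < d/2"
        obtain z' e where pe: "p = (z', e)" by (cases p)
        have "dist z' y < d/2" "e < d/2"
          using p pe dist_fst_le[of p "(y,0)"] dist_snd_le[of p "(y,0)"]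
          by (auto simp: dist_real_def)
        then have "dist z' z < d" using y(2) dist_triangle[of z' z y] by linarith
        then show "(case p of (z', e) \<Rightarrow> f e z') \<le> ereal b"
          using p pe \<open>e < d/2\<close> d by (auto intro!: less_imp_le)
      qed (use d in auto)
    qed
    then show ?thesis using assms[OF y(1), symmetric] b(2) by simp
  qed
  then show "\<forall>\<^sub>F z' in at z within S. ubar z' < a"
    unfolding eventually_at using d(1) by (intro exI[of _ "d/2"]) auto
qed

lemma relaxed_limsup_approx:
  fixes u :: "real \<Rightarrow> 'z::metric_space \<Rightarrow> real"
  assumes "ereal c = relaxed_limsup (\<lambda>e. S) (\<lambda>e z. ereal (u e z)) z"
  obtains E X where "\<And>n. 0 < E n" "E \<longlonglongrightarrow> 0" "\<And>n. X n \<in> S" "X \<longlonglongrightarrow> z"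
    "\<And>n. c - inverse (real (Suc n)) < u (E n) (X n)"
proof -
  have "\<exists>e x. 0 < e \<and> e < \<eta> \<and> x \<in> S \<and> dist x z < \<eta> \<and> c - \<eta> < u e x" if "\<eta> > 0" for \<eta>
  proof (rule ccontr)
    assume neg: "\<not> ?thesis"
    have "relaxed_limsup (\<lambda>e. S) (\<lambda>e z. ereal (u e z)) z \<le> ereal (c - \<eta>)"
      unfolding relaxed_limsup_def
    proof (rule Limsup_bounded)
      show "\<forall>\<^sub>F p in at (z, 0) within {(z', e). 0 < e \<and> z' \<in> S}. (case p of (z', e) \<Rightarrow> ereal (u e z')) \<le> ereal (c - \<eta>)"
        unfolding eventually_at
      proof (intro exI[of _ \<eta>] conjI ballI impI)
        fix p :: "'z \<times> real" assume p: "p \<in> {(z', e). 0 < e \<and> z' \<in> S}" "p \<noteq> (z, 0) \<and> dist p (z, 0) < \<eta>"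
        obtain z' e where pe: "p = (z', e)" by (cases p)
        have "dist z' z < \<eta>" "e < \<eta>"
          using p pe dist_fst_le[of p "(z,0)"] dist_snd_le[of p "(z,0)"]
          by (auto simp: dist_real_def)
        then show "(case p of (z', e) \<Rightarrow> ereal (u e z')) \<le> ereal (c - \<eta>)"
          using p pe neg by fastforce
      qed (use that in auto)
    qed
    with assms[symmetric] that show False by simp
  qed
  then have "\<forall>n. \<exists>e x. 0 < e \<and> e < inverse (real (Suc n)) \<and> x \<in> S \<and> dist x z < inverse (real (Suc n))
      \<and> c - inverse (real (Suc n)) < u e x"
    by simp
  then obtain E X where EX: "\<And>n. 0 < E n" "\<And>n. E n < inverse (real (Suc n))" "\<And>n. X n \<in> S"
    "\<And>n. dist (X n) z < inverse (real (Suc n))" "\<And>n. c - inverse (real (Suc n)) < u (E n) (X n)"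
    by metis
  have "E \<longlonglongrightarrow> 0"
    by (rule tendsto_sandwich[OF _ _ tendsto_const LIMSEQ_inverse_real_of_nat])
       (use EX in \<open>auto intro!: always_eventually less_imp_le\<close>)
  moreover have "X \<longlonglongrightarrow> z"
    unfolding tendsto_dist_iff[of X]
    by (rule tendsto_sandwich[OF _ _ tendsto_const LIMSEQ_inverse_real_of_nat])
       (use EX in \<open>auto intro!: always_eventually less_imp_le\<close>)
  ultimately show ?thesis using that EX by blast
qed

lemma relaxed_limsup_seq_less:
  assumes "ereal c = relaxed_limsup (\<lambda>e. S) (\<lambda>e z. ereal (u e z)) z"
    "\<And>n. 0 < E n" "E \<longlonglongrightarrow> 0" "\<And>n. X n \<in> S" "X \<longlonglongrightarrow> z" "c < a"
  shows "\<forall>\<^sub>F n in sequentially. u (E n) (X n) < a"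
proof -
  have "limsup (\<lambda>n. ereal (u (E n) (X n))) < ereal a"
    using limsup_le_relaxed_limsup[OF assms(5,3,2), of "\<lambda>e. S" "\<lambda>e z. ereal (u e z)"] assms(1,4,6)
    by (metis ereal_less_eq(3) le_less_trans less_ereal.simps(1))
  from Limsup_lessD[OF this] show ?thesis by simp
qed

text \<open>
  Follow maximizers over the compact set \<open>K\<close> along parameters for which \<open>u e\<close> nearly attains
  \<open>ubar z\<close> close to \<open>z\<close>. Comparing with these nearby points bounds the maxima from below,
  and the definition of \<open>ubar\<close> bounds them from above at a cluster point.
\<close>
lemma maximizers_converge:
  fixes u g :: "real \<Rightarrow> 'z::metric_space \<Rightarrow> real"
  assumes K: "compact K" "K \<subseteq> S" and z: "z \<in> K" "open U" "z \<in> U" "S \<inter> U \<subseteq> K"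
    and usc: "\<And>e. 0 < e \<Longrightarrow> usc_on S (u e)"
    and g: "\<And>e. 0 < e \<Longrightarrow> continuous_on K (g e)" "continuous_on K g0"
      "uniform_limit K g g0 (at_right 0)"
    and ubar: "\<And>z. z \<in> S \<Longrightarrow> ereal (ubar z) = relaxed_limsup (\<lambda>e. S) (\<lambda>e z. ereal (u e z)) z"
  obtains E W w where "\<And>n. 0 < E n" "E \<longlonglongrightarrow> 0" "\<And>n. W n \<in> K" "w \<in> K" "W \<longlonglongrightarrow> w"
    "\<And>n y. y \<in> K \<Longrightarrow> u (E n) y - g (E n) y \<le> u (E n) (W n) - g (E n) (W n)"
    "ubar z - g0 z \<le> ubar w - g0 w"
proof -
  have zS: "z \<in> S" using z(1) K(2) by blast
  obtain E X where EX: "\<And>n. 0 < E n" "E \<longlonglongrightarrow> 0" "\<And>n. X n \<in> S" "X \<longlonglongrightarrow> z"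
    "\<And>n. ubar z - inverse (real (Suc n)) < u (E n) (X n)"
    using relaxed_limsup_approx[OF ubar[OF zS]] by blast
  have "\<forall>n. \<exists>w\<in>K. \<forall>y\<in>K. u (E n) y - g (E n) y \<le> u (E n) w - g (E n) w"
    using usc_attains_max[OF usc K(2,1) _ g(1)] EX(1) z(1) by (metis empty_iff)
  then obtain W where W: "\<And>n. W n \<in> K"
      "\<And>n y. y \<in> K \<Longrightarrow> u (E n) y - g (E n) y \<le> u (E n) (W n) - g (E n) (W n)"
    by metis
  obtain w r where w: "w \<in> K" "strict_mono r" "(W \<circ> r) \<longlonglongrightarrow> w"
    using K(1) W(1) unfolding compact_eq_seq_compact_metric seq_compact_def by blast
  have Er: "filterlim (E \<circ> r) (at_right 0) sequentially"
    using LIMSEQ_subseq_LIMSEQ[OF EX(2) w(2)] EX(1) unfolding filterlim_at by (auto simp: less_imp_neq[symmetric])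
  have XK: "\<forall>\<^sub>F n in sequentially. X n \<in> K"
    using topological_tendstoD[OF EX(4) z(2,3)] by (rule eventually_mono) (use EX(3) z(4) in auto)
  have "ubar z - g0 z \<le> ubar w - g0 w + \<eta>" if "\<eta> > 0" for \<eta>
  proof -
    define h where "h = \<eta> / 8"
    have h: "h > 0" using that by (simp add: h_def)
    have unif: "\<forall>\<^sub>F n in sequentially. \<forall>y\<in>K. dist (g ((E \<circ> r) n) y) (g0 y) < h"
      using eventually_compose_filterlim[OF uniform_limitD[OF g(3) h] Er] .
    have xr: "(X \<circ> r) \<longlonglongrightarrow> z" by (rule LIMSEQ_subseq_LIMSEQ[OF EX(4) w(2)])
    have xK: "\<forall>\<^sub>F n in sequentially. X (r n) \<in> K"
      using eventually_subseq[OF w(2) XK] .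
    have g0c: "\<forall>\<^sub>F n in sequentially. dist (g0 (Y n)) (g0 y) < h"
      if "\<forall>\<^sub>F n in sequentially. Y n \<in> K" "Y \<longlonglongrightarrow> y" "y \<in> K" for Y y
      using continuous_on_tendsto_compose[OF g(2) that(2,3,1)] h by (rule tendstoD)
    have "\<forall>\<^sub>F n in sequentially. u ((E \<circ> r) n) ((W \<circ> r) n) < ubar w + h"
      by (rule relaxed_limsup_seq_less[OF ubar])
        (use w K(2) EX LIMSEQ_subseq_LIMSEQ[OF EX(2) w(2)] W(1) h in \<open>auto simp: comp_def\<close>)
    moreover have "\<forall>\<^sub>F n in sequentially. inverse (real (Suc n)) < h"
      using LIMSEQ_inverse_real_of_nat h by (rule order_tendstoD)
    then have "\<forall>\<^sub>F n in sequentially. inverse (real (Suc (r n))) < h"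
      using eventually_subseq[OF w(2)] by blast
    moreover have "\<forall>\<^sub>F n in sequentially. dist (g0 (X (r n))) (g0 z) < h"
      using g0c[of "X \<circ> r" z] xK xr z(1) by simp
    moreover have "\<forall>\<^sub>F n in sequentially. dist (g0 (W (r n))) (g0 w) < h"
      using g0c[of "W \<circ> r" w] W(1) w by simp
    ultimately have "\<forall>\<^sub>F n in sequentially. ubar z - g0 z \<le> ubar w - g0 w + \<eta>"
      using unif xK
    proof eventually_elim
      case (elim n)
      have "dist (g (E (r n)) (X (r n))) (g0 (X (r n))) < h" "dist (g (E (r n)) (W (r n))) (g0 (W (r n))) < h"
        using elim(5,6) W(1) by auto
      moreover have "u (E (r n)) (X (r n)) - g (E (r n)) (X (r n)) \<le> u (E (r n)) (W (r n)) - g (E (r n)) (W (r n))"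
        using W(2) elim(6) by blast
      moreover have "ubar z - inverse (real (Suc (r n))) < u (E (r n)) (X (r n))" by (rule EX(5))
      ultimately show ?case
        using elim(1-4) h unfolding h_def dist_real_def abs_less_iff comp_def by linarith
    qed
    then show ?thesis by simp
  qed
  then have "ubar z - g0 z \<le> ubar w - g0 w" by (rule field_le_epsilon)
  then show ?thesis
    using that[of "E \<circ> r" "W \<circ> r" w] EX(1) LIMSEQ_subseq_LIMSEQ[OF EX(2) w(2)] W w by simp
qed

section \<open>Tangent spaces of flat strata\<close>

lemma flat_atD:
  assumes "flat_at M k x r V"
  shows "0 < r" "subspace V" "dim V = k"
    "\<And>y. y \<in> ball x r \<Longrightarrow> y \<in> M k \<longleftrightarrow> y - x \<in> V"
    "\<And>y l. y \<in> ball x r \<Longrightarrow> y \<in> M l \<Longrightarrow> k \<le> l"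
proof -
  show "0 < r" "subspace V" "dim V = k" using assms by (auto simp: flat_at_def)
  show "y \<in> M k \<longleftrightarrow> y - x \<in> V" if "y \<in> ball x r" for y
  proof -
    have "y \<in> M k \<longleftrightarrow> y \<in> (\<lambda>v. x + v) ` V"
      using assms that unfolding flat_at_def by blast
    also have "\<dots> \<longleftrightarrow> y - x \<in> V"
      by (metis (no_types, lifting) add_diff_cancel_left' diff_add_cancel add.commute image_iff)
    finally show ?thesis .
  qed
  show "k \<le> l" if "y \<in> ball x r" "y \<in> M l" for y l
    using assms that unfolding flat_at_def by (metis IntI empty_iff not_le)
qed

text \<open>
  The difference quotients of \<open>\<gamma>\<close> at \<open>0\<close> eventually lie in \<open>V\<close>, which is closed. The
  curve is only differentiated at \<open>0\<close>, so that the lemma also applies to images of curves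
  under a chart.
\<close>
lemma velocity_in_flat:
  assumes flat: "flat_at M k y r V"
    and \<gamma>: "\<gamma> 0 = y" "(\<gamma> has_vector_derivative v) (at 0)" "\<forall>\<^sub>F s in at 0. \<gamma> s \<in> M k"
  shows "v \<in> V"
proof -
  note f = flat_atD[OF flat]
  have lim: "((\<lambda>s. (1/s) *\<^sub>R (\<gamma> s - y)) \<longlongrightarrow> v) (at 0)"
  proof -
    have "((\<lambda>s. (1 / norm s) *\<^sub>R (\<gamma> s - (y + s *\<^sub>R v))) \<longlongrightarrow> 0) (at 0)"
      using \<gamma>(1,2) unfolding has_vector_derivative_def has_derivative_at_within
      by (simp add: inverse_eq_divide diff_diff_eq)
    then have "((\<lambda>s. norm ((1 / norm s) *\<^sub>R (\<gamma> s - (y + s *\<^sub>R v)))) \<longlongrightarrow> 0) (at 0)"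
      by (rule tendsto_norm_zero)
    also have "?this \<longleftrightarrow> ((\<lambda>s. norm ((1/s) *\<^sub>R (\<gamma> s - y) - v)) \<longlongrightarrow> 0) (at 0)"
    proof (rule tendsto_cong, unfold eventually_at_filter, intro always_eventually allI impI)
      fix s :: real assume "s \<noteq> 0"
      then have "(1/s) *\<^sub>R (\<gamma> s - y) - v = (1/s) *\<^sub>R (\<gamma> s - (y + s *\<^sub>R v))"
        by (simp add: algebra_simps)
      then show "norm ((1 / norm s) *\<^sub>R (\<gamma> s - (y + s *\<^sub>R v))) = norm ((1/s) *\<^sub>R (\<gamma> s - y) - v)"
        by simp
    qed
    finally show ?thesis by (rule LIM_zero_cancel[OF tendsto_norm_zero_cancel])
  qed
  have "continuous (at 0) \<gamma>" using \<gamma>(2) has_vector_derivative_continuous by blast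
  then have "(\<gamma> \<longlongrightarrow> y) (at 0)" using \<gamma>(1) by (simp add: continuous_at)
  then have "\<forall>\<^sub>F s in at 0. \<gamma> s \<in> ball y r"
    using f(1) by (intro topological_tendstoD) auto
  with \<gamma>(3) have "\<forall>\<^sub>F s in at 0. (1/s) *\<^sub>R (\<gamma> s - y) \<in> V"
    by eventually_elim (metis f(2,4) subspace_scale)
  with lim show ?thesis
    using closed_subspace[OF f(2)] by (intro Lim_in_closed_set[of V]) auto
qed

lemma flat_at_mono:
  assumes "flat_at M k x r V" "y \<in> M k" "y \<in> ball x r"
  shows "flat_at M k y (r - dist x y) V"
proof -
  note f = flat_atD[OF assms(1)]
  have yx: "y - x \<in> V" using f(4) assms by blast
  have sub: "w \<in> ball x r" if "w \<in> ball y (r - dist x y)" for w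
    using that dist_triangle[of x w y] by (simp add: dist_commute)
  have "w \<in> M k \<longleftrightarrow> w \<in> (\<lambda>v. y + v) ` V" if "w \<in> ball y (r - dist x y)" for w
  proof -
    have "w \<in> M k \<longleftrightarrow> w - x \<in> V" using f(4) sub[OF that] by blast
    also have "\<dots> \<longleftrightarrow> w - y \<in> V"
      using subspace_add[OF f(2) _ yx, of "w - y"] subspace_diff[OF f(2) _ yx, of "w - x"] by auto
    also have "\<dots> \<longleftrightarrow> w \<in> (\<lambda>v. y + v) ` V"
      by (metis (no_types, lifting) add_diff_cancel_left' diff_add_cancel add.commute image_iff)
    finally show ?thesis .
  qed
  moreover have "ball y (r - dist x y) \<inter> M l = {}" if "l < k" for l
    using f(5) sub that by fastforce
  ultimately show ?thesis
    using f assms unfolding flat_at_def by auto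
qed

text \<open>
  In a flat stratum straight segments realize every direction of \<open>V\<close>. Hence \<open>V\<close> is
  determined by the stratum, and it is constant along each flat piece.
\<close>
lemma tangent_space_flat:
  assumes "flat_at M k y r V"
  shows "tangent_space (M k) y = V"
proof
  note f = flat_atD[OF assms]
  show "tangent_space (M k) y \<subseteq> V"
  proof
    fix v assume "v \<in> tangent_space (M k) y"
    then obtain \<gamma> d where g: "0 < d" "\<gamma> ` {-d<..<d} \<subseteq> M k" "\<gamma> 0 = y"
      "(\<gamma> has_vector_derivative v) (at 0)"
      unfolding tangent_space_def by blast
    have "\<forall>\<^sub>F s in at 0. \<gamma> s \<in> M k"
      unfolding eventually_at using g(1,2) by (intro exI[of _ d]) (auto simp: dist_real_def image_subset_iff abs_less_iff)
    with assms g(3,4) show "v \<in> V" by (rule velocity_in_flat)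
  qed
  show "V \<subseteq> tangent_space (M k) y"
  proof
    fix v assume v: "v \<in> V"
    define \<gamma> where "\<gamma> s = y + s *\<^sub>R v" for s :: real
    have \<gamma>0: "\<gamma> 0 = y" by (simp add: \<gamma>_def)
    define d where "d = r / (norm v + 1)"
    have d: "d > 0" using f(1) by (simp add: d_def add_nonneg_pos)
    have "\<gamma> s \<in> M k" if "s \<in> {-d<..<d}" for s
    proof -
      have "\<bar>s\<bar> * norm v \<le> \<bar>s\<bar> * (norm v + 1)" by (intro mult_left_mono) auto
      also have "\<dots> < d * (norm v + 1)"
        using that by (intro mult_strict_right_mono) (auto simp: add_nonneg_pos)
      also have "\<dots> = r"
        using norm_ge_zero[of v] unfolding d_def by (simp add: add_nonneg_eq_0_iff)
      finally have "\<gamma> s \<in> ball y r" by (simp add: \<gamma>_def dist_norm)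
      moreover have "\<gamma> s - y \<in> V" using v f(2) by (simp add: \<gamma>_def subspace_scale)
      ultimately show ?thesis using f(4) by blast
    qed
    then have im: "\<gamma> ` {-d<..<d} \<subseteq> M k" by blast
    have vd: "(\<gamma> has_vector_derivative v) (at s)" for s
      unfolding \<gamma>_def by (auto intro!: derivative_eq_intros)
    have C1: "\<gamma> C1_differentiable_on {-d<..<d}"
      unfolding C1_differentiable_on_def
      using vd continuous_on_const by (intro exI[of _ "\<lambda>_. v"]) blast
    show "v \<in> tangent_space (M k) y"
      unfolding tangent_space_def mem_Collect_eq
      by (rule exI[of _ \<gamma>], rule exI[of _ d]) (intro conjI d C1 im \<gamma>0 vd)
  qed
qed

lemma tangent_space_near:
  assumes "flat_at M k x r V" "y \<in> M k" "y \<in> ball x r"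
  shows "tangent_space (M k) y = V"
  using tangent_space_flat[OF flat_at_mono[OF assms]] .

lemma stratum_flat:
  fixes M :: "nat \<Rightarrow> 'a::euclidean_space set"
  assumes "flat_stratification UNIV M" "j \<le> DIM('a)" "y \<in> M j"
  obtains r where "flat_at M j y r (tangent_space (M j) y)"
  using assms tangent_space_flat unfolding flat_stratification_def by metis

lemma closure_stratum:
  fixes M :: "nat \<Rightarrow> 'a::euclidean_space set"
  assumes "flat_stratification UNIV M" "j \<le> DIM('a)" "y \<in> closure (M j)"
  obtains l where "l \<le> j" "y \<in> M l"
proof -
  have "UNIV \<inter> closure (M j) \<subseteq> (\<Union>l\<le>j. M l)"
    using assms(1,2) unfolding flat_stratification_def by blast
  then show ?thesis using assms(3) that by blast
qed

section \<open>Orthogonal projection along a subspace\<close>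

definition normal_projection :: "'a::euclidean_space set \<Rightarrow> ('a \<Rightarrow> 'a) \<Rightarrow> bool" where
  "normal_projection V P \<longleftrightarrow> subspace V \<and> linear P \<and> (\<forall>x. x - P x \<in> V) \<and> (\<forall>x. \<forall>v\<in>V. P x \<bullet> v = 0)"

lemma normal_projection_exists:
  assumes "subspace V"
  obtains P where "normal_projection V P"
proof -
  obtain B where B: "B \<subseteq> V" "pairwise orthogonal B" "\<And>x. x \<in> B \<Longrightarrow> norm x = 1"
    "independent B" "card B = dim V" "span B = V"
    using orthonormal_basis_subspace[OF assms(1)] by blast
  have finB: "finite B" using B(4) independent_imp_finite by blast
  define p where "p x = (\<Sum>b\<in>B. (x \<bullet> b) *\<^sub>R b)" for x
  have lin: "linear p" unfolding p_def
    by (intro linear_compose_sum ballI linearI) (auto simp: inner_add_left scaleR_add_left)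
  have pV: "p x \<in> V" for x
    unfolding p_def using B(1) assms(1) by (intro subspace_sum subspace_scale) auto
  have ortho_b: "(x - p x) \<bullet> b = 0" if "b \<in> B" for x b
  proof -
    have "p x \<bullet> b = (\<Sum>c\<in>B. if c = b then x \<bullet> b else 0)"
      unfolding p_def inner_sum_left
    proof (rule sum.cong)
      fix c assume "c \<in> B"
      then show "(x \<bullet> c) *\<^sub>R c \<bullet> b = (if c = b then x \<bullet> b else 0)"
        using B(2,3) that by (auto simp: pairwise_def orthogonal_def norm_eq_1)
    qed simp
    then show ?thesis using finB that by (simp add: inner_diff_left)
  qed
  have "(x - p x) \<bullet> w = 0" if "w \<in> V" for x w
    using orthogonal_to_span[of w B "x - p x"] that B(6) ortho_b by (auto simp: orthogonal_def)
  moreover have "linear (\<lambda>x. x - p x)" by (intro linear_compose_sub linear_id[unfolded id_def] lin)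
  ultimately show ?thesis
    using that[of "\<lambda>x. x - p x"] pV assms unfolding normal_projection_def by simp
qed

lemma normal_projectionD:
  assumes "normal_projection V P"
  shows "linear P" "subspace V" "x - P x \<in> V" "v \<in> V \<Longrightarrow> P x \<bullet> v = 0"
  using assms unfolding normal_projection_def by auto

lemma normal_projection_eq_0:
  assumes "normal_projection V P"
  shows "P v = 0 \<longleftrightarrow> v \<in> V"
proof
  note P = normal_projectionD[OF assms]
  show "v \<in> V" if "P v = 0" using P(3)[of v] that by simp
  assume "v \<in> V"
  then have "v - (v - P v) \<in> V" using P(2,3) subspace_diff by blast
  then have "P v \<bullet> P v = 0" by (intro P(4)) simp
  then show "P v = 0" by simp
qed

lemma normal_projection_fixes:
  assumes "normal_projection V P" "\<And>v. v \<in> V \<Longrightarrow> n \<bullet> v = 0"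
  shows "P n = n"
proof -
  note P = normal_projectionD[OF assms(1)]
  have "(n - P n) \<bullet> (n - P n) = 0"
    using assms(2)[OF P(3)] P(4)[OF P(3)] by (simp add: inner_diff_left)
  then show ?thesis by simp
qed

lemma normal_projection_norm:
  assumes "normal_projection V P"
  shows "norm (P x) \<le> norm x" "norm (x - P x) \<le> norm x"
proof -
  have "orthogonal (P x) (x - P x)"
    using normal_projectionD(4)[OF assms normal_projectionD(3)[OF assms]] by (simp add: orthogonal_def)
  from norm_add_Pythagorean[OF this]
  have eq: "(norm x)\<^sup>2 = (norm (P x))\<^sup>2 + (norm (x - P x))\<^sup>2" by simp
  show "norm (P x) \<le> norm x" by (rule power2_le_imp_le) (use eq in auto)
  show "norm (x - P x) \<le> norm x" by (rule power2_le_imp_le) (use eq in auto)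
qed

text \<open>
  The orthogonal projection of \<open>T\<close> to the smaller space \<open>V\<close> has a nontrivial kernel.
\<close>
lemma orthogonal_direction:
  fixes V T :: "'a::euclidean_space set"
  assumes "subspace V" "subspace T" "dim V < dim T"
  obtains \<tau> where "\<tau> \<in> T" "norm \<tau> = 1" "\<And>v. v \<in> V \<Longrightarrow> \<tau> \<bullet> v = 0"
proof -
  obtain P where P: "normal_projection V P" using normal_projection_exists[OF assms(1)] .
  define p where "p x = x - P x" for x
  have lin: "linear p" unfolding p_def
    by (intro linear_compose_sub linear_id[unfolded id_def] normal_projectionD(1)[OF P])
  have pV: "p x \<in> V" for x unfolding p_def by (rule normal_projectionD(3)[OF P])
  have "\<not> inj_on p T"
  proof
    assume "inj_on p T"
    then have "dim (p ` T) = dim T"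
      using dim_image_eq[OF lin, of T] assms(2) by (metis span_eq_iff)
    moreover have "dim (p ` T) \<le> dim V" using pV by (intro dim_subset) auto
    ultimately show False using assms(3) by simp
  qed
  then obtain v where v: "v \<in> T" "v \<noteq> 0" "p v = 0"
    using linear_inj_on_iff_eq_0[OF lin assms(2)] by blast
  then have "P v = v" by (simp add: p_def)
  then have orth: "v \<bullet> w = 0" if "w \<in> V" for w
    using normal_projectionD(4)[OF P that, of v] by simp
  show ?thesis
    by (rule that[of "v /\<^sub>R norm v"]) (use v orth assms(2) in \<open>auto intro: subspace_scale\<close>)
qed

section \<open>Flat stratifications are conical\<close>

lemma segment_last_point:
  fixes f g :: "'a::real_normed_vector"
  assumes C: "closed C" and f: "f \<in> C" and g: "g \<notin> C"
  obtains s where "0 \<le> s" "s < 1" "f + s *\<^sub>R (g - f) \<in> C"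
    "\<And>s'. s < s' \<Longrightarrow> s' \<le> 1 \<Longrightarrow> f + s' *\<^sub>R (g - f) \<notin> C"
proof -
  define S where "S = {0..1} \<inter> (\<lambda>s. f + s *\<^sub>R (g - f)) -` C"
  have "closed S" unfolding S_def
    by (intro continuous_closed_preimage C closed_atLeastAtMost continuous_intros)
  then have "compact S" using compact_Int_closed[of "{0..1}" S] by (simp add: S_def Int_absorb1)
  moreover have "0 \<in> S" using f by (simp add: S_def)
  ultimately obtain s where s: "s \<in> S" "\<And>s'. s' \<in> S \<Longrightarrow> s' \<le> s"
    using compact_attains_sup[of S] by blast
  have "s \<noteq> 1" using s(1) g by (auto simp: S_def)
  then have "0 \<le> s" "s < 1" using s(1) by (auto simp: S_def)
  moreover have "f + s' *\<^sub>R (g - f) \<notin> C" if "s < s'" "s' \<le> 1" for s'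
    using s(2)[of s'] that \<open>0 \<le> s\<close> by (auto simp: S_def)
  ultimately show ?thesis using that s(1) by (auto simp: S_def)
qed

text \<open>
  Suppose that the lower strata are conical at \<open>z\<close> inside a ball and that the plane \<open>A\<close>
  through a flat piece of \<open>M j\<close> misses \<open>z\<close>. Then this piece is dense in the part of \<open>A\<close>
  inside the ball. Indeed its frontier in \<open>A\<close> consists of points of lower strata; at such a
  point \<open>w\<close>, on \<open>M l\<close> say, the tangent space of \<open>M l\<close> contains \<open>z - w\<close>, which is not
  parallel to \<open>A\<close>. So \<open>M l\<close> meets \<open>A\<close> in dimension at most \<open>l - 1 \<le> j - 2\<close>, and a set of
  codimension two cannot separate a piece of \<open>A\<close> from its complement.
\<close>
lemma bad_plane_filled:
  fixes M :: "nat \<Rightarrow> 'a::euclidean_space set"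
  assumes strat: "flat_stratification UNIV M" and j: "j \<le> DIM('a)"
    and lower: "\<And>i w. i < j \<Longrightarrow> w \<in> M i \<Longrightarrow> w \<in> ball z \<rho> \<Longrightarrow> z - w \<in> tangent_space (M i) w"
    and y: "y \<in> M j" "y \<in> ball z \<rho>" and T: "T = tangent_space (M j) y" and bad: "z - y \<notin> T"
    and b: "b \<in> ball z \<rho>" "b - y \<in> T"
  shows "b \<in> closure {a \<in> M j. tangent_space (M j) a = T \<and> a - y \<in> T}"
proof (rule ccontr)
  obtain r0 where "flat_at M j y r0 T" using stratum_flat[OF strat j y(1)] T by metis
  note sT = flat_atD(2)[OF this] and dT = flat_atD(3)[OF this]
  define A where "A = {a. a - y \<in> T}"
  define F where "F = {a \<in> M j. tangent_space (M j) a = T \<and> a \<in> A}"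
  define B where "B = ball z \<rho>"
  assume "b \<notin> closure {a \<in> M j. tangent_space (M j) a = T \<and> a - y \<in> T}"
  then have nb: "b \<notin> closure F" by (simp add: F_def A_def)
  have A_diff: "a - a' \<in> T" if "a \<in> A" "a' \<in> A" for a a'
    using subspace_diff[OF sT, of "a - y" "a' - y"] that by (simp add: A_def)
  have A_add: "a + v \<in> A" if "a \<in> A" "v \<in> T" for a v
    using subspace_add[OF sT, of "a - y" v] that by (simp add: A_def algebra_simps)
  have A_seg: "a + s *\<^sub>R (a' - a) \<in> A" if "a \<in> A" "a' \<in> A" for a a' s
    using A_add[OF that(1) subspace_scale[OF sT A_diff[OF that(2,1)]]] .
  have B_seg: "a + s *\<^sub>R (a' - a) \<in> ball x d"
    if "a \<in> ball x d" "a' \<in> ball x d" "0 \<le> s" "s \<le> 1" for a a' x :: 'a and s d :: real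
    using convexD_alt[OF convex_ball that] by (simp add: algebra_simps)
  have yF: "y \<in> F" using y(1) T subspace_0[OF sT] by (simp add: F_def A_def)
  have F_open: "\<exists>d>0. \<forall>a'\<in>A. dist a a' < d \<longrightarrow> a' \<in> F" if a: "a \<in> F" for a
  proof -
    have "a \<in> M j" "a \<in> A" "tangent_space (M j) a = T" using a by (auto simp: F_def)
    then obtain r where r: "flat_at M j a r T" using stratum_flat[OF strat j] by metis
    show ?thesis
    proof (intro exI[of _ r] conjI ballI impI)
      show "0 < r" using flat_atD(1)[OF r] .
      fix a' assume a': "a' \<in> A" "dist a a' < r"
      then have "a' \<in> M j" using flat_atD(4)[OF r, of a'] A_diff[OF a'(1) \<open>a \<in> A\<close>] by simp
      moreover from this have "tangent_space (M j) a' = T"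
        using a'(2) by (intro tangent_space_near[OF r]) auto
      ultimately show "a' \<in> F" using a' by (simp add: F_def)
    qed
  qed
  \<comment> \<open>\<open>Fr\<close> is the frontier, relative to the plane, of the closure of the flat piece \<open>F\<close>,
    not of \<open>F\<close> itself: near each of its points there are both points of \<open>F\<close> and an open
    part of the plane outside the closure.\<close>
  define Fr where "Fr = {w \<in> A \<inter> B \<inter> closure F. \<forall>\<epsilon>>0. \<exists>a\<in>A \<inter> ball w \<epsilon>. a \<notin> closure F}"
  have Fr_I: "\<exists>s. 0 \<le> s \<and> s < 1 \<and> f + s *\<^sub>R (g - f) \<in> Fr"
    if fg: "f \<in> A \<inter> B" "g \<in> A \<inter> B" "f \<in> closure F" "g \<notin> closure F" for f g
  proof -
    obtain s where s: "0 \<le> s" "s < 1" "f + s *\<^sub>R (g - f) \<in> closure F"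
      "\<And>s'. s < s' \<Longrightarrow> s' \<le> 1 \<Longrightarrow> f + s' *\<^sub>R (g - f) \<notin> closure F"
      using segment_last_point[OF closed_closure fg(3,4)] by blast
    define w where "w = f + s *\<^sub>R (g - f)"
    have "\<exists>a\<in>A \<inter> ball w \<epsilon>. a \<notin> closure F" if "\<epsilon> > 0" for \<epsilon>
    proof -
      define h where "h = min (1 - s) (\<epsilon> / (2 * (norm (g - f) + 1)))"
      have h: "0 < h" "s + h \<le> 1" using s(2) that by (auto simp: h_def add_nonneg_pos)
      have half: "\<epsilon> / (2 * c) * c = \<epsilon> / 2" if "c > 0" for c :: real using that by simp
      have "h * norm (g - f) \<le> h * (norm (g - f) + 1)" using h(1) by simp
      also have "\<dots> \<le> \<epsilon> / (2 * (norm (g - f) + 1)) * (norm (g - f) + 1)"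
        by (intro mult_right_mono) (auto simp: h_def)
      also have "\<dots> = \<epsilon> / 2" by (rule half) (simp add: add_nonneg_pos)
      also have "\<dots> < \<epsilon>" using that by simp
      finally have "f + (s + h) *\<^sub>R (g - f) \<in> ball w \<epsilon>"
        using h by (simp add: w_def dist_norm algebra_simps flip: scaleR_diff_right)
      moreover have "f + (s + h) *\<^sub>R (g - f) \<notin> closure F" using h s(4) by simp
      ultimately show ?thesis using A_seg fg by blast
    qed
    moreover have "w \<in> A \<inter> B" unfolding w_def B_def
      using A_seg[of f g s] B_seg[of f z \<rho> g s] fg s by (auto simp: B_def)
    ultimately show ?thesis using s by (auto simp: Fr_def w_def intro!: exI[of _ s])
  qed
  have Fr_lower: "\<exists>l<j. w \<in> M l" if w: "w \<in> Fr" for w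
  proof -
    have wA: "w \<in> A" "w \<in> closure F" using w by (auto simp: Fr_def)
    then have "w \<in> closure (M j)" using closure_mono[of F "M j"] by (auto simp: F_def)
    then obtain l where l: "l \<le> j" "w \<in> M l" by (rule closure_stratum[OF strat j])
    have "l \<noteq> j"
    proof
      assume "l = j"
      with l have wj: "w \<in> M j" by simp
      then obtain r where r: "flat_at M j w r (tangent_space (M j) w)"
        using stratum_flat[OF strat j] by metis
      obtain f where f: "f \<in> F" "dist f w < r"
        using wA(2) flat_atD(1)[OF r] unfolding closure_approachable by blast
      have "tangent_space (M j) w = T"
        using tangent_space_near[OF r, of f] f by (auto simp: F_def dist_commute)
      then have "w \<in> F" using wA wj by (simp add: F_def)
      then obtain d where "d > 0" "\<forall>a'\<in>A. dist w a' < d \<longrightarrow> a' \<in> F" using F_open by blast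
      moreover obtain a where "a \<in> A \<inter> ball w d" "a \<notin> closure F"
        using w \<open>d > 0\<close> unfolding Fr_def by blast
      ultimately show False using closure_subset[of F] by auto
    qed
    with l show ?thesis by (metis le_neq_implies_less)
  qed
  have "y \<in> A \<inter> B" "b \<in> A \<inter> B" "y \<in> closure F"
    using yF y(2) b closure_subset[of F] by (auto simp: F_def A_def B_def)
  from Fr_I[OF this nb] obtain s where "y + s *\<^sub>R (b - y) \<in> Fr" by blast
  then have ex: "\<exists>l. l < j \<and> Fr \<inter> M l \<noteq> {}" using Fr_lower by blast
  \<comment> \<open>With \<open>l\<close> maximal, \<open>Fr\<close> stays inside \<open>M l\<close> near \<open>w\<close>: larger indices are excluded by
    maximality, smaller ones by flatness of \<open>M l\<close>.\<close>
  define l where "l = Max {l. l < j \<and> Fr \<inter> M l \<noteq> {}}"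
  have fin: "finite {l. l < j \<and> Fr \<inter> M l \<noteq> {}}" by simp
  have l: "l < j" "Fr \<inter> M l \<noteq> {}"
    using Max_in[OF fin] ex unfolding l_def by auto
  have l_max: "l' \<le> l" if "l' < j" "w \<in> Fr" "w \<in> M l'" for l' w
    unfolding l_def using that by (intro Max_ge[OF fin]) auto
  obtain w where w: "w \<in> Fr" "w \<in> M l" using l(2) by blast
  then have wA: "w \<in> A" "w \<in> B" "w \<in> closure F" by (auto simp: Fr_def)
  obtain r where r: "flat_at M l w r (tangent_space (M l) w)"
    using stratum_flat[OF strat _ w(2)] l(1) j by (metis less_imp_le order_trans)
  define V where "V = tangent_space (M l) w"
  note fV = flat_atD[OF r, folded V_def]
  have zw: "z - w \<in> V" using lower[OF l(1) w(2)] wA(2) by (simp add: V_def B_def)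
  have zwT: "z - w \<notin> T"
    using bad subspace_add[OF sT, of "z - w" "w - y"] wA(1) by (auto simp: A_def)
  define D where "D = V \<inter> T"
  have sD: "subspace D" unfolding D_def by (rule subspace_inter[OF fV(2) sT])
  have "dim D < l"
  proof -
    have "dim D < dim V"
    proof (rule dim_psubset)
      have "span D = D" "span V = V" using sD fV(2) by (simp_all only: span_eq_iff)
      moreover have "D \<subset> V" using zw zwT by (auto simp: D_def)
      ultimately show "span D \<subset> span V" by metis
    qed
    then show ?thesis using fV(3) by simp
  qed
  obtain \<epsilon> where eps: "\<epsilon> > 0" "ball w \<epsilon> \<subseteq> B" "\<epsilon> \<le> r"
  proof -
    obtain e where "e > 0" "ball w e \<subseteq> B"
      using wA(2) open_ball[of z \<rho>] unfolding B_def by (metis openE)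
    then show ?thesis using that[of "min e r"] fV(1) subset_ball[of "min e r" e w] by force
  qed
  obtain g where g: "g \<in> A" "g \<in> ball w \<epsilon>" "g \<notin> closure F"
    using w(1) eps(1) unfolding Fr_def by blast
  obtain f0 where f0: "f0 \<in> F" "dist f0 w < \<epsilon>"
    using wA(3) eps(1) unfolding closure_approachable by blast
  \<comment> \<open>A segment from \<open>f\<close> to \<open>g\<close> can only meet \<open>w + D\<close> if \<open>f - w\<close> lies in \<open>P\<close>, a proper
    subspace of the direction space; so \<open>f\<close> is moved slightly out of it.\<close>
  define P where "P = span (insert (g - w) D)"
  have "dim P \<le> dim D + 1" unfolding P_def by (simp add: dim_insert)
  then have "dim P < dim T" using \<open>dim D < l\<close> l(1) dT by linarith
  then obtain \<tau> where \<tau>: "\<tau> \<in> T" "\<tau> \<notin> P"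
    using dim_subset[of T P] by (meson leD subsetI)
  obtain f where f: "f \<in> F" "f \<in> ball w \<epsilon>" "f - w \<notin> P"
  proof (cases "f0 - w \<in> P")
    case False
    then show ?thesis using that[of f0] f0 by (simp add: dist_commute)
  next
    case True
    obtain d where d: "d > 0" "\<forall>a'\<in>A. dist f0 a' < d \<longrightarrow> a' \<in> F" using F_open[OF f0(1)] by blast
    define h where "h = min d (\<epsilon> - dist f0 w) / (2 * (norm \<tau> + 1))"
    have n: "norm \<tau> + 1 > 0" by (simp add: add_nonneg_pos)
    have h: "h > 0" using d(1) f0(2) n by (simp add: h_def)
    have "h * norm \<tau> \<le> h * (norm \<tau> + 1)" using h by simp
    also have "\<dots> = min d (\<epsilon> - dist f0 w) / 2"
    proof -
      have "c / (2 * a) * a = c / 2" if "a > 0" for a c :: real using that by simp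
      from this[OF n] show ?thesis unfolding h_def .
    qed
    also have "\<dots> < min d (\<epsilon> - dist f0 w)"
      proof -
      have "0 < min d (\<epsilon> - dist f0 w)" using d(1) f0(2) by simp
      moreover have "c / 2 < c" if "c > 0" for c :: real using that by simp
      ultimately show ?thesis by blast
    qed
    finally have hn: "h * norm \<tau> < d" "h * norm \<tau> < \<epsilon> - dist f0 w" by auto
    have "f0 + h *\<^sub>R \<tau> \<in> A"
      using A_add f0(1) subspace_scale[OF sT \<tau>(1)] by (auto simp: F_def)
    then have "f0 + h *\<^sub>R \<tau> \<in> F" using d(2) hn(1) h by (auto simp: dist_norm)
    moreover have "f0 + h *\<^sub>R \<tau> \<in> ball w \<epsilon>"
      using hn(2) h dist_triangle[of w "f0 + h *\<^sub>R \<tau>" f0] by (simp add: dist_norm norm_minus_commute)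
    moreover have "f0 + h *\<^sub>R \<tau> - w \<notin> P"
    proof
      assume "f0 + h *\<^sub>R \<tau> - w \<in> P"
      then have "(f0 + h *\<^sub>R \<tau> - w) - (f0 - w) \<in> P"
        using True unfolding P_def by (rule span_diff)
      then have "h *\<^sub>R \<tau> \<in> P" by simp
      then have "(1/h) *\<^sub>R (h *\<^sub>R \<tau>) \<in> P" unfolding P_def by (rule span_scale)
      then show False using \<tau>(2) h by simp
    qed
    ultimately show ?thesis by (rule that)
  qed
  have "f \<in> A \<inter> B" "g \<in> A \<inter> B" "f \<in> closure F"
    using f g eps(2) closure_subset[of F] by (auto simp: F_def)
  from Fr_I[OF this g(3)] obtain s where
    s: "0 \<le> s" "s < 1" "f + s *\<^sub>R (g - f) \<in> Fr" by blast
  define w' where "w' = f + s *\<^sub>R (g - f)"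
  have w'b: "w' \<in> ball w \<epsilon>" unfolding w'_def using f g s by (intro B_seg) auto
  obtain l' where l': "l' < j" "w' \<in> M l'" using Fr_lower s(3) unfolding w'_def by blast
  have "l' = l"
    using l_max[OF l'(1) s(3)[folded w'_def] l'(2)] fV(5)[of w' l'] l'(2) w'b eps(3) by force
  then have "w' - w \<in> V" using fV(4)[of w'] l'(2) w'b eps(3) by force
  moreover have "w' - w \<in> T" using A_diff s(3) wA(1) unfolding w'_def Fr_def by blast
  ultimately have "w' - w \<in> P" unfolding P_def D_def by (intro span_base) auto
  moreover have "g - w \<in> P" unfolding P_def by (intro span_base) simp
  ultimately have "(w' - w) - s *\<^sub>R (g - w) \<in> P"
    unfolding P_def by (rule span_diff[OF _ span_scale])
  also have "(w' - w) - s *\<^sub>R (g - w) = (1 - s) *\<^sub>R (f - w)"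
    unfolding w'_def by (simp add: algebra_simps)
  finally have "(1 / (1 - s)) *\<^sub>R ((1 - s) *\<^sub>R (f - w)) \<in> P"
    unfolding P_def by (rule span_scale)
  then show False using f(3) s(2) by simp
qed

text \<open>
  Otherwise there are planes through pieces of \<open>M j\<close> that miss \<open>z\<close> but pass arbitrarily
  close to it. Let \<open>Q\<close> be the set of points approached by such planes. A point of \<open>Q\<close> cannot
  lie on \<open>M j\<close>, since \<open>M j\<close> is a single plane near it: the approaching planes, being densely
  filled by \<open>M j\<close>, would all coincide with this plane, which would then contain \<open>z\<close>. So \<open>Q\<close>
  lies in the lower strata. Near a point of \<open>Q\<close> on a stratum \<open>M l\<close> with \<open>l\<close> as large as
  possible, \<open>Q\<close> is contained in a plane of dimension \<open>l < j\<close>; but \<open>Q\<close> also contains a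
  segment leaving that plane, a limit of segments of the \<open>j\<close>-dimensional planes.
\<close>
lemma conical_step:
  fixes M :: "nat \<Rightarrow> 'a::euclidean_space set"
  assumes strat: "flat_stratification UNIV M" and j: "j \<le> DIM('a)" and \<rho>: "\<rho> > 0"
    and lower: "\<And>i w. i < j \<Longrightarrow> w \<in> M i \<Longrightarrow> w \<in> ball z \<rho> \<Longrightarrow> z - w \<in> tangent_space (M i) w"
  shows "\<exists>\<rho>'>0. \<forall>y\<in>M j \<inter> ball z \<rho>'. z - y \<in> tangent_space (M j) y"
proof (rule ccontr)
  assume "\<not> ?thesis"
  then have neg: "\<exists>y\<in>M j \<inter> ball z \<epsilon>. z - y \<notin> tangent_space (M j) y" if "\<epsilon> > 0" for \<epsilon>
    using that by blast
  \<comment> \<open>The minimum with \<open>\<rho>\<close> keeps \<open>y\<close> in the ball where the lower strata are known to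
    be conical.\<close>
  define bad where "bad \<epsilon> y \<longleftrightarrow> y \<in> M j \<and> y \<in> ball z (min \<epsilon> \<rho>) \<and> z - y \<notin> tangent_space (M j) y" for \<epsilon> y
  define Q where "Q = {x \<in> ball z \<rho>. \<forall>\<epsilon>>0. \<exists>y a. bad \<epsilon> y \<and> a - y \<in> tangent_space (M j) y \<and> dist a x < \<epsilon>}"
  have sT: "subspace (tangent_space (M j) y)" and dT: "dim (tangent_space (M j) y) = j"
    if "y \<in> M j" for y
    using stratum_flat[OF strat j that] flat_atD by metis+
  have "z \<in> Q"
  proof -
    have "\<exists>y a. bad \<epsilon> y \<and> a - y \<in> tangent_space (M j) y \<and> dist a z < \<epsilon>" if eps: "\<epsilon> > 0" for \<epsilon>
    proof -
      obtain y where y: "y \<in> M j" "y \<in> ball z (min \<epsilon> \<rho>)" "z - y \<notin> tangent_space (M j) y"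
        using neg[of "min \<epsilon> \<rho>"] eps \<rho> by auto
      then show ?thesis
        by (intro exI[of _ y]) (auto simp: bad_def dist_commute subspace_0[OF sT])
    qed
    then show ?thesis using \<rho> by (auto simp: Q_def)
  qed
  have approx: "\<exists>y f. bad \<epsilon> y \<and> f \<in> M j \<and> dist f x < \<epsilon> \<and> tangent_space (M j) f = tangent_space (M j) y
      \<and> f - y \<in> tangent_space (M j) y" if x: "x \<in> Q" and eps: "\<epsilon> > 0" for x \<epsilon>
  proof -
    define h where "h = min (\<epsilon>/2) (\<rho> - dist z x)"
    have h: "h > 0" using x eps by (auto simp: h_def Q_def)
    obtain y a where ya: "bad h y" "a - y \<in> tangent_space (M j) y" "dist a x < h"
      using x h unfolding Q_def by blast
    have "a \<in> ball z \<rho>" using ya(3) dist_triangle[of z a x] by (simp add: h_def dist_commute)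
    then have "a \<in> closure {f \<in> M j. tangent_space (M j) f = tangent_space (M j) y \<and> f - y \<in> tangent_space (M j) y}"
      using bad_plane_filled[OF strat j lower _ _ refl _ _ ya(2)] ya(1) unfolding bad_def by auto
    then obtain f where f: "f \<in> M j" "tangent_space (M j) f = tangent_space (M j) y"
        "f - y \<in> tangent_space (M j) y" "dist f a < \<epsilon>/2"
      using half_gt_zero[OF eps] unfolding closure_approachable by blast
    have "dist f x < \<epsilon>" using f(4) ya(3) dist_triangle[of f x a] by (simp add: h_def)
    moreover have "bad \<epsilon> y" using ya(1) eps by (auto simp: bad_def h_def)
    ultimately show ?thesis using f by blast
  qed
  have Q_lower: "\<exists>l<j. x \<in> M l" if x: "x \<in> Q" for x
  proof -
    have "x \<in> closure (M j)"
      unfolding closure_approachable using approx[OF x] by blast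
    then obtain l where l: "l \<le> j" "x \<in> M l" by (rule closure_stratum[OF strat j])
    have "l \<noteq> j"
    proof
      assume "l = j"
      with l have xj: "x \<in> M j" by simp
      define V where "V = tangent_space (M j) x"
      obtain r where r: "flat_at M j x r V"
        using stratum_flat[OF strat j xj] unfolding V_def by metis
      note fV = flat_atD[OF r]
      have near: "\<exists>y. y - x \<in> V \<and> dist y z < \<epsilon> \<and> z - y \<notin> V" if eps: "\<epsilon> > 0" for \<epsilon>
      proof -
        obtain y f where yf: "bad (min \<epsilon> r) y" "f \<in> M j" "dist f x < min \<epsilon> r"
          "tangent_space (M j) f = tangent_space (M j) y" "f - y \<in> tangent_space (M j) y"
          using approx[OF x, of "min \<epsilon> r"] eps fV(1) by auto
        have fb: "f \<in> ball x r" using yf(3) by (simp add: dist_commute)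
        have "tangent_space (M j) f = V" using tangent_space_near[OF r yf(2) fb] .
        with yf have "f - y \<in> V" "z - y \<notin> V" "dist y z < \<epsilon>"
          by (auto simp: bad_def dist_commute)
        moreover have "f - x \<in> V" using fV(4)[OF fb] yf(2) by blast
        ultimately show ?thesis using subspace_diff[OF fV(2), of "f - x" "f - y"] by auto
      qed
      have cl: "closed ((\<lambda>v. x + v) ` V)" by (intro closed_translation closed_subspace fV(2))
      have "\<exists>y\<in>(\<lambda>v. x + v) ` V. dist y z < \<epsilon>" if eps: "\<epsilon> > 0" for \<epsilon>
      proof -
        obtain y where "y - x \<in> V" "dist y z < \<epsilon>" using near[OF eps] by blast
        then show ?thesis by (intro bexI[of _ y] image_eqI[of _ _ "y - x"]) auto
      qed
      then have "z \<in> closure ((\<lambda>v. x + v) ` V)" unfolding closure_approachable by blast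
      then have "z \<in> (\<lambda>v. x + v) ` V" using cl by (simp add: closure_closed)
      then have "z - x \<in> V" by auto
      moreover obtain y where "y - x \<in> V" "z - y \<notin> V" using near[of 1] by auto
      ultimately show False using subspace_diff[OF fV(2), of "z - x" "y - x"] by simp
    qed
    with l show ?thesis by (metis le_neq_implies_less)
  qed
  have ex: "\<exists>l. l < j \<and> Q \<inter> M l \<noteq> {}" using Q_lower \<open>z \<in> Q\<close> by blast
  define l where "l = Max {l. l < j \<and> Q \<inter> M l \<noteq> {}}"
  have fin: "finite {l. l < j \<and> Q \<inter> M l \<noteq> {}}" by simp
  have l: "l < j" "Q \<inter> M l \<noteq> {}"
    using Max_in[OF fin] ex unfolding l_def by auto
  have l_max: "l' \<le> l" if "l' < j" "w \<in> Q" "w \<in> M l'" for l' w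
    unfolding l_def using that by (intro Max_ge[OF fin]) auto
  obtain x where x: "x \<in> Q" "x \<in> M l" using l(2) by blast
  define V where "V = tangent_space (M l) x"
  obtain r where r: "flat_at M l x r V"
    using stratum_flat[OF strat _ x(2)] l(1) j unfolding V_def by (metis less_imp_le order_trans)
  note fV = flat_atD[OF r]
  have "\<exists>y a \<tau>. bad (inverse (real (Suc n))) y \<and> a - y \<in> tangent_space (M j) y \<and> dist a x < inverse (real (Suc n))
      \<and> \<tau> \<in> tangent_space (M j) y \<and> norm \<tau> = 1 \<and> (\<forall>v\<in>V. \<tau> \<bullet> v = 0)" for n
  proof -
    have "0 < inverse (real (Suc n))" by simp
    then obtain y a where ya: "bad (inverse (real (Suc n))) y" "a - y \<in> tangent_space (M j) y"
        "dist a x < inverse (real (Suc n))"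
      using x(1) unfolding Q_def by blast
    then have "y \<in> M j" by (simp add: bad_def)
    then obtain \<tau> where "\<tau> \<in> tangent_space (M j) y" "norm \<tau> = 1" "\<And>v. v \<in> V \<Longrightarrow> \<tau> \<bullet> v = 0"
      using orthogonal_direction[OF fV(2) sT, of y] dT[of y] fV(3) l(1) by metis
    then show ?thesis using ya by blast
  qed
  then obtain Y a \<tau> where seq: "\<And>n. bad (inverse (real (Suc n))) (Y n)"
    "\<And>n. a n - Y n \<in> tangent_space (M j) (Y n)" "\<And>n. dist (a n) x < inverse (real (Suc n))"
    "\<And>n. \<tau> n \<in> tangent_space (M j) (Y n)" "\<And>n. norm (\<tau> n) = 1" "\<And>n v. v \<in> V \<Longrightarrow> \<tau> n \<bullet> v = 0"
    by metis
  have "\<forall>n. \<tau> n \<in> sphere 0 1" using seq(5) by simp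
  then obtain t s where t: "t \<in> sphere 0 1" "strict_mono s" "(\<tau> \<circ> s) \<longlonglongrightarrow> t"
    using compact_sphere[of 0 1] unfolding compact_eq_seq_compact_metric seq_compact_def by blast
  have t_orth: "t \<bullet> v = 0" if "v \<in> V" for v
  proof -
    have "(\<lambda>n. (\<tau> \<circ> s) n \<bullet> v) \<longlonglongrightarrow> t \<bullet> v" by (intro tendsto_inner t(3) tendsto_const)
    moreover have "(\<lambda>n. (\<tau> \<circ> s) n \<bullet> v) = (\<lambda>n. 0)" using seq(6)[OF that] by auto
    ultimately show ?thesis using LIMSEQ_unique tendsto_const by metis
  qed
  define h where "h = min r (\<rho> - dist z x) / 2"
  have h: "h > 0" "h < r" "h < \<rho> - dist z x" using fV(1) x(1) by (auto simp: h_def Q_def)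
  define x' where "x' = x + h *\<^sub>R t"
  have xx': "dist x x' = h" using t(1) h(1) by (simp add: x'_def dist_norm)
  have "a \<longlonglongrightarrow> x"
    unfolding tendsto_dist_iff[of a]
    by (rule tendsto_sandwich[OF _ _ tendsto_const LIMSEQ_inverse_real_of_nat])
       (use seq(3) in \<open>auto intro!: always_eventually less_imp_le\<close>)
  from tendsto_add[OF LIMSEQ_subseq_LIMSEQ[OF this t(2)] tendsto_scaleR[OF tendsto_const t(3), of h]]
  have lim: "(\<lambda>n. a (s n) + h *\<^sub>R \<tau> (s n)) \<longlonglongrightarrow> x'" by (simp add: x'_def)
  have "x' \<in> Q"
  proof -
    have "\<exists>y b. bad \<epsilon> y \<and> b - y \<in> tangent_space (M j) y \<and> dist b x' < \<epsilon>" if eps: "\<epsilon> > 0" for \<epsilon>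
    proof -
      have "\<forall>\<^sub>F n in sequentially. inverse (real (Suc n)) < \<epsilon>"
        using LIMSEQ_inverse_real_of_nat eps by (rule order_tendstoD)
      from eventually_conj[OF eventually_subseq[OF t(2) this] tendstoD[OF lim eps]]
      obtain n where n: "inverse (real (Suc (s n))) < \<epsilon>" "dist (a (s n) + h *\<^sub>R \<tau> (s n)) x' < \<epsilon>"
        using eventually_happens'[OF sequentially_bot] by blast
      have "bad \<epsilon> (Y (s n))" using seq(1)[of "s n"] n(1) by (auto simp: bad_def)
      moreover from this have "Y (s n) \<in> M j" by (simp add: bad_def)
      then have "a (s n) + h *\<^sub>R \<tau> (s n) - Y (s n) \<in> tangent_space (M j) (Y (s n))"
        using subspace_add[OF sT seq(2) subspace_scale[OF sT seq(4), of _ h]]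
        by (simp add: algebra_simps)
      ultimately show ?thesis using n(2) by blast
    qed
    moreover have "x' \<in> ball z \<rho>" using xx' h(3) dist_triangle[of z x' x] by simp
    ultimately show ?thesis by (simp add: Q_def)
  qed
  then obtain l' where l': "l' < j" "x' \<in> M l'" using Q_lower by blast
  have x'b: "x' \<in> ball x r" using xx' h(2) by simp
  have "l' = l" using l_max[OF l'(1) \<open>x' \<in> Q\<close> l'(2)] fV(5)[OF x'b l'(2)] by simp
  then have "x' - x \<in> V" using fV(4)[OF x'b] l'(2) by simp
  then have "t \<bullet> (h *\<^sub>R t) = 0" by (intro t_orth) (simp add: x'_def)
  then show False using t(1) h(1) by simp
qed

text \<open>
  Near \<open>z\<close> every stratum is a union of pieces of planes through \<open>z\<close>. The proof goes by
  induction on the dimension of the strata.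
\<close>
lemma flat_stratification_conical:
  fixes M :: "nat \<Rightarrow> 'a::euclidean_space set"
  assumes strat: "flat_stratification UNIV M"
  obtains \<rho> where "\<rho> > 0"
    "\<And>j y. j \<le> DIM('a) \<Longrightarrow> y \<in> M j \<Longrightarrow> y \<in> ball z \<rho> \<Longrightarrow> z - y \<in> tangent_space (M j) y"
proof -
  have "\<exists>\<rho>>0. \<forall>i<j. \<forall>y\<in>M i \<inter> ball z \<rho>. z - y \<in> tangent_space (M i) y" if "j \<le> DIM('a) + 1" for j
    using that
  proof (induction j)
    case 0
    then show ?case by (intro exI[of _ 1]) auto
  next
    case (Suc j)
    then obtain \<rho> where \<rho>: "\<rho> > 0" "\<forall>i<j. \<forall>y\<in>M i \<inter> ball z \<rho>. z - y \<in> tangent_space (M i) y" by auto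
    obtain \<rho>' where \<rho>': "\<rho>' > 0" "\<forall>y\<in>M j \<inter> ball z \<rho>'. z - y \<in> tangent_space (M j) y"
      using conical_step[OF strat _ \<rho>(1), of j z] \<rho>(2) Suc.prems by auto
    show ?case
    proof (intro exI[of _ "min \<rho> \<rho>'"] conjI allI impI ballI)
      fix i y assume "i < Suc j" "y \<in> M i \<inter> ball z (min \<rho> \<rho>')"
      then show "z - y \<in> tangent_space (M i) y"
        using \<rho>(2) \<rho>'(2) by (cases "i = j") auto
    qed (use \<rho> \<rho>' in auto)
  qed
  from this[OF order_refl] show ?thesis using that by (metis IntI Suc_eq_plus1 le_imp_less_Suc)
qed

section \<open>Regular charts\<close>

text \<open>
  Testing the difference of the adjoints against itself moves it onto \<open>f - g\<close>.
\<close>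
lemma adjoint_close:
  fixes f g :: "'a::euclidean_space \<Rightarrow> 'a"
  assumes "linear f" "linear g" "\<And>h. norm (f h - g h) \<le> \<eta> * norm h" "0 \<le> \<eta>"
  shows "norm (adjoint f q - adjoint g q) \<le> \<eta> * norm q"
proof -
  define w where "w = adjoint f q - adjoint g q"
  have "w \<bullet> w = (f w - g w) \<bullet> q"
    using adjoint_works[OF assms(1), of w q] adjoint_works[OF assms(2), of w q]
    by (simp add: w_def inner_diff_right inner_diff_left)
  also have "\<dots> \<le> norm (f w - g w) * norm q" by (rule norm_cauchy_schwarz)
  also have "\<dots> \<le> (\<eta> * norm w) * norm q" using assms(3) by (intro mult_right_mono) auto
  finally have "norm w * norm w \<le> (\<eta> * norm q) * norm w"
    by (simp add: dot_square_norm power2_eq_square mult_ac)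
  then have "norm w \<le> \<eta> * norm q"
    using assms(4) by (cases "w = 0") (auto simp: mult_le_cancel_right)
  then show ?thesis by (simp add: w_def)
qed

abbreviation Der :: "('a::euclidean_space \<Rightarrow> 'a) \<Rightarrow> 'a \<Rightarrow> 'a \<Rightarrow> 'a" where
  "Der \<Psi> y \<equiv> frechet_derivative \<Psi> (at y)"

lemma C11_derivative:
  assumes "C11_coordinates x r \<Psi>" "y \<in> ball x r"
  shows "(\<Psi> has_derivative Der \<Psi> y) (at y)" "linear (Der \<Psi> y)" "bij (Der \<Psi> y)"
proof -
  show d: "(\<Psi> has_derivative Der \<Psi> y) (at y)"
    using assms frechet_derivative_works unfolding C11_coordinates_def by blast
  show "linear (Der \<Psi> y)" using has_derivative_linear[OF d] .
  show "bij (Der \<Psi> y)" using assms unfolding C11_coordinates_def by blast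
qed

lemma C11_derivative_lipschitz:
  assumes "C11_coordinates x r \<Psi>"
  obtains L where "L \<ge> 0"
    "\<And>y y'. y \<in> ball x r \<Longrightarrow> y' \<in> ball x r \<Longrightarrow> onorm (\<lambda>h. Der \<Psi> y h - Der \<Psi> y' h) \<le> L * norm (y - y')"
proof -
  obtain L where L: "\<And>y y'. y \<in> ball x r \<Longrightarrow> y' \<in> ball x r
      \<Longrightarrow> onorm (\<lambda>h. Der \<Psi> y h - Der \<Psi> y' h) \<le> L * norm (y - y')"
    using assms unfolding C11_coordinates_def dist_norm by blast
  have "L * norm (y - y') \<le> \<bar>L\<bar> * norm (y - y')" for y y' by (intro mult_right_mono) auto
  then have "onorm (\<lambda>h. Der \<Psi> y h - Der \<Psi> y' h) \<le> \<bar>L\<bar> * norm (y - y')"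
    if "y \<in> ball x r" "y' \<in> ball x r" for y y'
    using order_trans[OF L[OF that]] by blast
  then show ?thesis using that[of "\<bar>L\<bar>"] by simp
qed

text \<open>
  The second-order remainder is what turns a penalty composed with the chart into a global
  polynomial test function; a merely differentiable chart would not give this directly.
\<close>
lemma C11_taylor:
  assumes "C11_coordinates x r \<Psi>"
  obtains L where "L \<ge> 0"
    "\<And>y y'. y \<in> ball x r \<Longrightarrow> y' \<in> ball x r
      \<Longrightarrow> norm (\<Psi> y' - \<Psi> y - Der \<Psi> y (y' - y)) \<le> L * (norm (y' - y))\<^sup>2"
proof -
  obtain L where L: "L \<ge> 0"
    "\<And>y y'. y \<in> ball x r \<Longrightarrow> y' \<in> ball x r \<Longrightarrow> onorm (\<lambda>h. Der \<Psi> y h - Der \<Psi> y' h) \<le> L * norm (y - y')"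
    using C11_derivative_lipschitz[OF assms] by blast
  have "norm (\<Psi> y' - \<Psi> y - Der \<Psi> y (y' - y)) \<le> L * (norm (y' - y))\<^sup>2"
    if y: "y \<in> ball x r" "y' \<in> ball x r" for y y'
  proof -
    have seg: "closed_segment y y' \<subseteq> ball x r"
      using y by (intro closed_segment_subset convex_ball)
    have "norm (\<Psi> y' - \<Psi> y - Der \<Psi> y (y' - y)) \<le> norm (y' - y) * (L * norm (y' - y))"
    proof (rule differentiable_bound_linearization[where S = "closed_segment y y'" and f' = "Der \<Psi>"])
      show "y + t *\<^sub>R (y' - y) \<in> closed_segment y y'" if "t \<in> {0..1}" for t
        using that by (auto simp: in_segment algebra_simps intro!: exI[of _ t])
      show "(\<Psi> has_derivative Der \<Psi> w) (at w within closed_segment y y')"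
        if "w \<in> closed_segment y y'" for w
        using C11_derivative(1)[OF assms] that seg has_derivative_at_withinI by blast
      show "onorm (Der \<Psi> w - Der \<Psi> y) \<le> L * norm (y' - y)" if "w \<in> closed_segment y y'" for w
      proof -
        have "onorm (Der \<Psi> w - Der \<Psi> y) = onorm (\<lambda>h. Der \<Psi> w h - Der \<Psi> y h)"
          by (simp add: fun_diff_def)
        also have "\<dots> \<le> L * norm (w - y)" using L(2) that seg y by blast
        also have "\<dots> \<le> L * norm (y' - y)"
          using segment_bound1[OF that] L(1) by (intro mult_left_mono) (auto simp: norm_minus_commute)
        finally show ?thesis .
      qed
    qed auto
    then show ?thesis by (simp add: power2_eq_square mult_ac)
  qed
  with L(1) show ?thesis by (rule that)
qed

lemma onorm_diff_bound:
  assumes "linear f" "linear (g :: 'a::euclidean_space \<Rightarrow> 'a)" "onorm (\<lambda>h. f h - g h) \<le> \<eta>"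
  shows "norm (f h - g h) \<le> \<eta> * norm h"
proof -
  have "norm (f h - g h) \<le> onorm (\<lambda>h. f h - g h) * norm h"
    using assms(1,2) by (intro onorm) (auto intro!: bounded_linear_sub simp: linear_conv_bounded_linear)
  also have "\<dots> \<le> \<eta> * norm h" using assms(3) by (intro mult_right_mono) auto
  finally show ?thesis .
qed

text \<open>
  The chart maps a curve in the stratum to a curve in the flat stratum.
\<close>
lemma chart_tangent:
  assumes C: "C11_coordinates x r \<Psi>" and y: "y \<in> ball x r"
    and strata: "\<Psi> ` (N \<inter> ball x r) \<subseteq> Ms j" and flat: "flat_at Ms j (\<Psi> y) \<rho> V"
    and b: "b \<in> tangent_space N y"
  shows "Der \<Psi> y b \<in> V"
proof -
  obtain \<gamma> d where g: "0 < d" "\<gamma> ` {-d<..<d} \<subseteq> N" "\<gamma> 0 = y" "(\<gamma> has_vector_derivative b) (at 0)"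
    using b unfolding tangent_space_def by blast
  have "((\<Psi> \<circ> \<gamma>) has_vector_derivative Der \<Psi> y b) (at 0)"
    using vector_derivative_diff_chain_within[of \<gamma> b 0 UNIV \<Psi> "Der \<Psi> y"] g(3,4)
      C11_derivative(1)[OF C y] has_derivative_at_withinI by auto
  moreover have "\<forall>\<^sub>F s in at 0. (\<Psi> \<circ> \<gamma>) s \<in> Ms j"
  proof -
    have "continuous (at 0) \<gamma>" using g(4) has_vector_derivative_continuous by blast
    then have "(\<gamma> \<longlongrightarrow> y) (at 0)" using g(3) by (simp add: continuous_at)
    then have "\<forall>\<^sub>F s in at 0. \<gamma> s \<in> ball x r"
      using y by (intro topological_tendstoD) auto
    moreover have "\<forall>\<^sub>F s in at 0. \<gamma> s \<in> N"
      unfolding eventually_at using g(1,2)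
      by (intro exI[of _ d]) (auto simp: dist_real_def image_subset_iff abs_less_iff)
    ultimately show ?thesis
      by eventually_elim (use strata in auto)
  qed
  ultimately show ?thesis
    using velocity_in_flat[OF flat, of "\<Psi> \<circ> \<gamma>"] g(3) by simp
qed

text \<open>
  Convergence of the charts in \<open>C\<^sup>1\<close> and continuity of the limit chart are combined
  into one statement about pairs \<open>(e, y)\<close> close to \<open>(0, x)\<close>.
\<close>
lemma chart_near:
  fixes M :: "nat \<Rightarrow> 'a::euclidean_space set"
  assumes chart: "convergence_chart Me M x r Ms \<Psi>e \<Psi>" and \<eta>: "\<eta> > 0"
  obtains d where "0 < d" "d \<le> r" "\<And>y. y \<in> ball x d \<Longrightarrow> dist (\<Psi> y) (\<Psi> x) < \<eta>"
    "\<And>e y. 0 < e \<Longrightarrow> e < d \<Longrightarrow> y \<in> ball x d \<Longrightarrow> dist (\<Psi>e e y) (\<Psi> x) < \<eta>"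
    "\<And>e y q. 0 < e \<Longrightarrow> e < d \<Longrightarrow> y \<in> ball x d \<Longrightarrow>
      norm (adjoint (Der (\<Psi>e e) y) q - adjoint (Der \<Psi> x) q) \<le> \<eta> * norm q"
proof -
  have r: "0 < r" and C: "C11_coordinates x r \<Psi>"
    and Ce: "\<And>e. 0 < e \<Longrightarrow> C11_coordinates x r (\<Psi>e e)"
    and conv: "C1_converges (\<lambda>e. ball x r) \<Psi>e \<Psi>"
    using chart unfolding convergence_chart_def flattening_def by auto
  have xr: "x \<in> ball x r" using r by simp
  obtain e0 where e0: "e0 > 0" "\<And>e y. 0 < e \<Longrightarrow> e < e0 \<Longrightarrow> y \<in> ball x r \<Longrightarrow> dist (\<Psi>e e y) (\<Psi> y) < \<eta>/2"
    "\<And>e y. 0 < e \<Longrightarrow> e < e0 \<Longrightarrow> y \<in> ball x r \<Longrightarrow> onorm (\<lambda>h. Der (\<Psi>e e) y h - Der \<Psi> y h) < \<eta>/2"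
  proof -
    have "\<forall>\<^sub>F e in at_right 0. \<forall>y\<in>ball x r. dist (\<Psi>e e y) (\<Psi> y) < \<eta>/2
        \<and> onorm (\<lambda>h. Der (\<Psi>e e) y h - Der \<Psi> y h) < \<eta>/2"
      using conv half_gt_zero[OF \<eta>] unfolding C1_converges_def by blast
    then show ?thesis unfolding eventually_at_right_field using that by blast
  qed
  obtain L where L: "L \<ge> 0"
    "\<And>y y'. y \<in> ball x r \<Longrightarrow> y' \<in> ball x r \<Longrightarrow> onorm (\<lambda>h. Der \<Psi> y h - Der \<Psi> y' h) \<le> L * norm (y - y')"
    using C11_derivative_lipschitz[OF C] by blast
  have "continuous (at x) \<Psi>" using C11_derivative(1)[OF C xr] has_derivative_continuous by blast
  then obtain d1 where d1: "d1 > 0" "\<And>y. dist y x < d1 \<Longrightarrow> dist (\<Psi> y) (\<Psi> x) < \<eta>/2"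
    using half_gt_zero[OF \<eta>] unfolding continuous_at_eps_delta by blast
  define d where "d = Min {e0, d1, r, \<eta> / (2 * (L + 1))}"
  have d: "0 < d" "d \<le> e0" "d \<le> d1" "d \<le> r" "d \<le> \<eta> / (2 * (L + 1))"
    using e0(1) d1(1) r L(1) \<eta> by (auto simp: d_def)
  have "L * d \<le> (L + 1) * (\<eta> / (2 * (L + 1)))" using L(1) d by (intro mult_mono) auto
  also have "\<dots> = \<eta>/2"
  proof -
    have "c * (\<eta> / (2 * c)) = \<eta>/2" if "c > 0" for c using that by simp
    then show ?thesis using L(1) by (metis add_nonneg_pos zero_less_one)
  qed
  finally have Ld: "L * d \<le> \<eta>/2" .
  show ?thesis
  proof (rule that[OF d(1,4)])
    show near: "dist (\<Psi> y) (\<Psi> x) < \<eta>" if "y \<in> ball x d" for y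
    proof -
      have "dist (\<Psi> y) (\<Psi> x) < \<eta>/2" using that d(3) by (intro d1(2)) (simp add: dist_commute)
      then show ?thesis using \<eta> by simp
    qed
    fix e y assume e: "0 < e" "e < d" and y: "y \<in> ball x d"
    have yr: "y \<in> ball x r" using y d(4) by simp
    have "dist (\<Psi> y) (\<Psi> x) < \<eta>/2" using y d(3) by (intro d1(2)) (simp add: dist_commute)
    moreover have "dist (\<Psi>e e y) (\<Psi> y) < \<eta>/2" using e d(2) yr by (intro e0(2)) auto
    ultimately show "dist (\<Psi>e e y) (\<Psi> x) < \<eta>"
      using dist_triangle[of "\<Psi>e e y" "\<Psi> x" "\<Psi> y"] by linarith
    fix q
    note lin = C11_derivative(2)[OF Ce[OF e(1)] yr] C11_derivative(2)[OF C yr] C11_derivative(2)[OF C xr]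
    have "norm (Der (\<Psi>e e) y h - Der \<Psi> x h) \<le> \<eta> * norm h" for h
    proof -
      have "norm (Der (\<Psi>e e) y h - Der \<Psi> y h) \<le> \<eta>/2 * norm h"
        using e0(3)[OF e(1) _ yr] e(2) d(2) by (intro onorm_diff_bound lin) auto
      moreover have "onorm (\<lambda>h. Der \<Psi> y h - Der \<Psi> x h) \<le> \<eta>/2"
      proof -
        have "onorm (\<lambda>h. Der \<Psi> y h - Der \<Psi> x h) \<le> L * norm (y - x)" by (rule L(2)[OF yr xr])
        also have "\<dots> \<le> L * d" using L(1) y by (intro mult_left_mono) (auto simp: dist_norm norm_minus_commute)
        finally show ?thesis using Ld by simp
      qed
      then have "norm (Der \<Psi> y h - Der \<Psi> x h) \<le> \<eta>/2 * norm h"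
        by (intro onorm_diff_bound lin)
      moreover have "norm (Der (\<Psi>e e) y h - Der \<Psi> x h)
          \<le> norm (Der (\<Psi>e e) y h - Der \<Psi> y h) + norm (Der \<Psi> y h - Der \<Psi> x h)"
        using norm_triangle_ineq[of "Der (\<Psi>e e) y h - Der \<Psi> y h" "Der \<Psi> y h - Der \<Psi> x h"] by simp
      ultimately show ?thesis by (simp add: algebra_simps)
    qed
    then show "norm (adjoint (Der (\<Psi>e e) y) q - adjoint (Der \<Psi> x) q) \<le> \<eta> * norm q"
      using \<eta> by (intro adjoint_close lin) auto
  qed
qed

text \<open>
  Covectors in the original coordinates are controlled by their pull-backs uniformly in \<open>e\<close>,
  because the differential of the limit chart at \<open>x\<close> is invertible.
\<close>
lemma chart_adjoint_lower:
  fixes M :: "nat \<Rightarrow> 'a::euclidean_space set"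
  assumes chart: "convergence_chart Me M x r Ms \<Psi>e \<Psi>"
  obtains c d where "0 < c" "0 < d"
    "\<And>e y q. 0 < e \<Longrightarrow> e < d \<Longrightarrow> y \<in> ball x d \<Longrightarrow> c * norm q \<le> norm (adjoint (Der (\<Psi>e e) y) q)"
proof -
  have r: "0 < r" and C: "C11_coordinates x r \<Psi>"
    using chart unfolding convergence_chart_def flattening_def by auto
  have xr: "x \<in> ball x r" using r by simp
  note D = C11_derivative[OF C xr]
  have "linear (adjoint (Der \<Psi> x))" "inj (adjoint (Der \<Psi> x))"
    using D adjoint_linear by (auto simp: bij_def)
  then obtain b where b: "b > 0" "\<And>q. b * norm q \<le> norm (adjoint (Der \<Psi> x) q)"
    using linear_inj_bounded_below_pos by blast
  obtain d where d: "0 < d" "\<And>e y q. 0 < e \<Longrightarrow> e < d \<Longrightarrow> y \<in> ball x d \<Longrightarrow>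
      norm (adjoint (Der (\<Psi>e e) y) q - adjoint (Der \<Psi> x) q) \<le> b/2 * norm q"
    using chart_near[OF chart half_gt_zero[OF b(1)]] by metis
  have "b/2 * norm q \<le> norm (adjoint (Der (\<Psi>e e) y) q)" if "0 < e" "e < d" "y \<in> ball x d" for e y q
    using d(2)[OF that, of q] b(2)[of q]
      norm_triangle_ineq2[of "adjoint (Der \<Psi> x) q" "adjoint (Der \<Psi> x) q - adjoint (Der (\<Psi>e e) y) q"]
    by (simp add: norm_minus_commute)
  then show ?thesis using that[of "b/2" d] b(1) d(1) by simp
qed

section \<open>Test functions\<close>

lemma C1_test_add:
  assumes "C1_test \<phi> D\<phi> \<phi>t" "C1_test \<psi> D\<psi> \<psi>t"
  shows "C1_test (\<lambda>w. \<phi> w + \<psi> w) (\<lambda>w. D\<phi> w + D\<psi> w) (\<lambda>w. \<phi>t w + \<psi>t w)"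
  unfolding C1_test_def
proof (intro conjI allI)
  fix z
  have "((\<lambda>w. \<phi> w + \<psi> w) has_derivative
      (\<lambda>p. (case p of (h, s) \<Rightarrow> D\<phi> z \<bullet> h + \<phi>t z * s) + (case p of (h, s) \<Rightarrow> D\<psi> z \<bullet> h + \<psi>t z * s))) (at z)"
    using assms unfolding C1_test_def by (intro has_derivative_add) blast+
  then show "((\<lambda>w. \<phi> w + \<psi> w) has_derivative
      (\<lambda>(h, s). (D\<phi> z + D\<psi> z) \<bullet> h + (\<phi>t z + \<psi>t z) * s)) (at z)"
    by (simp add: case_prod_unfold algebra_simps)
qed (use assms in \<open>auto simp: C1_test_def intro!: continuous_intros\<close>)

lemma C1_test_linear:
  "C1_test (\<lambda>w. a \<bullet> (fst w - y)) (\<lambda>w. a) (\<lambda>w. 0)"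
  unfolding C1_test_def by (auto intro!: derivative_eq_intros continuous_intros simp: case_prod_unfold)

lemma C1_test_sqdist:
  fixes z :: "'a::euclidean_space \<times> real"
  shows "C1_test (\<lambda>w. \<kappa> * (dist w z)\<^sup>2) (\<lambda>w. (2 * \<kappa>) *\<^sub>R (fst w - fst z)) (\<lambda>w. 2 * \<kappa> * (snd w - snd z))"
proof -
  have eq: "(\<lambda>w. \<kappa> * (dist w z)\<^sup>2) = (\<lambda>w. \<kappa> * ((fst w - fst z) \<bullet> (fst w - fst z) + (snd w - snd z)\<^sup>2))"
    by (auto simp: dist_norm norm_Pair[symmetric] fun_eq_iff norm_prod_def dot_square_norm)
  have "((\<lambda>w. \<kappa> * ((fst w - fst z) \<bullet> (fst w - fst z) + (snd w - snd z)\<^sup>2)) has_derivative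
      (\<lambda>(h, s). ((2 * \<kappa>) *\<^sub>R (fst w - fst z)) \<bullet> h + 2 * \<kappa> * (snd w - snd z) * s)) (at w)" for w
    by (auto intro!: derivative_eq_intros simp: case_prod_unfold inner_commute algebra_simps)
  then show ?thesis unfolding eq C1_test_def by (auto intro!: continuous_intros)
qed

lemma C1_test_continuous:
  assumes "C1_test \<phi> D\<phi> \<phi>t"
  shows "continuous_on A \<phi>" "continuous_on A D\<phi>" "continuous_on A \<phi>t"
proof -
  show "continuous_on A \<phi>"
    using assms unfolding C1_test_def
    by (meson continuous_at_imp_continuous_on has_derivative_continuous)
  show "continuous_on A D\<phi>" "continuous_on A \<phi>t"
    using assms unfolding C1_test_def by (auto intro: continuous_on_subset)
qed

section \<open>Stability of supersolutions\<close>

lemma lsc_on_uminus: "lsc_on S v \<longleftrightarrow> usc_on S (\<lambda>z. - v z)"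
proof -
  have "(\<forall>a<v z. \<forall>\<^sub>F z' in F. a < v z') \<longleftrightarrow> (\<forall>a>- v z. \<forall>\<^sub>F z' in F. - v z' < a)" for z F
  proof (intro iffI allI impI)
    fix a assume "\<forall>a<v z. \<forall>\<^sub>F z' in F. a < v z'" "- v z < a"
    then have "\<forall>\<^sub>F z' in F. - a < v z'" by (metis minus_less_iff)
    then show "\<forall>\<^sub>F z' in F. - v z' < a" by eventually_elim simp
  next
    fix a assume "\<forall>a>- v z. \<forall>\<^sub>F z' in F. - v z' < a" "a < v z"
    then have "\<forall>\<^sub>F z' in F. - v z' < - a" by (metis neg_less_iff_less)
    then show "\<forall>\<^sub>F z' in F. a < v z'" by eventually_elim simp
  qed
  then show ?thesis unfolding lsc_on_def usc_on_def by blast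
qed

lemma time_slab_compact:
  fixes x :: "'a::euclidean_space"
  assumes "0 < t" "\<delta> < t"
  shows "compact (cball (x, t) \<delta> \<inter> UNIV \<times> {0..T})"
    "w \<in> cball (x, t) \<delta> \<inter> UNIV \<times> {0..T} \<Longrightarrow> w \<in> UNIV \<times> {0<..T}"
proof -
  have "closed (UNIV \<times> {0..T} :: ('a \<times> real) set)" by (intro closed_Times) auto
  then show "compact (cball (x, t) \<delta> \<inter> UNIV \<times> {0..T})" by (intro compact_Int_closed) auto
  assume w: "w \<in> cball (x, t) \<delta> \<inter> UNIV \<times> {0..T}"
  then have "dist t (snd w) < t" using dist_snd_le[of "(x, t)" w] assms(2) by simp
  then have "0 < snd w" by (simp add: dist_real_def abs_if split: if_splits)
  then show "w \<in> UNIV \<times> {0<..T}" using w by auto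
qed

lemma supersolution_stability:
  fixes He :: "real \<Rightarrow> 'a::euclidean_space \<Rightarrow> real \<Rightarrow> 'a \<Rightarrow> ereal"
  assumes super: "\<And>e. 0 < e \<Longrightarrow> supersolution T (He e) (v e)"
    and bdd: "bounded (vlow ` (UNIV \<times> {0..T}))"
    and vlow: "\<And>z. z \<in> UNIV \<times> {0..T} \<Longrightarrow>
      ereal (vlow z) = relaxed_liminf (\<lambda>e. UNIV \<times> {0..T}) (\<lambda>e z. ereal (v e z)) z"
  shows "supersolution T
    (\<lambda>x t p. relaxed_limsup (\<lambda>e. UNIV \<times> {0..T} \<times> UNIV) (\<lambda>e (x, t, p). He e x t p) (x, t, p)) vlow"
proof -
  define S :: "('a \<times> real) set" where "S = UNIV \<times> {0..T}"
  have ubar: "ereal (- vlow z) = relaxed_limsup (\<lambda>e. S) (\<lambda>e z. ereal (- v e z)) z" if "z \<in> S" for z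
    using vlow[of z] that unfolding S_def
    by (simp add: relaxed_liminf_uminus flip: uminus_ereal.simps(1))
  have "lsc_on S vlow"
    unfolding lsc_on_uminus by (rule usc_on_relaxed_limsup[OF ubar])
  moreover have "0 \<le> ereal (\<phi>t (x, t)) + relaxed_limsup (\<lambda>e. UNIV \<times> {0..T} \<times> UNIV)
      (\<lambda>e (x, t, p). He e x t p) (x, t, D\<phi> (x, t))"
    if test: "C1_test \<phi> D\<phi> \<phi>t" and lmin: "local_min_on (UNIV \<times> {0<..T}) (\<lambda>z. vlow z - \<phi> z) (x, t)"
    for \<phi> D\<phi> \<phi>t x t
  proof -
    define z where "z = (x, t)"
    have t: "0 < t" "t \<le> T" using lmin by (auto simp: local_min_on_def)
    obtain d where d: "d > 0" "\<And>w. w \<in> UNIV \<times> {0<..T} \<Longrightarrow> dist w z < d \<Longrightarrow> vlow z - \<phi> z \<le> vlow w - \<phi> w"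
      using lmin unfolding local_min_on_def eventually_at z_def by (metis order_refl)
    define \<delta> where "\<delta> = min d t / 2"
    have \<delta>: "0 < \<delta>" "\<delta> < d" "\<delta> < t" using d(1) t by (auto simp: \<delta>_def)
    define K where "K = cball z \<delta> \<inter> S"
    note slab = time_slab_compact[where x = x and T = T, OF t(1) \<delta>(3), folded S_def z_def, folded K_def]
    \<comment> \<open>The squared distance makes the minimum of \<open>vlow - \<psi>\<close> at \<open>z\<close> strict, and its
      derivatives vanish at \<open>z\<close>.\<close>
    define \<psi> D\<psi> \<psi>t where "\<psi> = (\<lambda>w. \<phi> w + (-1) * (dist w z)\<^sup>2)"
      and "D\<psi> = (\<lambda>w. D\<phi> w + (2 * (-1)) *\<^sub>R (fst w - fst z))"
      and "\<psi>t = (\<lambda>w. \<phi>t w + 2 * (-1) * (snd w - snd z))"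
    have test': "C1_test \<psi> D\<psi> \<psi>t"
      unfolding \<psi>_def D\<psi>_def \<psi>t_def by (rule C1_test_add[OF test C1_test_sqdist])
    have zK: "z \<in> K" and KS: "K \<subseteq> S" and zb: "z \<in> ball z \<delta>" and KU: "S \<inter> ball z \<delta> \<subseteq> K"
      using \<delta> t by (auto simp: K_def S_def z_def)
    have usc: "usc_on S (\<lambda>z. - v e z)" if "0 < e" for e
      using super[OF that] unfolding supersolution_def S_def lsc_on_uminus[symmetric] by blast
    have cont\<psi>: "continuous_on K (\<lambda>w. - \<psi> w)"
      by (intro continuous_intros C1_test_continuous[OF test'])
    obtain E W w where EW: "\<And>n. 0 < E n" "E \<longlonglongrightarrow> 0" "\<And>n. W n \<in> K" "w \<in> K" "W \<longlonglongrightarrow> w"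
      "\<And>n y. y \<in> K \<Longrightarrow> - v (E n) y - - \<psi> y \<le> - v (E n) (W n) - - \<psi> (W n)"
      "- vlow z - - \<psi> z \<le> - vlow w - - \<psi> w"
      by (rule maximizers_converge[OF slab(1) KS zK open_ball[of z \<delta>] zb KU usc cont\<psi> cont\<psi> uniform_limit_const ubar])
        (assumption | rule that)+
    have "vlow z - \<phi> z \<le> vlow w - \<phi> w"
      using d(2) slab(2)[OF EW(4)] EW(4) \<delta>(2) by (auto simp: K_def dist_commute)
    then have "(dist w z)\<^sup>2 \<le> 0" using EW(7)[unfolded \<psi>_def dist_self power_zero_numeral] by linarith
    then have "w = z" by simp
    with EW(5) have Wz: "W \<longlonglongrightarrow> z" by simp
    have ineq: "\<forall>\<^sub>F n in sequentially. ereal (- \<psi>t (W n)) \<le> He (E n) (fst (W n)) (snd (W n)) (D\<psi> (W n))"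
      using topological_tendstoD[OF Wz open_ball, of z \<delta>]
    proof (rule eventually_mono)
      fix n assume n: "W n \<in> ball z \<delta>"
      have "\<forall>\<^sub>F w in at (W n) within UNIV \<times> {0<..T}. w \<in> ball z \<delta>"
        using n by (intro topological_tendstoD[OF tendsto_ident_at]) auto
      moreover have "\<forall>\<^sub>F w in at (W n) within UNIV \<times> {0<..T}. w \<in> UNIV \<times> {0<..T}"
        by (simp add: eventually_at_filter)
      ultimately have "\<forall>\<^sub>F w in at (W n) within UNIV \<times> {0<..T}. v (E n) (W n) - \<psi> (W n) \<le> v (E n) w - \<psi> w"
      proof eventually_elim
        case (elim w)
        then have "w \<in> K" by (auto simp: K_def S_def)
        from EW(6)[OF this, of n] show ?case by simp
      qed
      then have "local_min_on (UNIV \<times> {0<..T}) (\<lambda>z. v (E n) z - \<psi> z) (fst (W n), snd (W n))"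
        using slab(2)[OF EW(3)[of n]] by (simp add: local_min_on_def)
      then have "0 \<le> ereal (\<psi>t (fst (W n), snd (W n)))
          + He (E n) (fst (W n)) (snd (W n)) (D\<psi> (fst (W n), snd (W n)))"
        using super[OF EW(1)[of n]] test' unfolding supersolution_def by blast
      then have "0 \<le> ereal (\<psi>t (W n)) + He (E n) (fst (W n)) (snd (W n)) (D\<psi> (W n))" by simp
      then show "ereal (- \<psi>t (W n)) \<le> He (E n) (fst (W n)) (snd (W n)) (D\<psi> (W n))"
        by (cases "He (E n) (fst (W n)) (snd (W n)) (D\<psi> (W n))") auto
    qed (use \<delta> in auto)
    have cont: "(\<lambda>n. f (W n)) \<longlonglongrightarrow> f z" if "continuous_on UNIV f" for f :: "_ \<Rightarrow> 'z::topological_space"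
      using continuous_on_tendsto_compose[OF that Wz] by simp
    have "(\<lambda>n. ereal (- \<psi>t (W n))) \<longlonglongrightarrow> ereal (- \<psi>t z)"
      by (intro tendsto_intros cont C1_test_continuous[OF test'])
    then have "ereal (- \<psi>t z) = limsup (\<lambda>n. ereal (- \<psi>t (W n)))"
      by (intro lim_imp_Limsup[symmetric] sequentially_bot)
    also have "\<dots> \<le> limsup (\<lambda>n. He (E n) (fst (W n)) (snd (W n)) (D\<psi> (W n)))"
      by (rule Limsup_mono[OF ineq])
    also have "\<dots> = limsup (\<lambda>n. (\<lambda>e (x, t, p). He e x t p) (E n) (fst (W n), snd (W n), D\<psi> (W n)))"
      by simp
    also have "\<dots> \<le> relaxed_limsup (\<lambda>e. UNIV \<times> {0..T} \<times> UNIV) (\<lambda>e (x, t, p). He e x t p) (x, t, D\<psi> z)"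
    proof (rule limsup_le_relaxed_limsup[OF _ EW(2,1)])
      have "(\<lambda>n. D\<psi> (W n)) \<longlonglongrightarrow> D\<psi> z" by (intro cont C1_test_continuous[OF test'])
      then show "(\<lambda>n. (fst (W n), snd (W n), D\<psi> (W n))) \<longlonglongrightarrow> (x, t, D\<psi> z)"
        using tendsto_fst[OF Wz] tendsto_snd[OF Wz] by (auto intro!: tendsto_Pair simp: z_def)
      show "(fst (W n), snd (W n), D\<psi> (W n)) \<in> UNIV \<times> {0..T} \<times> UNIV" for n
        using slab(2)[OF EW(3)[of n]] by (simp add: mem_Times_iff)
    qed
    finally have "ereal (- \<phi>t (x, t)) \<le> relaxed_limsup (\<lambda>e. UNIV \<times> {0..T} \<times> UNIV)
      (\<lambda>e (x, t, p). He e x t p) (x, t, D\<phi> (x, t))" (is "_ \<le> ?R")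
      by (simp add: \<psi>t_def D\<psi>_def z_def)
    then show ?thesis by (cases ?R) auto
  qed
  ultimately show ?thesis using bdd unfolding supersolution_def S_def by blast
qed

section \<open>Normal penalization\<close>

text \<open>
  If the conclusion failed for every \<open>C\<close>, the bound on \<open>u\<close> would force \<open>d\<close> to tend to \<open>0\<close>
  along the violating points, and upper semicontinuity would contradict \<open>strict\<close> at a
  cluster point.
\<close>
lemma penalization_strict:
  fixes u \<psi> d :: "'z::metric_space \<Rightarrow> real"
  assumes u: "usc_on S u" "bounded (u ` S)" and K: "compact K" "K \<subseteq> S"
    and cont: "continuous_on K \<psi>" "continuous_on K d" and d0: "\<And>w. w \<in> K \<Longrightarrow> 0 \<le> d w"
    and strict: "\<And>w. w \<in> K \<Longrightarrow> d w = 0 \<Longrightarrow> u w - \<psi> w < c"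
  obtains C0 where "\<And>C w. C0 \<le> C \<Longrightarrow> w \<in> K \<Longrightarrow> u w - \<psi> w - C * d w < c"
proof (rule ccontr)
  assume "\<not> thesis"
  then have "\<exists>C w. real n \<le> C \<and> w \<in> K \<and> c \<le> u w - \<psi> w - C * d w" for n
    using that[of "real n"] by (meson not_le)
  moreover have "c \<le> u w - \<psi> w - real n * d w" if "real n \<le> C" "w \<in> K" "c \<le> u w - \<psi> w - C * d w" for n C w
    using that mult_right_mono[OF that(1) d0[OF that(2)]] by linarith
  ultimately have "\<forall>n. \<exists>w\<in>K. c \<le> u w - \<psi> w - real n * d w" by blast
  then obtain X where X: "\<And>n. X n \<in> K" "\<And>n. c \<le> u (X n) - \<psi> (X n) - real n * d (X n)" by metis
  obtain w r where w: "w \<in> K" "strict_mono r" "(X \<circ> r) \<longlonglongrightarrow> w"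
    using K(1) X(1) unfolding compact_eq_seq_compact_metric seq_compact_def by blast
  have lim: "(\<lambda>n. f (X (r n))) \<longlonglongrightarrow> f w" if "continuous_on K f" for f :: "'z \<Rightarrow> real"
    using continuous_on_tendsto_compose[OF that w(3,1)] X(1) by (simp add: comp_def)
  obtain B1 where B1: "\<And>z. z \<in> S \<Longrightarrow> \<bar>u z\<bar> \<le> B1"
    using u(2) unfolding bounded_iff by auto
  obtain B2 where B2: "\<And>z. z \<in> K \<Longrightarrow> \<bar>\<psi> z\<bar> \<le> B2"
    using compact_imp_bounded[OF compact_continuous_image[OF cont(1) K(1)]] unfolding bounded_iff by auto
  define B where "B = B1 + B2 - c"
  have nd: "real n * d (X n) \<le> B" for n
    using X(2)[of n] B1[of "X n"] B2[of "X n"] X(1)[of n] K(2) unfolding B_def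
    by (auto simp: abs_le_iff)
  have "(\<lambda>n. d (X (r n))) \<longlonglongrightarrow> 0"
  proof (rule tendsto_sandwich[OF _ _ tendsto_const])
    show "\<forall>\<^sub>F n in sequentially. d (X (r n)) \<le> B * inverse (real n)"
    proof (rule eventually_sequentiallyI[of 1])
      fix n :: nat assume "1 \<le> n"
      then have "1 \<le> r n" using seq_suble[OF w(2), of n] by linarith
      have "real n * d (X (r n)) \<le> real (r n) * d (X (r n))"
        using seq_suble[OF w(2), of n] d0[OF X(1)] by (intro mult_right_mono) auto
      also have "\<dots> \<le> B" by (rule nd)
      finally show "d (X (r n)) \<le> B * inverse (real n)"
        using \<open>1 \<le> n\<close> by (simp add: field_simps)
    qed
    show "(\<lambda>n. B * inverse (real n)) \<longlonglongrightarrow> 0"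
      using tendsto_mult_right_zero[OF lim_inverse_n, of B] by simp
  qed (use d0 X in auto)
  then have "d w = 0" using LIMSEQ_unique[OF lim[OF cont(2)]] by blast
  with strict w(1) have "u w - \<psi> w < c" by blast
  define \<eta> where "\<eta> = (c - (u w - \<psi> w)) / 2"
  have \<eta>: "\<eta> > 0" using \<open>u w - \<psi> w < c\<close> by (simp add: \<eta>_def)
  have "\<forall>\<^sub>F n in sequentially. u ((X \<circ> r) n) < u w + \<eta>"
    by (rule usc_on_sequentially[OF u(1) _ _ w(3)]) (use w(1) X(1) K(2) \<eta> in auto)
  moreover have "\<forall>\<^sub>F n in sequentially. \<psi> w - \<eta> < \<psi> (X (r n))"
    using order_tendstoD(1)[OF lim[OF cont(1)], of "\<psi> w - \<eta>"] \<eta> by simp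
  ultimately have "\<forall>\<^sub>F n in sequentially. False"
  proof eventually_elim
    case (elim n)
    have "0 \<le> real (r n) * d (X (r n))" using d0[OF X(1)] by simp
    then show False using elim X(2)[of "r n"] by (simp add: \<eta>_def field_simps)
  qed
  then show False by simp
qed

text \<open>
  A test function must be \<open>C\<^sup>1\<close> on the whole space, which \<open>norm (P (\<Psi> y - z))\<close> is
  not. Where it does not vanish it is touched from above by a quadratic polynomial with the
  same gradient, and this can replace it at a maximum point. The bound comes from
  \<open>2 |a| |a + h| \<le> |a|\<^sup>2 + |a + h|\<^sup>2\<close>, that is
  \<open>|a + h| \<le> |a| + (a / |a|) \<bullet> h + |h|\<^sup>2 / (2 |a|)\<close>.
\<close>
lemma penalty_touch:
  assumes C: "C11_coordinates x r \<Psi>" and y0: "y0 \<in> ball x r"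
    and P: "normal_projection V P" and a: "P (\<Psi> y0 - z) \<noteq> 0"
  obtains \<kappa> where "\<kappa> \<ge> 0" "\<forall>\<^sub>F y in nhds y0. norm (P (\<Psi> y - z)) \<le> norm (P (\<Psi> y0 - z))
      + adjoint (Der \<Psi> y0) (sgn (P (\<Psi> y0 - z))) \<bullet> (y - y0) + \<kappa> * (norm (y - y0))\<^sup>2"
proof -
  obtain L where L: "L \<ge> 0"
    "\<And>y y'. y \<in> ball x r \<Longrightarrow> y' \<in> ball x r
      \<Longrightarrow> norm (\<Psi> y' - \<Psi> y - Der \<Psi> y (y' - y)) \<le> L * (norm (y' - y))\<^sup>2"
    using C11_taylor[OF C] by blast
  note linP = normal_projectionD(1)[OF P]
  define a where "a = P (\<Psi> y0 - z)"
  define n where "n = sgn a"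
  define B where "B = onorm (Der \<Psi> y0)"
  have bl: "bounded_linear (Der \<Psi> y0)"
    using C11_derivative(2)[OF C y0] by (simp add: linear_conv_bounded_linear)
  have B: "B \<ge> 0" unfolding B_def using onorm_pos_le[OF bl] .
  have a0: "norm a > 0" using a by (simp add: a_def)
  have nn: "norm n = 1" using a0 by (simp add: n_def norm_sgn)
  have nP: "n \<bullet> P v = n \<bullet> v" for v
  proof -
    have "n \<bullet> (v - P v) = 0"
      using normal_projectionD(4)[OF P normal_projectionD(3)[OF P]]
      by (simp add: n_def sgn_div_norm a_def)
    then show ?thesis by (simp add: inner_diff_right)
  qed
  \<comment> \<open>\<open>L\<close> bounds the Taylor remainder of the chart, \<open>B + L\<close> its Lipschitz constant at
    distance at most one, and the quotient accounts for the curvature of the norm at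
    distance \<open>norm a\<close> from the origin.\<close>
  define \<kappa> where "\<kappa> = L + (B + L)\<^sup>2 / (2 * norm a)"
  have "norm (P (\<Psi> y - z)) \<le> norm a + adjoint (Der \<Psi> y0) n \<bullet> (y - y0) + \<kappa> * (norm (y - y0))\<^sup>2"
    if y: "y \<in> ball x r" "dist y y0 < 1" for y
  proof -
    define h where "h = P (\<Psi> y - \<Psi> y0)"
    define v where "v = y - y0"
    define R where "R = \<Psi> y - \<Psi> y0 - Der \<Psi> y0 v"
    have R: "norm R \<le> L * (norm v)\<^sup>2" unfolding R_def v_def using L(2)[OF y0 y(1)] .
    have v1: "norm v \<le> 1" using y(2) by (simp add: v_def dist_norm)
    have "(norm v)\<^sup>2 \<le> norm v" using v1 by (simp add: power2_eq_square mult_left_le_one_le)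
    then have "L * (norm v)\<^sup>2 \<le> L * norm v" using L(1) by (rule mult_left_mono)
    moreover have "norm (\<Psi> y - \<Psi> y0) \<le> norm (Der \<Psi> y0 v) + norm R"
      using norm_triangle_ineq[of "Der \<Psi> y0 v" R] by (simp add: R_def)
    moreover have "norm (Der \<Psi> y0 v) \<le> B * norm v" unfolding B_def by (rule onorm[OF bl])
    ultimately have "norm (\<Psi> y - \<Psi> y0) \<le> (B + L) * norm v" using R by (simp add: algebra_simps)
    then have "norm h \<le> (B + L) * norm v"
      unfolding h_def using normal_projection_norm(1)[OF P] order_trans by blast
    then have "(norm h)\<^sup>2 \<le> ((B + L) * norm v)\<^sup>2" by (intro power_mono) auto
    then have h2: "(norm h)\<^sup>2 / (2 * norm a) \<le> (B + L)\<^sup>2 / (2 * norm a) * (norm v)\<^sup>2"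
      using a0 by (simp add: power_mult_distrib divide_right_mono)
    have "P (\<Psi> y - z) = a + h"
      unfolding a_def h_def using linear_add[OF linP, of "\<Psi> y0 - z" "\<Psi> y - \<Psi> y0"] by simp
    moreover have "norm (a + h) \<le> norm a + n \<bullet> h + (norm h)\<^sup>2 / (2 * norm a)"
    proof -
      have "n \<bullet> h = (a \<bullet> h) / norm a"
        by (simp add: n_def sgn_div_norm inverse_eq_divide)
      moreover have "(norm (a + h))\<^sup>2 = (norm a)\<^sup>2 + 2 * (a \<bullet> h) + (norm h)\<^sup>2"
        by (simp add: power2_norm_eq_inner inner_add_left inner_add_right inner_commute)
      moreover have "0 \<le> (norm (a + h) - norm a)\<^sup>2" by simp
      ultimately show ?thesis
        using a0 by (simp add: field_simps power2_eq_square)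
    qed
    moreover have "n \<bullet> h = adjoint (Der \<Psi> y0) n \<bullet> v + n \<bullet> R"
    proof -
      have "n \<bullet> h = n \<bullet> (\<Psi> y - \<Psi> y0)" unfolding h_def by (rule nP)
      also have "\<Psi> y - \<Psi> y0 = Der \<Psi> y0 v + R" by (simp add: R_def)
      finally show ?thesis
        using adjoint_works[OF C11_derivative(2)[OF C y0], of v n]
        by (simp add: inner_add_right inner_commute)
    qed
    moreover have "n \<bullet> R \<le> L * (norm v)\<^sup>2"
      using norm_cauchy_schwarz[of n R] R nn by simp
    ultimately show ?thesis
      using h2 by (simp add: \<kappa>_def v_def[symmetric] algebra_simps)
  qed
  moreover have "\<forall>\<^sub>F y in nhds y0. y \<in> ball x r \<and> dist y y0 < 1"
  proof -
    have "open (ball x r \<inter> ball y0 1)" by (intro open_Int open_ball)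
    moreover have "y0 \<in> ball x r \<inter> ball y0 1" using y0 by simp
    ultimately show ?thesis
      unfolding eventually_nhds by (intro exI[of _ "ball x r \<inter> ball y0 1"]) (auto simp: dist_commute)
  qed
  ultimately have "\<forall>\<^sub>F y in nhds y0. norm (P (\<Psi> y - z)) \<le> norm a + adjoint (Der \<Psi> y0) n \<bullet> (y - y0)
      + \<kappa> * (norm (y - y0))\<^sup>2"
    by (simp add: eventually_mono)
  moreover have "\<kappa> \<ge> 0" using L(1) by (simp add: \<kappa>_def)
  ultimately show ?thesis using that[of \<kappa>] by (simp add: a_def n_def)
qed

text \<open>
  The normal controllability condition applied to the covector \<open>y - z\<close> shows that
  \<open>P (y - z)\<close> is tangent to the stratum. Hence the tangential component \<open>p\<close> of \<open>q + C n\<close>,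
  with \<open>n\<close> the unit vector in this direction, keeps \<open>C n\<close> entirely, and only \<open>q\<close> is
  diminished by the projection.
\<close>
lemma normal_hamiltonian_bound:
  fixes Ms :: "nat \<Rightarrow> 'a::euclidean_space set"
  assumes NC: "NC T Ms D G k z \<rho> V C2 \<delta>" and const: "0 < C2" "0 < \<delta>"
    and P: "normal_projection V P" and j: "k < j" "j \<le> DIM('a)" and e: "e > 0" and t: "t \<in> {0..T}"
    and y: "y \<in> Ms j" "y \<in> ball z \<rho>" "y \<in> D e"
    and sub: "subspace (tangent_space (Ms j) y)" and cone: "y - z \<in> tangent_space (Ms j) y"
    and a: "P (y - z) \<noteq> 0" and C: "norm q \<le> C"
  obtains p where "\<And>\<tau>. \<tau> \<in> tangent_space (Ms j) y \<Longrightarrow> \<tau> \<bullet> p = \<tau> \<bullet> (q + C *\<^sub>R sgn (P (y - z)))"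
    "ereal (\<delta> * (C - norm q) - C2 * (1 + norm q)) \<le> G e j y t p"
proof -
  define S where "S = tangent_space (Ms j) y"
  define n where "n = sgn (P (y - z))"
  note PD = normal_projectionD[OF P]
  have nc: "\<exists>pt\<in>V \<inter> S. \<exists>pn\<in>orthogonal_comp V \<inter> S.
      p = pt + pn \<and> G e j y t p \<ge> ereal (\<delta> * norm pn - C2 * (1 + norm pt))" if "p \<in> S" for p
    using NC e j t y that unfolding NC_def S_def by blast
  have split: "P p = pn" if "p = pt + pn" "pt \<in> V" "pn \<in> orthogonal_comp V" for p pt pn
  proof -
    have "P pt = 0" using normal_projection_eq_0[OF P] that by blast
    moreover have "P pn = pn"
      using that(3) by (intro normal_projection_fixes[OF P])
        (simp add: orthogonal_comp_def orthogonal_def inner_commute)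
    ultimately show ?thesis using that(1) linear_add[OF PD(1)] by simp
  qed
  have "P (y - z) \<in> S"
    using nc[OF cone[folded S_def]] split by blast
  then have nS: "n \<in> S" using sub by (simp add: n_def sgn_div_norm S_def subspace_scale)
  have nn: "norm n = 1" using a by (simp add: n_def norm_sgn)
  have Pn: "P n = n"
    by (rule normal_projection_fixes[OF P]) (simp add: n_def sgn_div_norm PD(4))
  obtain PS where PS: "normal_projection S PS"
    using normal_projection_exists sub unfolding S_def by blast
  define q' where "q' = q - PS q"
  have q': "q' \<in> S" "norm q' \<le> norm q"
    unfolding q'_def using normal_projectionD(3)[OF PS] normal_projection_norm(2)[OF PS] by auto
  define p where "p = q' + C *\<^sub>R n"
  have pS: "p \<in> S" unfolding p_def using q'(1) nS sub
    by (simp add: S_def subspace_add subspace_scale)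
  obtain pt pn where pp: "pt \<in> V" "pn \<in> orthogonal_comp V" "p = pt + pn"
    "G e j y t p \<ge> ereal (\<delta> * norm pn - C2 * (1 + norm pt))"
    using nc[OF pS] by blast
  have pn: "pn = P q' + C *\<^sub>R n"
    using split[OF pp(3,1,2)] Pn unfolding p_def
    by (simp add: linear_add[OF PD(1)] linear_scale[OF PD(1)])
  then have pt: "pt = q' - P q'" using pp(3) by (simp add: p_def algebra_simps)
  have "norm (C *\<^sub>R n) \<le> norm pn + norm (P q')"
    using norm_triangle_ineq4[of pn "P q'"] pn by simp
  moreover have "C \<ge> 0" using C norm_ge_zero[of q] by linarith
  ultimately have "C - norm q \<le> norm pn"
    using nn normal_projection_norm(1)[OF P, of q'] q'(2) by simp
  then have "\<delta> * (C - norm q) \<le> \<delta> * norm pn" using const(2) by simp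
  moreover have "norm pt \<le> norm q"
    using normal_projection_norm(2)[OF P, of q'] q'(2) pt by simp
  then have "C2 * (1 + norm pt) \<le> C2 * (1 + norm q)" using const(1) by simp
  ultimately have "ereal (\<delta> * (C - norm q) - C2 * (1 + norm q)) \<le> G e j y t p"
    using order_trans[OF _ pp(4)] by simp
  moreover have "\<tau> \<bullet> p = \<tau> \<bullet> (q + C *\<^sub>R n)" if "\<tau> \<in> S" for \<tau>
    using normal_projectionD(4)[OF PS that, of q]
    by (simp add: p_def q'_def inner_add_right inner_diff_right inner_commute)
  ultimately show ?thesis using that unfolding S_def n_def by blast
qed

lemma stratum_hamiltonian_cong:
  assumes "\<And>b. b \<in> tangent_space (N j) y \<Longrightarrow> b \<bullet> p = b \<bullet> q"
  shows "stratum_hamiltonian BL N j y s p = stratum_hamiltonian BL N j y s q"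
  unfolding stratum_hamiltonian_def by (rule SUP_cong) (use assms in auto)

text \<open>
  A maximum of the penalized function on a higher stratum would contradict the subsolution
  inequality there, because the Hamiltonian grows like \<open>\<delta> C\<close>. The hypotheses on \<open>C\<close>
  only involve bounds that are uniform in \<open>e\<close> and in the maximum point.
\<close>
lemma normal_penalty_inactive:
  fixes Ms N :: "nat \<Rightarrow> 'a::euclidean_space set"
  assumes sub: "subsolution T N (stratum_hamiltonian BL N) u"
    and C11: "C11_coordinates x r \<Psi>"
    and strata: "\<And>j. j \<le> DIM('a) \<Longrightarrow> \<Psi> ` (N j \<inter> ball x r) = Ms j \<inter> \<Psi> ` ball x r"
    and strat: "flat_stratification UNIV Ms" and flat: "flat_at Ms k z \<rho> V"
    and P: "normal_projection V P"
    and NC: "NC T Ms D G k z \<rho> V C2 \<delta>" "0 < C2" "0 < \<delta>"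
    and e: "0 < e" "D e = \<Psi> ` ball x r"
      "G e = (\<lambda>j. rectified (ball x r) \<Psi> (stratum_hamiltonian BL N j))"
    and cone: "\<And>j y. j \<le> DIM('a) \<Longrightarrow> y \<in> Ms j \<Longrightarrow> y \<in> ball z \<rho>' \<Longrightarrow> z - y \<in> tangent_space (Ms j) y"
    and test: "C1_test \<psi> D\<psi> \<psi>t"
    and y0: "y0 \<in> ball x r" "\<Psi> y0 \<in> ball z \<rho>" "\<Psi> y0 \<in> ball z \<rho>'" "y0 \<in> N j" "j \<le> DIM('a)"
    and s0: "s0 \<in> {0<..T}"
    and max: "\<forall>\<^sub>F w in at (y0, s0) within UNIV \<times> {0<..T}.
      u w - \<psi> w - C * norm (P (\<Psi> (fst w) - z)) \<le> u (y0, s0) - \<psi> (y0, s0) - C * norm (P (\<Psi> y0 - z))"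
    and lower: "0 < c" "\<And>q. c * norm q \<le> norm (adjoint (Der \<Psi> y0) q)"
    and B: "norm (D\<psi> (y0, s0)) \<le> c * B" "\<bar>\<psi>t (y0, s0)\<bar> \<le> B'"
    and C: "0 \<le> C" "B \<le> C" "B' < \<delta> * (C - B) - C2 * (1 + B)"
  shows "P (\<Psi> y0 - z) = 0"
proof (rule ccontr)
  assume a: "P (\<Psi> y0 - z) \<noteq> 0"
  define A where "A = Der \<Psi> y0"
  define n where "n = sgn (P (\<Psi> y0 - z))"
  note A = C11_derivative[OF C11 y0(1), folded A_def]
  have inv: "inv_into (ball x r) \<Psi> (\<Psi> y0) = y0"
    using C11 y0(1) unfolding C11_coordinates_def by (simp add: inv_into_f_f)
  have y: "\<Psi> y0 \<in> Ms j" "\<Psi> y0 \<in> \<Psi> ` ball x r"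
    using strata[OF y0(5)] y0(1,4) by blast+
  have "k \<le> j" by (rule flat_atD(5)[OF flat y0(2) y(1)])
  moreover have "k \<noteq> j"
  proof
    assume "k = j"
    then have "\<Psi> y0 - z \<in> V" using flat_atD(4)[OF flat y0(2)] y(1) by simp
    then show False using a normal_projection_eq_0[OF P] by blast
  qed
  ultimately have kj: "k < j" by simp
  define Tj where "Tj = tangent_space (Ms j) (\<Psi> y0)"
  obtain r' where r': "flat_at Ms j (\<Psi> y0) r' Tj"
    using stratum_flat[OF strat y0(5) y(1)] unfolding Tj_def by metis
  have sTj: "subspace Tj" using flat_atD(2)[OF r'] .
  have cone': "\<Psi> y0 - z \<in> Tj"
    using subspace_neg[OF sTj cone[OF y0(5) y(1) y0(3), folded Tj_def]] by simp
  obtain \<kappa> where \<kappa>: "\<kappa> \<ge> 0" "\<forall>\<^sub>F y in nhds y0. norm (P (\<Psi> y - z)) \<le> norm (P (\<Psi> y0 - z))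
      + adjoint A n \<bullet> (y - y0) + \<kappa> * (norm (y - y0))\<^sup>2"
    using penalty_touch[OF C11 y0(1) P a] unfolding A_def n_def by blast
  define \<theta> D\<theta> \<theta>t where "\<theta> = (\<lambda>w. \<psi> w + ((C *\<^sub>R adjoint A n) \<bullet> (fst w - y0) + (C * \<kappa>) * (dist w (y0, s0))\<^sup>2))"
    and "D\<theta> = (\<lambda>w. D\<psi> w + (C *\<^sub>R adjoint A n + (2 * (C * \<kappa>)) *\<^sub>R (fst w - fst (y0, s0))))"
    and "\<theta>t = (\<lambda>w. \<psi>t w + (0 + 2 * (C * \<kappa>) * (snd w - snd (y0, s0))))"
  have test\<theta>: "C1_test \<theta> D\<theta> \<theta>t"
    unfolding \<theta>_def D\<theta>_def \<theta>t_def
    by (rule C1_test_add[OF test C1_test_add[OF C1_test_linear C1_test_sqdist]])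
  have "filterlim fst (nhds y0) (at (y0, s0) within UNIV \<times> {0<..T})"
    using tendsto_fst[OF tendsto_ident_at[of "(y0, s0)" "UNIV \<times> {0<..T}"]] by simp
  from eventually_compose_filterlim[OF \<kappa>(2) this] max
  have max\<theta>: "\<forall>\<^sub>F w in at (y0, s0) within UNIV \<times> {0<..T}. u w - \<theta> w \<le> u (y0, s0) - \<theta> (y0, s0)"
  proof eventually_elim
    case (elim w)
    have "norm (fst w - y0) \<le> dist w (y0, s0)"
      using dist_fst_le[of w "(y0, s0)"] by (simp add: dist_norm)
    then have "(norm (fst w - y0))\<^sup>2 \<le> (dist w (y0, s0))\<^sup>2" by (intro power_mono) auto
    then have "\<kappa> * (norm (fst w - y0))\<^sup>2 \<le> \<kappa> * (dist w (y0, s0))\<^sup>2" using \<kappa>(1) by (rule mult_left_mono)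
    then have "norm (P (\<Psi> (fst w) - z)) \<le> norm (P (\<Psi> y0 - z)) + adjoint A n \<bullet> (fst w - y0)
        + \<kappa> * (dist w (y0, s0))\<^sup>2"
      using elim(1) by linarith
    then have "C * norm (P (\<Psi> (fst w) - z)) \<le> C * (norm (P (\<Psi> y0 - z)) + adjoint A n \<bullet> (fst w - y0)
        + \<kappa> * (dist w (y0, s0))\<^sup>2)"
      using C(1) by (rule mult_left_mono)
    then show ?case using elim(2) by (simp add: \<theta>_def algebra_simps)
  qed
  have "(y0, s0) \<in> N j \<times> {0<..T}" using y0(4) s0 by simp
  moreover have "\<forall>\<^sub>F w in at (y0, s0) within N j \<times> {0<..T}. u w - \<theta> w \<le> u (y0, s0) - \<theta> (y0, s0)"
    by (rule filter_leD[OF at_le max\<theta>]) auto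
  ultimately have "local_max_on (N j \<times> {0<..T}) (\<lambda>w. u w - \<theta> w) (y0, s0)"
    by (simp add: local_max_on_def)
  then have "ereal (\<theta>t (y0, s0)) + stratum_hamiltonian BL N j y0 s0 (D\<theta> (y0, s0)) \<le> 0"
    using sub y0(5) test\<theta> unfolding subsolution_def by blast
  then have visc: "ereal (\<psi>t (y0, s0))
      + stratum_hamiltonian BL N j y0 s0 (D\<psi> (y0, s0) + C *\<^sub>R adjoint A n) \<le> 0"
    by (simp add: \<theta>t_def D\<theta>_def)
  have "surj (adjoint A)" using A(2,3) by (simp add: bij_def)
  then obtain q where q: "adjoint A q = D\<psi> (y0, s0)" by (metis surjD)
  have "c * norm q \<le> c * B" using lower(2)[of q] B(1) by (simp add: A_def[symmetric] q)
  then have qB: "norm q \<le> B" using lower(1) by simp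
  have pre: "s0 \<in> {0..T}" "\<Psi> y0 \<in> D e" "norm q \<le> C" using s0 y(2) e(2) qB C(2) by auto
  obtain p where p: "\<And>\<tau>. \<tau> \<in> Tj \<Longrightarrow> \<tau> \<bullet> p = \<tau> \<bullet> (q + C *\<^sub>R n)"
    "ereal (\<delta> * (C - norm q) - C2 * (1 + norm q)) \<le> G e j (\<Psi> y0) s0 p"
    using normal_hamiltonian_bound[OF NC P kj y0(5) e(1) pre(1) y(1) y0(2) pre(2)
        sTj[unfolded Tj_def] cone'[unfolded Tj_def] a pre(3)]
    unfolding Tj_def n_def by blast
  have "stratum_hamiltonian BL N j y0 s0 (adjoint A p)
      = stratum_hamiltonian BL N j y0 s0 (adjoint A (q + C *\<^sub>R n))"
  proof (rule stratum_hamiltonian_cong)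
    fix b assume "b \<in> tangent_space (N j) y0"
    then have "A b \<in> Tj"
      unfolding A_def by (intro chart_tangent[OF C11 y0(1) _ r']) (use strata[OF y0(5)] in auto)
    from p(1)[OF this] show "b \<bullet> adjoint A p = b \<bullet> adjoint A (q + C *\<^sub>R n)"
      by (simp add: adjoint_works[OF A(2)])
  qed
  also have "adjoint A (q + C *\<^sub>R n) = D\<psi> (y0, s0) + C *\<^sub>R adjoint A n"
    using adjoint_linear[OF A(2)] q by (simp add: linear_add linear_scale)
  finally have "G e j (\<Psi> y0) s0 p = stratum_hamiltonian BL N j y0 s0 (D\<psi> (y0, s0) + C *\<^sub>R adjoint A n)"
    by (simp add: e(3) rectified_def inv A_def)
  moreover have "\<delta> * (C - B) - C2 * (1 + B) \<le> \<delta> * (C - norm q) - C2 * (1 + norm q)"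
    using qB NC(2,3) by (intro diff_mono mult_left_mono) auto
  ultimately have "ereal B' < stratum_hamiltonian BL N j y0 s0 (D\<psi> (y0, s0) + C *\<^sub>R adjoint A n)"
    using C(3) p(2) by (metis ereal_less(2) less_ereal.simps(1) less_le_trans)
  then show False
    using visc B(2) by (cases "stratum_hamiltonian BL N j y0 s0 (D\<psi> (y0, s0) + C *\<^sub>R adjoint A n)") auto
qed

section \<open>Stability of subsolutions\<close>

text \<open>
  The stability of subsolutions at one point \<open>x\<close> of \<open>M k\<close>, read in the chart at \<open>x\<close>. The
  test function stays in the original coordinates, and the charts only enter through the
  penalty and the rectified Hamiltonians; so no common domain for the inverse charts has to
  be found.
\<close>
lemma subsolution_stability_at:
  fixes M :: "nat \<Rightarrow> 'a::euclidean_space set"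
  assumes sub: "\<And>e. 0 < e \<Longrightarrow> subsolution T (Me e) (stratum_hamiltonian (BL e) (Me e)) (u e)"
    and cover: "\<And>e. 0 < e \<Longrightarrow> (\<Union>j\<le>DIM('a). Me e j) = UNIV"
    and bdd: "bounded (ubar ` (UNIV \<times> {0..T}))"
    and ubar: "\<And>z. z \<in> UNIV \<times> {0..T} \<Longrightarrow>
      ereal (ubar z) = relaxed_limsup (\<lambda>e. UNIV \<times> {0..T}) (\<lambda>e z. ereal (u e z)) z"
    and chart: "convergence_chart Me M x r Ms \<Psi>e \<Psi>"
    and NCTC: "uniform_NC_TC T (\<lambda>e. stratum_hamiltonian (BL e) (Me e)) x r Ms \<Psi>e \<Psi>"
    and Hlim: "rectified_liminf T (\<lambda>e. stratum_hamiltonian (BL e) (Me e)) H x r Ms \<Psi>e \<Psi>"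
    and k: "k \<le> DIM('a)" and test: "C1_test \<phi> D\<phi> \<phi>t"
    and lmax: "local_max_on (M k \<times> {0<..T}) (\<lambda>w. ubar w - \<phi> w) (x, t)"
  shows "ereal (\<phi>t (x, t)) + H k x t (D\<phi> (x, t)) \<le> 0"
proof -
  define S :: "('a \<times> real) set" where "S = UNIV \<times> {0..T}"
  define w0 where "w0 = (x, t)"
  define z where "z = \<Psi> x"
  have r: "0 < r" and strat: "flat_stratification UNIV Ms" and C11: "C11_coordinates x r \<Psi>"
    and strata: "\<And>j. j \<le> DIM('a) \<Longrightarrow> \<Psi> ` (M j \<inter> ball x r) = Ms j \<inter> \<Psi> ` ball x r"
    and C11e: "\<And>e. 0 < e \<Longrightarrow> C11_coordinates x r (\<Psi>e e)"
    and stratae: "\<And>e j. 0 < e \<Longrightarrow> j \<le> DIM('a) \<Longrightarrow> \<Psi>e e ` (Me e j \<inter> ball x r) = Ms j \<inter> \<Psi>e e ` ball x r"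
    and conv: "C1_converges (\<lambda>e. ball x r) \<Psi>e \<Psi>"
    using chart unfolding convergence_chart_def flattening_def by auto
  have xr: "x \<in> ball x r" using r by simp
  have t: "0 < t" "t \<le> T" and xM: "x \<in> M k" using lmax by (auto simp: local_max_on_def)
  have zMs: "z \<in> Ms k \<inter> \<Psi> ` ball x r" using strata[OF k] xM xr unfolding z_def by blast
  define D where "D = (\<lambda>e. \<Psi>e e ` ball x r)"
  define G where "G = (\<lambda>e j. rectified (ball x r) (\<Psi>e e) (stratum_hamiltonian (BL e) (Me e) j))"
  obtain \<rho> V C2 \<delta>N where flat: "flat_at Ms k z \<rho> V" and NC: "NC T Ms D G k z \<rho> V C2 \<delta>N"
    and NCc: "0 < C2" "0 < \<delta>N"
    using NCTC k zMs unfolding uniform_NC_TC_def Let_def D_def G_def by blast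
  obtain P where P: "normal_projection V P"
    using normal_projection_exists[OF flat_atD(2)[OF flat]] by blast
  note PD = normal_projectionD[OF P]
  obtain \<rho>' where \<rho>': "\<rho>' > 0" and
    cone: "\<And>j y. j \<le> DIM('a) \<Longrightarrow> y \<in> Ms j \<Longrightarrow> y \<in> ball z \<rho>' \<Longrightarrow> z - y \<in> tangent_space (Ms j) y"
    using flat_stratification_conical[OF strat] by blast
  have "0 < min \<rho> \<rho>'" using \<rho>' flat_atD(1)[OF flat] by simp
  from chart_near[OF chart this] obtain d1 where d1: "0 < d1" "d1 \<le> r"
    "\<And>y. y \<in> ball x d1 \<Longrightarrow> dist (\<Psi> y) z < min \<rho> \<rho>'"
    "\<And>e y. 0 < e \<Longrightarrow> e < d1 \<Longrightarrow> y \<in> ball x d1 \<Longrightarrow> dist (\<Psi>e e y) z < min \<rho> \<rho>'"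
    unfolding z_def by metis
  obtain c d2 where c: "0 < c" and d2: "0 < d2"
    and lower: "\<And>e y q. 0 < e \<Longrightarrow> e < d2 \<Longrightarrow> y \<in> ball x d2 \<Longrightarrow> c * norm q \<le> norm (adjoint (Der (\<Psi>e e) y) q)"
    using chart_adjoint_lower[OF chart] by blast
  obtain d3 where d3: "d3 > 0"
    "\<And>w. w \<in> M k \<times> {0<..T} \<Longrightarrow> dist w w0 < d3 \<Longrightarrow> ubar w - \<phi> w \<le> ubar w0 - \<phi> w0"
    using lmax unfolding local_max_on_def eventually_at w0_def by (metis order_refl)
  define \<delta> where "\<delta> = Min {d1, d2, d3, t} / 2"
  have \<delta>: "0 < \<delta>" "\<delta> < d1" "\<delta> < d2" "\<delta> < d3" "\<delta> < t"
    using d1(1) d2 d3(1) t(1) by (auto simp: \<delta>_def min_def)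
  define K where "K = cball w0 \<delta> \<inter> S"
  note slab = time_slab_compact[where x = x and T = T, OF t(1) \<delta>(5), folded S_def w0_def, folded K_def]
  have Kx: "fst w \<in> ball x d1" "fst w \<in> ball x d2" "fst w \<in> ball x r" "dist w w0 < d3"
    if "w \<in> K" for w
  proof -
    have "dist w0 w \<le> \<delta>" using that by (simp add: K_def)
    moreover have "dist x (fst w) \<le> dist w0 w" using dist_fst_le[of w0 w] by (simp add: w0_def)
    ultimately show "fst w \<in> ball x d1" "fst w \<in> ball x d2" "fst w \<in> ball x r" "dist w w0 < d3"
      using \<delta> d1(2) by (auto simp: dist_commute)
  qed
  define \<psi> D\<psi> \<psi>t where "\<psi> = (\<lambda>w. \<phi> w + 1 * (dist w w0)\<^sup>2)"
    and "D\<psi> = (\<lambda>w. D\<phi> w + (2 * 1) *\<^sub>R (fst w - fst w0))"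
    and "\<psi>t = (\<lambda>w. \<phi>t w + 2 * 1 * (snd w - snd w0))"
  have test\<psi>: "C1_test \<psi> D\<psi> \<psi>t"
    unfolding \<psi>_def D\<psi>_def \<psi>t_def by (rule C1_test_add[OF test C1_test_sqdist])
  note cont\<psi> = C1_test_continuous[OF test\<psi>]
  define pen :: "'a \<times> real \<Rightarrow> real" where "pen = (\<lambda>w. norm (P (\<Psi> (fst w) - z)))"
  have contP: "continuous_on A (\<lambda>y. norm (P (f y - z)))" if "continuous_on A f" for A and f :: "'a \<times> real \<Rightarrow> 'a"
  proof -
    have "continuous_on A (\<lambda>y. f y - z)" using that by (intro continuous_intros)
    from linear_continuous_on_compose[OF this PD(1)] show ?thesis by (rule continuous_on_norm)
  qed
  have contchart: "continuous_on K (\<lambda>w. \<Phi> (fst w))" if "C11_coordinates x r \<Phi>" for \<Phi> :: "'a \<Rightarrow> 'a"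
  proof (rule continuous_on_compose2[OF _ continuous_on_fst[OF continuous_on_id]])
    show "continuous_on (ball x r) \<Phi>"
      using C11_derivative(1)[OF that] by (meson continuous_at_imp_continuous_on has_derivative_continuous)
  qed (use Kx in auto)
  have on_stratum: "fst w \<in> M k" if w: "w \<in> K" and "pen w = 0" for w
  proof -
    have "\<Psi> (fst w) - z \<in> V" using that normal_projection_eq_0[OF P] by (simp add: pen_def)
    moreover have "\<Psi> (fst w) \<in> ball z \<rho>" using d1(3)[OF Kx(1)[OF w]] by (simp add: dist_commute)
    ultimately have "\<Psi> (fst w) \<in> Ms k" using flat_atD(4)[OF flat] by blast
    then have "\<Psi> (fst w) \<in> \<Psi> ` (M k \<inter> ball x r)" using strata[OF k] Kx(3)[OF w] by blast
    then obtain y where "y \<in> M k" "y \<in> ball x r" "\<Psi> (fst w) = \<Psi> y" by blast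
    moreover from this have "fst w = y"
      using C11 Kx(3)[OF w] unfolding C11_coordinates_def inj_on_def by blast
    ultimately show ?thesis by simp
  qed
  have strict: "w = w0" if w: "w \<in> K" and "pen w = 0" and ge: "ubar w0 - \<psi> w0 \<le> ubar w - \<psi> w" for w
  proof -
    have "w \<in> M k \<times> {0<..T}"
      using on_stratum[OF w \<open>pen w = 0\<close>] slab(2)[OF w] by (cases w) auto
    then have "ubar w - \<phi> w \<le> ubar w0 - \<phi> w0" using Kx(4)[OF w] by (intro d3(2))
    then have "(dist w w0)\<^sup>2 \<le> 0" using ge[unfolded \<psi>_def dist_self power_zero_numeral] by linarith
    then show ?thesis by simp
  qed
  have usc_ubar: "usc_on S ubar" unfolding S_def by (rule usc_on_relaxed_limsup[OF ubar])
  have KS: "K \<subseteq> S" by (simp add: K_def)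
  have contpen: "continuous_on K pen" unfolding pen_def by (intro contP contchart C11)
  obtain C0 where C0: "\<And>C w. C0 \<le> C \<Longrightarrow> w \<in> K - ball w0 \<delta> \<Longrightarrow> ubar w - \<psi> w - C * pen w < ubar w0 - \<psi> w0"
  proof (rule penalization_strict[OF usc_ubar])
    show "bounded (ubar ` S)" using bdd by (simp add: S_def)
    show "compact (K - ball w0 \<delta>)" using slab(1) by (rule compact_diff) simp
    show "K - ball w0 \<delta> \<subseteq> S" using KS by blast
    show "continuous_on (K - ball w0 \<delta>) \<psi>" by (rule cont\<psi>(1))
    show "continuous_on (K - ball w0 \<delta>) pen" by (rule continuous_on_subset[OF contpen]) blast
    show "0 \<le> pen w" for w by (simp add: pen_def)
    show "ubar w - \<psi> w < ubar w0 - \<psi> w0" if "w \<in> K - ball w0 \<delta>" "pen w = 0" for w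
    proof (rule ccontr)
      assume "\<not> ?thesis"
      then have "w = w0" using that by (intro strict) auto
      then show False using that(1) \<delta>(1) by simp
    qed
  qed (rule that)
  obtain B1 where B1: "\<And>w. w \<in> K \<Longrightarrow> norm (D\<psi> w) \<le> B1"
    using compact_imp_bounded[OF compact_continuous_image[OF cont\<psi>(2) slab(1)]]
    unfolding bounded_iff by auto
  obtain B2 where B2: "\<And>w. w \<in> K \<Longrightarrow> \<bar>\<psi>t w\<bar> \<le> B2"
    using compact_imp_bounded[OF compact_continuous_image[OF cont\<psi>(3) slab(1)]]
    unfolding bounded_iff by auto
  define B where "B = B1 / c"
  have cB: "B1 = c * B" using c by (simp add: B_def)
  \<comment> \<open>Every constant entering \<open>C\<close> depends on the compact set \<open>K\<close>, which was fixed before,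
    and not on \<open>e\<close> or on the maximizers. The additional \<open>1\<close> makes the inequality \<open>CN\<close>
    below strict.\<close>
  define C where "C = Max {0, B, C0, B + (B2 + 1 + C2 * (1 + B)) / \<delta>N}"
  have C: "0 \<le> C" "B \<le> C" "C0 \<le> C" by (auto simp: C_def)
  have CN: "B2 < \<delta>N * (C - B) - C2 * (1 + B)"
  proof -
    have "(B2 + 1 + C2 * (1 + B)) / \<delta>N \<le> C - B" by (simp add: C_def)
    then have "B2 + 1 + C2 * (1 + B) \<le> \<delta>N * (C - B)" using NCc(2) by (simp add: field_simps)
    then show ?thesis by simp
  qed
  define pene :: "real \<Rightarrow> 'a \<times> real \<Rightarrow> real" where "pene = (\<lambda>e w. norm (P (\<Psi>e e (fst w) - z)))"
  have pen_close: "\<bar>pene e w - pen w\<bar> \<le> dist (\<Psi>e e (fst w)) (\<Psi> (fst w))" for e w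
  proof -
    have "\<bar>pene e w - pen w\<bar> \<le> norm (P (\<Psi>e e (fst w) - z) - P (\<Psi> (fst w) - z))"
      unfolding pene_def pen_def by (rule norm_triangle_ineq3)
    also have "\<dots> = norm (P (\<Psi>e e (fst w) - \<Psi> (fst w)))"
      using linear_diff[OF PD(1), of "\<Psi>e e (fst w) - z" "\<Psi> (fst w) - z"] by simp
    also have "\<dots> \<le> dist (\<Psi>e e (fst w)) (\<Psi> (fst w))"
      unfolding dist_norm by (rule normal_projection_norm(1)[OF P])
    finally show ?thesis .
  qed
  have unif: "\<forall>\<^sub>F e in at_right 0. \<forall>w\<in>K. dist (\<Psi>e e (fst w)) (\<Psi> (fst w)) < \<eta>" if "\<eta> > 0" for \<eta>
  proof -
    have "\<forall>\<^sub>F e in at_right 0. \<forall>y\<in>ball x r. dist (\<Psi>e e y) (\<Psi> y) < \<eta>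
        \<and> onorm (\<lambda>h. Der (\<Psi>e e) y h - Der \<Psi> y h) < \<eta>"
      using conv that unfolding C1_converges_def by blast
    then show ?thesis by eventually_elim (use Kx(3) in blast)
  qed
  have w0K: "w0 \<in> K" "w0 \<in> ball w0 \<delta>" "S \<inter> ball w0 \<delta> \<subseteq> K"
    using \<delta> t by (auto simp: K_def S_def w0_def)
  have usc: "usc_on S (u e)" if "0 < e" for e
    using sub[OF that] unfolding subsolution_def S_def by blast
  have cont_e: "continuous_on K (\<lambda>w. \<psi> w + C * pene e w)" if "0 < e" for e
    unfolding pene_def by (intro continuous_intros cont\<psi>(1) contP contchart C11e that)
  have cont_0: "continuous_on K (\<lambda>w. \<psi> w + C * pen w)"
    by (intro continuous_intros cont\<psi>(1) contpen)
  have ulim: "uniform_limit K (\<lambda>e w. \<psi> w + C * pene e w) (\<lambda>w. \<psi> w + C * pen w) (at_right 0)"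
  proof (rule uniform_limitI)
    fix \<eta> :: real assume "\<eta> > 0"
    then have "\<forall>\<^sub>F e in at_right 0. \<forall>w\<in>K. dist (\<Psi>e e (fst w)) (\<Psi> (fst w)) < \<eta> / (C + 1)"
      using C(1) by (intro unif) simp
    then show "\<forall>\<^sub>F e in at_right 0. \<forall>w\<in>K. dist (\<psi> w + C * pene e w) (\<psi> w + C * pen w) < \<eta>"
    proof (rule eventually_mono, intro ballI)
      fix e w assume "\<forall>w\<in>K. dist (\<Psi>e e (fst w)) (\<Psi> (fst w)) < \<eta> / (C + 1)" "w \<in> K"
      then have "\<bar>pene e w - pen w\<bar> < \<eta> / (C + 1)" using pen_close[of e w] by fastforce
      then have "(C + 1) * \<bar>pene e w - pen w\<bar> < \<eta>" using C(1) by (simp add: field_simps)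
      moreover have "C * \<bar>pene e w - pen w\<bar> \<le> (C + 1) * \<bar>pene e w - pen w\<bar>"
        by (intro mult_right_mono) auto
      moreover have "dist (\<psi> w + C * pene e w) (\<psi> w + C * pen w) = C * \<bar>pene e w - pen w\<bar>"
        using C(1) by (simp add: dist_real_def abs_mult flip: right_diff_distrib)
      ultimately show "dist (\<psi> w + C * pene e w) (\<psi> w + C * pen w) < \<eta>" by linarith
    qed
  qed
  obtain E W w where EW: "\<And>n. 0 < E n" "E \<longlonglongrightarrow> 0" "\<And>n. W n \<in> K" "w \<in> K" "W \<longlonglongrightarrow> w"
    "\<And>n y. y \<in> K \<Longrightarrow> u (E n) y - (\<psi> y + C * pene (E n) y) \<le> u (E n) (W n) - (\<psi> (W n) + C * pene (E n) (W n))"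
    "ubar w0 - (\<psi> w0 + C * pen w0) \<le> ubar w - (\<psi> w + C * pen w)"
    by (rule maximizers_converge[OF slab(1) KS w0K(1) open_ball[of w0 \<delta>] w0K(2,3) usc cont_e cont_0 ulim
          ubar[folded S_def]]) (assumption | rule that)+
  have pen0: "pen w0 = 0" by (simp add: pen_def w0_def z_def linear_0[OF PD(1)])
  \<comment> \<open>At this stage the limit point is only known to be interior, and \<open>w = w0\<close> follows
    later, once the maximizers are seen to lie on the \<open>k\<close>-th strata. Interiority is
    enough to make the maximizers local maxima.\<close>
  have wball: "w \<in> ball w0 \<delta>"
  proof (rule ccontr)
    assume "w \<notin> ball w0 \<delta>"
    then have "ubar w - \<psi> w - C * pen w < ubar w0 - \<psi> w0" using EW(4) by (intro C0 C(3)) simp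
    then show False using EW(7) pen0 by simp
  qed
  have "\<forall>\<^sub>F n in sequentially. W n \<in> ball w0 \<delta>"
    using topological_tendstoD[OF EW(5) open_ball wball] .
  moreover have "\<forall>\<^sub>F n in sequentially. E n < min d1 d2"
    using order_tendstoD(2)[OF EW(2), of "min d1 d2"] d1(1) d2 by simp
  ultimately have "\<forall>\<^sub>F n in sequentially. W n \<in> ball w0 \<delta> \<and> E n < min d1 d2"
    by (rule eventually_conj)
  then obtain n0 where n0: "\<And>n. n \<ge> n0 \<Longrightarrow> W n \<in> ball w0 \<delta>" "\<And>n. n \<ge> n0 \<Longrightarrow> E n < min d1 d2"
    unfolding eventually_sequentially by blast
  \<comment> \<open>Lower half-relaxed limits are compared along sequences all of whose terms are
    admissible, so the initial segment is dropped.\<close>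
  define E' W' where "E' = (\<lambda>n. E (n + n0))" and "W' = (\<lambda>n. W (n + n0))"
  have E': "0 < E' n" "E' n < d1" "E' n < d2" for n
    using EW(1) n0(2)[of "n + n0"] by (auto simp: E'_def)
  have W': "W' n \<in> K" "W' n \<in> ball w0 \<delta>" for n
    using EW(3) n0(1)[of "n + n0"] by (auto simp: W'_def)
  have E'0: "E' \<longlonglongrightarrow> 0" and W'w: "W' \<longlonglongrightarrow> w"
    unfolding E'_def W'_def by (intro LIMSEQ_ignore_initial_segment EW)+
  have maxW': "\<forall>\<^sub>F y in at (W' n) within UNIV \<times> {0<..T}.
      u (E' n) y - \<psi> y - C * pene (E' n) y \<le> u (E' n) (W' n) - \<psi> (W' n) - C * pene (E' n) (W' n)" for n
  proof -
    have "\<forall>\<^sub>F y in at (W' n) within UNIV \<times> {0<..T}. y \<in> ball w0 \<delta>"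
      using W'(2)[of n] by (intro topological_tendstoD[OF tendsto_ident_at]) auto
    moreover have "\<forall>\<^sub>F y in at (W' n) within UNIV \<times> {0<..T}. y \<in> UNIV \<times> {0<..T}"
      by (simp add: eventually_at_filter)
    ultimately show ?thesis
    proof eventually_elim
      case (elim y)
      then have "y \<in> K" by (auto simp: K_def S_def)
      from EW(6)[OF this, of "n + n0"] show ?case by (simp add: E'_def W'_def)
    qed
  qed
  have W'S: "snd (W' n) \<in> {0<..T}" for n using slab(2)[OF W'(1)[of n]] by auto
  have W'near: "\<Psi>e (E' n) (fst (W' n)) \<in> ball z \<rho>" "\<Psi>e (E' n) (fst (W' n)) \<in> ball z \<rho>'" for n
    using d1(4)[OF E'(1,2) Kx(1)[OF W'(1)], of n n] by (auto simp: dist_commute)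
  have inactive: "P (\<Psi>e (E' n) (fst (W' n)) - z) = 0" for n
  proof -
    obtain j where j: "j \<le> DIM('a)" "fst (W' n) \<in> Me (E' n) j"
      using cover[OF E'(1)[of n]] by (metis UNIV_I UN_E atMost_iff)
    show ?thesis
    proof (rule normal_penalty_inactive[OF sub[OF E'(1)] C11e[OF E'(1)] stratae[OF E'(1)] strat flat P
          NC NCc E'(1) _ _ cone test\<psi> Kx(3)[OF W'(1)] W'near j(2,1) W'S _ c lower[OF E'(1,3) Kx(2)[OF W'(1)]]
          _ _ C(1,2) CN])
      show "D (E' n) = \<Psi>e (E' n) ` ball x r" by (simp add: D_def)
      show "G (E' n) = (\<lambda>j. rectified (ball x r) (\<Psi>e (E' n)) (stratum_hamiltonian (BL (E' n)) (Me (E' n)) j))"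
        by (simp add: G_def)
      show "norm (D\<psi> (fst (W' n), snd (W' n))) \<le> c * B" using B1[OF W'(1)[of n]] cB by simp
      show "\<bar>\<psi>t (fst (W' n), snd (W' n))\<bar> \<le> B2" using B2[OF W'(1)[of n]] by simp
      show "\<forall>\<^sub>F y in at (fst (W' n), snd (W' n)) within UNIV \<times> {0<..T}.
        u (E' n) y - \<psi> y - C * norm (P (\<Psi>e (E' n) (fst y) - z))
        \<le> u (E' n) (fst (W' n), snd (W' n)) - \<psi> (fst (W' n), snd (W' n))
          - C * norm (P (\<Psi>e (E' n) (fst (W' n)) - z))"
        using maxW'[of n] by (simp add: pene_def)
    qed
  qed
  have pen_lim: "(\<lambda>n. pen (W' n)) \<longlonglongrightarrow> 0"
  proof (rule LIMSEQ_I)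
    fix \<eta> :: real assume "\<eta> > 0"
    have "filterlim E' (at_right 0) sequentially"
      using E'0 E'(1) unfolding filterlim_at by (auto simp: less_imp_neq[symmetric])
    from eventually_compose_filterlim[OF unif[OF \<open>\<eta> > 0\<close>] this]
    have "\<forall>\<^sub>F n in sequentially. norm (pen (W' n) - 0) < \<eta>"
    proof (rule eventually_mono)
      fix n assume "\<forall>w\<in>K. dist (\<Psi>e (E' n) (fst w)) (\<Psi> (fst w)) < \<eta>"
      then have "\<bar>pene (E' n) (W' n) - pen (W' n)\<bar> < \<eta>"
        using pen_close[of "E' n" "W' n"] W'(1)[of n] by fastforce
      then show "norm (pen (W' n) - 0) < \<eta>" using inactive[of n] by (simp add: pene_def)
    qed
    then show "\<exists>no. \<forall>n\<ge>no. norm (pen (W' n) - 0) < \<eta>" by (simp add: eventually_sequentially)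
  qed
  moreover have "(\<lambda>n. pen (W' n)) \<longlonglongrightarrow> pen w"
    using continuous_on_tendsto_compose[OF contpen W'w EW(4)] W'(1) by simp
  ultimately have "pen w = 0" using LIMSEQ_unique by blast
  then have "w = w0" using strict[OF EW(4)] EW(7) pen0 by simp
  with W'w have W'w0: "W' \<longlonglongrightarrow> w0" by simp
  have onMs: "\<Psi>e (E' n) (fst (W' n)) \<in> Ms k" for n
    using inactive[of n] normal_projection_eq_0[OF P] flat_atD(4)[OF flat W'near(1)[of n]] by simp
  have visc: "stratum_hamiltonian (BL (E' n)) (Me (E' n)) k (fst (W' n)) (snd (W' n)) (D\<psi> (W' n))
      \<le> ereal (- \<psi>t (W' n))" for n
  proof -
    have "\<Psi>e (E' n) (fst (W' n)) \<in> \<Psi>e (E' n) ` (Me (E' n) k \<inter> ball x r)"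
      using onMs[of n] stratae[OF E'(1)[of n] k] Kx(3)[OF W'(1)[of n]] by blast
    then obtain y where y: "y \<in> Me (E' n) k" "y \<in> ball x r" "\<Psi>e (E' n) (fst (W' n)) = \<Psi>e (E' n) y" by blast
    then have "fst (W' n) = y"
      using C11e[OF E'(1)[of n]] Kx(3)[OF W'(1)[of n]] unfolding C11_coordinates_def inj_on_def by blast
    then have mem: "W' n \<in> Me (E' n) k \<times> {0<..T}"
      using y(1) W'S[of n] by (cases "W' n") auto
    have "\<forall>\<^sub>F y in at (W' n) within Me (E' n) k \<times> {0<..T}. y \<in> ball w0 \<delta>"
      using W'(2)[of n] by (intro topological_tendstoD[OF tendsto_ident_at]) auto
    moreover have "\<forall>\<^sub>F y in at (W' n) within Me (E' n) k \<times> {0<..T}. y \<in> Me (E' n) k \<times> {0<..T}"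
      by (simp add: eventually_at_filter)
    moreover have "\<forall>\<^sub>F y in at (W' n) within Me (E' n) k \<times> {0<..T}.
      u (E' n) y - \<psi> y - C * pene (E' n) y \<le> u (E' n) (W' n) - \<psi> (W' n) - C * pene (E' n) (W' n)"
      by (rule filter_leD[OF at_le maxW']) auto
    ultimately have "\<forall>\<^sub>F y in at (W' n) within Me (E' n) k \<times> {0<..T}.
      u (E' n) y - \<psi> y \<le> u (E' n) (W' n) - \<psi> (W' n)"
    proof eventually_elim
      case (elim y)
      then have yK: "y \<in> K" by (auto simp: K_def S_def)
      have "fst y \<in> Me (E' n) k" using elim(2) by auto
      then have "\<Psi>e (E' n) (fst y) \<in> Ms k"
        using stratae[OF E'(1)[of n] k] Kx(3)[OF yK] by blast
      moreover have "\<Psi>e (E' n) (fst y) \<in> ball z \<rho>"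
        using d1(4)[OF E'(1,2)[of n] Kx(1)[OF yK]] by (simp add: dist_commute)
      ultimately have "P (\<Psi>e (E' n) (fst y) - z) = 0"
        using flat_atD(4)[OF flat] normal_projection_eq_0[OF P] by blast
      then show ?case using elim(3) inactive[of n] by (simp add: pene_def)
    qed
    with mem have "local_max_on (Me (E' n) k \<times> {0<..T}) (\<lambda>w. u (E' n) w - \<psi> w) (fst (W' n), snd (W' n))"
      by (simp add: local_max_on_def)
    then have "ereal (\<psi>t (fst (W' n), snd (W' n)))
        + stratum_hamiltonian (BL (E' n)) (Me (E' n)) k (fst (W' n)) (snd (W' n)) (D\<psi> (fst (W' n), snd (W' n))) \<le> 0"
      using sub[OF E'(1)[of n]] k test\<psi> unfolding subsolution_def by blast
    then show ?thesis
      by (cases "stratum_hamiltonian (BL (E' n)) (Me (E' n)) k (fst (W' n)) (snd (W' n)) (D\<psi> (W' n))") auto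
  qed
  define A where "A = (\<lambda>n. adjoint (Der (\<Psi>e (E' n)) (fst (W' n))))"
  define A0 where "A0 = adjoint (Der \<Psi> x)"
  \<comment> \<open>\<open>Q n\<close> is the covector whose pull-back by the chart \<open>\<Psi>e (E' n)\<close> is the gradient
    of the test function at \<open>W' n\<close>; its limit \<open>q\<close> rectifies the gradient at the limit
    point.\<close>
  have surjA: "surj (A n)" for n
    using C11_derivative[OF C11e[OF E'(1)] Kx(3)[OF W'(1)], of n n] by (simp add: A_def bij_def)
  have linA: "linear (A n)" for n
    unfolding A_def by (intro adjoint_linear C11_derivative[OF C11e[OF E'(1)] Kx(3)[OF W'(1)]])
  have "surj A0" using C11_derivative[OF C11 xr] by (simp add: A0_def bij_def)
  then obtain q where q: "A0 q = D\<phi> (x, t)" by (metis surjD)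
  have "\<forall>n. \<exists>q. A n q = D\<psi> (W' n)" using surjA by (metis surjD)
  then obtain Q where Q: "\<And>n. A n (Q n) = D\<psi> (W' n)" by metis
  have Alim: "(\<lambda>n. A n q) \<longlonglongrightarrow> A0 q"
  proof (rule LIMSEQ_I)
    fix \<eta> :: real assume \<eta>: "\<eta> > 0"
    define h where "h = \<eta> / (norm q + 1)"
    have n1: "norm q + 1 > 0" by (simp add: add_nonneg_pos)
    then have h: "h > 0" using \<eta> by (simp add: h_def)
    obtain d where d: "0 < d" "\<And>e y q. 0 < e \<Longrightarrow> e < d \<Longrightarrow> y \<in> ball x d \<Longrightarrow>
      norm (adjoint (Der (\<Psi>e e) y) q - adjoint (Der \<Psi> x) q) \<le> h * norm q"
      using chart_near[OF chart h] by metis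
    have "(\<lambda>n. fst (W' n)) \<longlonglongrightarrow> x" using tendsto_fst[OF W'w0] by (simp add: w0_def)
    then have "\<forall>\<^sub>F n in sequentially. fst (W' n) \<in> ball x d"
      using d(1) by (intro topological_tendstoD) auto
    moreover have "\<forall>\<^sub>F n in sequentially. E' n < d" using order_tendstoD(2)[OF E'0 d(1)] .
    ultimately have "\<forall>\<^sub>F n in sequentially. norm (A n q - A0 q) < \<eta>"
    proof eventually_elim
      case (elim n)
      have "norm (A n q - A0 q) \<le> h * norm q"
        unfolding A_def A0_def using d(2)[OF E'(1) elim(2,1)] .
      also have "\<dots> < h * (norm q + 1)" using h by simp
      also have "\<dots> = \<eta>" unfolding h_def using n1 by (metis less_irrefl nonzero_eq_divide_eq)
      finally show ?case .
    qed
    then show "\<exists>no. \<forall>n\<ge>no. norm (A n q - A0 q) < \<eta>" by (simp add: eventually_sequentially)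
  qed
  have D\<psi>lim: "(\<lambda>n. D\<psi> (W' n)) \<longlonglongrightarrow> D\<phi> (x, t)"
    using continuous_on_tendsto_compose[OF cont\<psi>(2)[of UNIV] W'w0] by (simp add: D\<psi>_def w0_def)
  have Qlim: "Q \<longlonglongrightarrow> q"
  proof -
    have "(\<lambda>n. D\<psi> (W' n) - A n q) \<longlonglongrightarrow> D\<phi> (x, t) - A0 q" by (intro tendsto_diff D\<psi>lim Alim)
    then have lim: "(\<lambda>n. (1/c) * norm (D\<psi> (W' n) - A n q)) \<longlonglongrightarrow> 0"
      using q by (intro tendsto_mult_right_zero tendsto_norm_zero) simp
    have le: "norm (Q n - q) \<le> (1/c) * norm (D\<psi> (W' n) - A n q)" for n
    proof -
      have "c * norm (Q n - q) \<le> norm (A n (Q n - q))"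
        unfolding A_def by (rule lower[OF E'(1,3) Kx(2)[OF W'(1)]])
      also have "A n (Q n - q) = D\<psi> (W' n) - A n q" using linear_diff[OF linA] Q by simp
      finally show ?thesis using c by (simp add: field_simps)
    qed
    have "(\<lambda>n. Q n - q) \<longlonglongrightarrow> 0"
      by (rule Lim_null_comparison[OF always_eventually[rule_format, OF le] lim])
    then show ?thesis by (rule LIM_zero_cancel)
  qed
  define Y where "Y = (\<lambda>n. (\<Psi>e (E' n) (fst (W' n)), snd (W' n), Q n))"
  have Ylim: "Y \<longlonglongrightarrow> (z, t, q)"
  proof -
    have "(\<lambda>n. \<Psi>e (E' n) (fst (W' n))) \<longlonglongrightarrow> z"
    proof (rule LIMSEQ_I)
      fix \<eta> :: real assume \<eta>: "\<eta> > 0"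
      obtain d where d: "0 < d" "\<And>e y. 0 < e \<Longrightarrow> e < d \<Longrightarrow> y \<in> ball x d \<Longrightarrow> dist (\<Psi>e e y) (\<Psi> x) < \<eta>"
        using chart_near[OF chart \<eta>] by metis
      have "(\<lambda>n. fst (W' n)) \<longlonglongrightarrow> x" using tendsto_fst[OF W'w0] by (simp add: w0_def)
      then have "\<forall>\<^sub>F n in sequentially. fst (W' n) \<in> ball x d"
        using d(1) by (intro topological_tendstoD) auto
      moreover have "\<forall>\<^sub>F n in sequentially. E' n < d" using order_tendstoD(2)[OF E'0 d(1)] .
      ultimately have "\<forall>\<^sub>F n in sequentially. norm (\<Psi>e (E' n) (fst (W' n)) - z) < \<eta>"
        by eventually_elim (use d(2)[OF E'(1)] in \<open>auto simp: z_def dist_norm\<close>)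
      then show "\<exists>no. \<forall>n\<ge>no. norm (\<Psi>e (E' n) (fst (W' n)) - z) < \<eta>"
        by (simp add: eventually_sequentially)
    qed
    moreover have "(\<lambda>n. snd (W' n)) \<longlonglongrightarrow> t" using tendsto_snd[OF W'w0] by (simp add: w0_def)
    ultimately show ?thesis unfolding Y_def by (intro tendsto_Pair Qlim)
  qed
  have inv: "inv_into (ball x r) \<Psi> z = x"
    using C11 xr unfolding C11_coordinates_def z_def by (simp add: inv_into_f_f)
  define F where "F = (\<lambda>e (y, t, q). rectified (ball x r) (\<Psi>e e) (stratum_hamiltonian (BL e) (Me e) k) y t q)"
  have FY: "F (E' n) (Y n)
      = stratum_hamiltonian (BL (E' n)) (Me (E' n)) k (fst (W' n)) (snd (W' n)) (D\<psi> (W' n))" for n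
  proof -
    have "inv_into (ball x r) (\<Psi>e (E' n)) (\<Psi>e (E' n) (fst (W' n))) = fst (W' n)"
      using C11e[OF E'(1)[of n]] Kx(3)[OF W'(1)[of n]] unfolding C11_coordinates_def by (simp add: inv_into_f_f)
    then show ?thesis using Q[of n] by (simp add: F_def Y_def rectified_def A_def)
  qed
  have "H k x t (D\<phi> (x, t)) = rectified (ball x r) \<Psi> (H k) z t q"
    using q by (simp add: rectified_def inv A0_def)
  also have "\<dots> = relaxed_liminf (\<lambda>e. (Ms k \<inter> \<Psi>e e ` ball x r) \<times> {0..T} \<times> UNIV) F (z, t, q)"
    using Hlim k zMs t unfolding rectified_liminf_def F_def by auto
  also have "\<dots> \<le> liminf (\<lambda>n. F (E' n) (Y n))"
  proof (rule relaxed_liminf_le_liminf[OF Ylim E'0 E'(1)])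
    fix n
    show "Y n \<in> (Ms k \<inter> \<Psi>e (E' n) ` ball x r) \<times> {0..T} \<times> UNIV"
      using onMs[of n] Kx(3)[OF W'(1)[of n]] W'S[of n] by (simp add: Y_def)
  qed
  also have "\<dots> \<le> liminf (\<lambda>n. ereal (- \<psi>t (W' n)))"
    using visc by (intro Liminf_mono always_eventually) (simp add: FY)
  also have "(\<lambda>n. ereal (- \<psi>t (W' n))) \<longlonglongrightarrow> ereal (- \<psi>t w0)"
    using continuous_on_tendsto_compose[OF cont\<psi>(3)[of UNIV] W'w0] by (intro tendsto_intros) simp
  then have "liminf (\<lambda>n. ereal (- \<psi>t (W' n))) = ereal (- \<psi>t w0)"
    by (intro lim_imp_Liminf) auto
  finally have "H k x t (D\<phi> (x, t)) \<le> ereal (- \<phi>t (x, t))" by (simp add: \<psi>t_def w0_def)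
  then show ?thesis by (cases "H k x t (D\<phi> (x, t))") auto
qed

theorem theorem6p2:
  fixes T :: real
    and BL :: "real \<Rightarrow> 'a::euclidean_space \<times> real \<Rightarrow> ('a \<times> real) set"
    and Me :: "real \<Rightarrow> nat \<Rightarrow> 'a set"
    and M :: "nat \<Rightarrow> 'a set"
  assumes "0 < T"
    and "\<And>e. 0 < e \<Longrightarrow> H_BL T (BL e)"
    and "\<And>e. 0 < e \<Longrightarrow> regular_stratification (Me e)"
    and "\<And>e. 0 < e \<Longrightarrow> adapted T (BL e) (Me e)"
    and "regular_stratification M"
    and "stratifications_converge Me M"
  shows
    "(\<forall>(v :: real \<Rightarrow> 'a \<times> real \<Rightarrow> real) vlow.
        (\<forall>e>0. supersolution T (hamiltonian (BL e)) (v e)) \<and>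
        bounded (vlow ` (UNIV \<times> {0..T})) \<and>
        (\<forall>z\<in>UNIV \<times> {0..T}. ereal (vlow z) =
           relaxed_liminf (\<lambda>e. UNIV \<times> {0..T}) (\<lambda>e z. ereal (v e z)) z)
        \<longrightarrow> supersolution T
              (\<lambda>x t p. relaxed_limsup (\<lambda>e. UNIV \<times> {0..T} \<times> UNIV)
                 (\<lambda>e (x, t, p). hamiltonian (BL e) x t p) (x, t, p)) vlow)
     \<and>
     (\<forall>(u :: real \<Rightarrow> 'a \<times> real \<Rightarrow> real) ubar H R Ms \<Psi>e \<Psi>.
        (\<forall>e>0. subsolution T (Me e) (stratum_hamiltonian (BL e) (Me e)) (u e)) \<and>
        bounded (ubar ` (UNIV \<times> {0..T})) \<and>
        (\<forall>z\<in>UNIV \<times> {0..T}. ereal (ubar z) =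
           relaxed_limsup (\<lambda>e. UNIV \<times> {0..T}) (\<lambda>e z. ereal (u e z)) z) \<and>
        (\<forall>x. convergence_chart Me M x (R x) (Ms x) (\<Psi>e x) (\<Psi> x)) \<and>
        (\<forall>x. uniform_NC_TC T (\<lambda>e. stratum_hamiltonian (BL e) (Me e))
               x (R x) (Ms x) (\<Psi>e x) (\<Psi> x)) \<and>
        (\<forall>x. rectified_liminf T (\<lambda>e. stratum_hamiltonian (BL e) (Me e)) H
               x (R x) (Ms x) (\<Psi>e x) (\<Psi> x))
        \<longrightarrow> subsolution T M H ubar)"
proof (intro conjI allI impI, goal_cases)
  case (1 v vlow)
  then show ?case by (intro supersolution_stability) blast+
next
  case (2 u ubar H R Ms \<Psi>e \<Psi>)
  then have sub: "\<And>e. 0 < e \<Longrightarrow> subsolution T (Me e) (stratum_hamiltonian (BL e) (Me e)) (u e)"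
    and bdd: "bounded (ubar ` (UNIV \<times> {0..T}))"
    and ubar: "\<And>z. z \<in> UNIV \<times> {0..T} \<Longrightarrow>
      ereal (ubar z) = relaxed_limsup (\<lambda>e. UNIV \<times> {0..T}) (\<lambda>e z. ereal (u e z)) z"
    and chart: "\<And>x. convergence_chart Me M x (R x) (Ms x) (\<Psi>e x) (\<Psi> x)"
    and NCTC: "\<And>x. uniform_NC_TC T (\<lambda>e. stratum_hamiltonian (BL e) (Me e)) x (R x) (Ms x) (\<Psi>e x) (\<Psi> x)"
    and Hlim: "\<And>x. rectified_liminf T (\<lambda>e. stratum_hamiltonian (BL e) (Me e)) H
      x (R x) (Ms x) (\<Psi>e x) (\<Psi> x)"
    by blast+
  have cover: "(\<Union>j\<le>DIM('a). Me e j) = UNIV" if "0 < e" for e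
    using assms(3)[OF that] unfolding regular_stratification_def by blast
  have "usc_on (UNIV \<times> {0..T}) ubar" by (rule usc_on_relaxed_limsup[OF ubar])
  then show ?case
    unfolding subsolution_def
    using bdd subsolution_stability_at[OF sub cover bdd ubar chart NCTC Hlim] by blast
qed

end
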